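(* Let $\mathcal U$ be a domain in $\mathbb R^2$, let $(M^3,g)$ be an oriented Riemannian $3$-manifold, and let $f:\mathcal U\to (M^3,g)$ be a front, with unit normal vector field $\nu$, all of whose singular points are non-degenerate. Let $K$ be the Gaussian curvature of $f$ (defined on the set of regular points of $f$) and let $d\hat A=\det_g(f_u,f_v,\nu)\,du\wedge dv$ be the signed area element. Then the $2$-form $K\,d\hat A$ extends smoothly to $\mathcal U$. Moreover, for each singular point $p\in\mathcal U$ of $f$ the following two conditions are equivalent: (1) the limiting normal curvature $\kappa_\nu(p)$ is equal to zero; (2) the smooth extension of the $2$-form $K\,d\hat A$ vanishes at $p$. If $\kappa_\nu(p)\neq 0$, then $K$ is unbounded near $p$ and changes sign between the two sides of the singular curve (near $p$, $K$ is positive on one side of the singular curve and negative on the other side). Furthermore, if $(M^3,g)$ is the Euclidean $3$-space $\mathbb R^3$, then conditions (1) and (2) are equivalent to the condition that the Gauss map $\nu:\mathcal U\to S^2$ of $f$ has a singular point at $p$ (that is, $\nu$ is not an immersion at $p$).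
   Context: All manifolds and maps are $C^\infty$. Write $\langle\cdot,\cdot\rangle=g$, $|\cdot|$ for the norm, $\nabla$ for the Levi-Civita connection and $\det_g$ for the Riemannian volume form of $(M^3,g)$; $f_u=df(\partial_u)$, $f_v=df(\partial_v)$, $f_{uu}=\nabla_{\partial_u}f_u$. Frontals and fronts: a singular point of $f$ is a point at which $f$ is not an immersion; other points are regular. $f$ is a frontal if around each point there is a unit vector field $\nu$ along $f$ with $\nu\perp df(a)$ for all tangent vectors $a$; it is a front if moreover $\nu$, regarded as a map into $TM^3$, is an immersion. A unit normal vector field $\nu$ is fixed. In $\mathbb R^3$, $\nu$ is regarded as a map into the unit sphere $S^2$ (the Gauss map). Non-degenerate singular points: put $\lambda=\det_g(f_u,f_v,\nu)$ for a positively oriented local coordinate system $(u,v)$. A singular point $p$ is non-degenerate if $d\lambda(p)\ne0$. Then $df(p)$ has rank one, and near $p$ the singular set is a regular curve in the source, called the singular curve. Limiting normal curvature: let $p$ be a singular point at which $df(p)$ has rank one. Take a positively oriented local coordinate system $(u,v)$ centered at $p$ with $f_v(p)=0$ (called admissible). Then $\kappa_\nu(p):=\langle f_{uu}(p),\nu(p)\rangle/|f_u(p)|^2$, which does not depend on the choice of such coordinates. Gaussian curvature: $K$ is the Gaussian curvature of the induced metric $f^*g$ on the set of regular points. *)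

theory Defs
  imports "HOL-Analysis.Analysis"
begin

section \<open>Smooth functions between Euclidean spaces\<close>

text \<open>Both notions are meant for open sets \<open>S\<close>.\<close>

primrec Ck_on ::
  "nat \<Rightarrow> 'a::euclidean_space set \<Rightarrow> ('a \<Rightarrow> 'b::real_normed_vector) \<Rightarrow> bool"
where
  "Ck_on 0 S h \<longleftrightarrow> continuous_on S h"
| "Ck_on (Suc k) S h \<longleftrightarrow>
     (\<forall>x\<in>S. h differentiable (at x)) \<and>
     (\<forall>a. Ck_on k S (\<lambda>x. frechet_derivative h (at x) a))"

definition smooth_on :: "'a::euclidean_space set \<Rightarrow> ('a \<Rightarrow> 'b::real_normed_vector) \<Rightarrow> bool" where
  "smooth_on S h \<longleftrightarrow> (\<forall>k. Ck_on k S h)"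

definition partial :: "'n \<Rightarrow> (real^'n \<Rightarrow> 'b::real_normed_vector) \<Rightarrow> real^'n \<Rightarrow> 'b" where
  "partial i h x = frechet_derivative h (at x) (axis i 1)"


section \<open>Oriented Riemannian manifolds\<close>

text \<open>
  A chart is a pair of its domain and its coordinate map. A tangent vector at \<open>q\<close> is the
  family of its coordinate vectors in all charts around \<open>q\<close>, related by the derivatives of the
  transition maps; at every other index the family has the value 0, so that
  equality of tangent vectors is equality of functions.
\<close>

type_synonym ('m, 'n) chart = "'m set \<times> ('m \<Rightarrow> real^'n)"
type_synonym ('m, 'n) tvec = "('m, 'n) chart \<Rightarrow> real^'n"

record ('m, 'n) riem =
  atlas :: "('m, 'n) chart set"
  metric :: "'m \<Rightarrow> ('m, 'n) tvec \<Rightarrow> ('m, 'n) tvec \<Rightarrow> real"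

definition chart_inv :: "('m, 'n) chart \<Rightarrow> real^'n \<Rightarrow> 'm" where
  "chart_inv c = inv_into (fst c) (snd c)"

definition transition :: "('m, 'n) chart \<Rightarrow> ('m, 'n) chart \<Rightarrow> real^'n \<Rightarrow> real^'n" where
  "transition c c' = snd c' \<circ> chart_inv c"

definition is_chart :: "('m::topological_space, 'n::finite) chart \<Rightarrow> bool" where
  "is_chart c \<longleftrightarrow>
     open (fst c) \<and> open (snd c ` fst c) \<and>
     homeomorphism (fst c) (snd c ` fst c) (snd c) (chart_inv c)"

text \<open>The manifold itself is the union of the chart domains.\<close>

definition carrier :: "('m, 'n) riem \<Rightarrow> 'm set" where
  "carrier M = (\<Union>c\<in>atlas M. fst c)"

definition charts_at :: "('m, 'n) riem \<Rightarrow> 'm \<Rightarrow> ('m, 'n) chart set" where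
  "charts_at M q = {c \<in> atlas M. q \<in> fst c}"

definition oriented_smooth_atlas :: "('m::topological_space, 'n::finite) riem \<Rightarrow> bool" where
  "oriented_smooth_atlas M \<longleftrightarrow>
     (\<forall>c\<in>atlas M. is_chart c) \<and>
     (\<forall>c\<in>atlas M. \<forall>c'\<in>atlas M.
        smooth_on (snd c ` (fst c \<inter> fst c')) (transition c c') \<and>
        (\<forall>y \<in> snd c ` (fst c \<inter> fst c').
           det (matrix (frechet_derivative (transition c c') (at y))) > 0))"

definition tangent_space :: "('m, 'n::finite) riem \<Rightarrow> 'm \<Rightarrow> ('m, 'n) tvec set" where
  "tangent_space M q =
     {w. (\<forall>c\<in>charts_at M q. \<forall>c'\<in>charts_at M q.
            w c' = frechet_derivative (transition c c') (at (snd c q)) (w c)) \<and>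
         (\<forall>c. c \<notin> charts_at M q \<longrightarrow> w c = 0)}"

definition coord_vec ::
  "('m, 'n::finite) riem \<Rightarrow> ('m, 'n) chart \<Rightarrow> 'm \<Rightarrow> 'n \<Rightarrow> ('m, 'n) tvec" where
  "coord_vec M c q i = (\<lambda>c'.
     if c' \<in> charts_at M q
     then frechet_derivative (transition c c') (at (snd c q)) (axis i 1) else 0)"

definition metric_matrix ::
  "('m, 'n::finite) riem \<Rightarrow> ('m, 'n) chart \<Rightarrow> real^'n \<Rightarrow> real^'n^'n" where
  "metric_matrix M c y =
     (let q = chart_inv c y in \<chi> i j. metric M q (coord_vec M c q i) (coord_vec M c q j))"

definition riemannian_metric :: "('m, 'n::finite) riem \<Rightarrow> bool" where
  "riemannian_metric M \<longleftrightarrow>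
     (\<forall>q\<in>carrier M.
        (\<forall>v\<in>tangent_space M q. \<forall>w\<in>tangent_space M q. metric M q v w = metric M q w v) \<and>
        (\<forall>v\<in>tangent_space M q. \<forall>w\<in>tangent_space M q. \<forall>z\<in>tangent_space M q. \<forall>a b.
           metric M q (\<lambda>c. a *\<^sub>R v c + b *\<^sub>R w c) z = a * metric M q v z + b * metric M q w z) \<and>
        (\<forall>v\<in>tangent_space M q. v \<noteq> (\<lambda>_. 0) \<longrightarrow> metric M q v v > 0)) \<and>
     (\<forall>c\<in>atlas M. smooth_on (snd c ` fst c) (metric_matrix M c))"

definition oriented_riemannian_manifold ::
  "('m::{t2_space, second_countable_topology}, 'n::finite) riem \<Rightarrow> bool" where
  "oriented_riemannian_manifold M \<longleftrightarrow> oriented_smooth_atlas M \<and> riemannian_metric M"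

text \<open>The value does not depend on the chart, since all charts of the atlas are positively oriented.\<close>

definition volume_form ::
  "('m, 3) riem \<Rightarrow> 'm \<Rightarrow> ('m, 3) tvec \<Rightarrow> ('m, 3) tvec \<Rightarrow> ('m, 3) tvec \<Rightarrow> real" where
  "volume_form M q v w z =
     (let c = SOME c. c \<in> charts_at M q
      in sqrt (det (metric_matrix M c (snd c q))) * det (vector [v c, w c, z c] :: real^3^3))"

definition euclidean_chart :: "(real^'n, 'n) chart" where
  "euclidean_chart = (UNIV, id)"

definition euclidean_space_riem :: "(real^'n, 'n::finite) riem" where
  "euclidean_space_riem =
     \<lparr>atlas = {euclidean_chart}, metric = (\<lambda>q v w. v euclidean_chart \<bullet> w euclidean_chart)\<rparr>"


section \<open>Levi-Civita connection and curvature in coordinates\<close>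

text \<open>\<open>christoffel G x k i j\<close> is \<open>\<Gamma>\<^sup>k\<^sub>i\<^sub>j\<close> of the metric with matrix function \<open>G\<close>.\<close>

definition christoffel ::
  "(real^'n \<Rightarrow> real^'n^'n) \<Rightarrow> real^'n::finite \<Rightarrow> 'n \<Rightarrow> 'n \<Rightarrow> 'n \<Rightarrow> real" where
  "christoffel G x k i j =
     (\<Sum>l\<in>UNIV. matrix_inv (G x) $ k $ l *
        (partial i (\<lambda>y. G y $ j $ l) x + partial j (\<lambda>y. G y $ i $ l) x
         - partial l (\<lambda>y. G y $ i $ j) x)) / 2"

text \<open>
  \<open>curvature G x l i j k\<close> is the \<open>l\<close>-th component of \<open>R(\<partial>\<^sub>i,\<partial>\<^sub>j)\<partial>\<^sub>k\<close>, where
  \<open>R(X,Y) = \<nabla>\<^sub>X\<nabla>\<^sub>Y - \<nabla>\<^sub>Y\<nabla>\<^sub>X - \<nabla>\<^bsub>[X,Y]\<^esub>\<close>.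
\<close>

definition curvature ::
  "(real^'n \<Rightarrow> real^'n^'n) \<Rightarrow> real^'n::finite \<Rightarrow> 'n \<Rightarrow> 'n \<Rightarrow> 'n \<Rightarrow> 'n \<Rightarrow> real" where
  "curvature G x l i j k =
     partial i (\<lambda>y. christoffel G y l j k) x - partial j (\<lambda>y. christoffel G y l i k) x
     + (\<Sum>m\<in>UNIV. christoffel G x l i m * christoffel G x m j k
                 - christoffel G x l j m * christoffel G x m i k)"

text \<open>The sectional curvature \<open>\<langle>R(\<partial>\<^sub>1,\<partial>\<^sub>2)\<partial>\<^sub>2,\<partial>\<^sub>1\<rangle> / det G\<close> of a metric on a plane domain.\<close>

definition gauss_curv_metric :: "(real^2 \<Rightarrow> real^2^2) \<Rightarrow> real^2 \<Rightarrow> real" where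
  "gauss_curv_metric G x = (\<Sum>l\<in>UNIV. G x $ l $ 1 * curvature G x l 1 2 2) / det (G x)"


section \<open>Maps from plane domains and vector fields along them\<close>

definition smooth_map_into ::
  "('m::topological_space, 'n::finite) riem \<Rightarrow> (real^2) set \<Rightarrow> (real^2 \<Rightarrow> 'm) \<Rightarrow> bool" where
  "smooth_map_into M U f \<longleftrightarrow>
     continuous_on U f \<and> f ` U \<subseteq> carrier M \<and>
     (\<forall>c\<in>atlas M. smooth_on (U \<inter> f -` fst c) (snd c \<circ> f))"

definition tangent_map ::
  "('m, 'n::finite) riem \<Rightarrow> (real^2 \<Rightarrow> 'm) \<Rightarrow> real^2 \<Rightarrow> real^2 \<Rightarrow> ('m, 'n) tvec" where
  "tangent_map M f x a = (\<lambda>c.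
     if c \<in> charts_at M (f x) then frechet_derivative (snd c \<circ> f) (at x) a else 0)"

definition smooth_field_along ::
  "('m, 'n::finite) riem \<Rightarrow> (real^2) set \<Rightarrow> (real^2 \<Rightarrow> 'm) \<Rightarrow> (real^2 \<Rightarrow> ('m, 'n) tvec) \<Rightarrow> bool"
where
  "smooth_field_along M U f X \<longleftrightarrow>
     (\<forall>x\<in>U. X x \<in> tangent_space M (f x)) \<and>
     (\<forall>c\<in>atlas M. smooth_on (U \<inter> f -` fst c) (\<lambda>x. X x c))"

text \<open>The covariant derivative \<open>\<nabla>\<^sub>a X\<close> at \<open>x\<close> of a vector field \<open>X\<close> along \<open>f\<close>.\<close>

definition cov_deriv ::
  "('m, 'n::finite) riem \<Rightarrow> (real^2 \<Rightarrow> 'm) \<Rightarrow> (real^2 \<Rightarrow> ('m, 'n) tvec) \<Rightarrow> real^2 \<Rightarrow> real^2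
   \<Rightarrow> ('m, 'n) tvec" where
  "cov_deriv M f X x a = (\<lambda>c.
     if c \<in> charts_at M (f x) then
       frechet_derivative (\<lambda>y. X y c) (at x) a
       + (\<chi> k. \<Sum>i\<in>UNIV. \<Sum>j\<in>UNIV. christoffel (metric_matrix M c) (snd c (f x)) k i j
                  * tangent_map M f x a c $ i * X x c $ j)
     else 0)"

definition unit_normal_field ::
  "('m, 'n::finite) riem \<Rightarrow> (real^2) set \<Rightarrow> (real^2 \<Rightarrow> 'm) \<Rightarrow> (real^2 \<Rightarrow> ('m, 'n) tvec) \<Rightarrow> bool"
where
  "unit_normal_field M U f \<nu> \<longleftrightarrow>
     smooth_field_along M U f \<nu> \<and>
     (\<forall>x\<in>U. metric M (f x) (\<nu> x) (\<nu> x) = 1 \<and>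
            (\<forall>a. metric M (f x) (\<nu> x) (tangent_map M f x a) = 0))"

text \<open>
  In the chart of the tangent bundle induced by \<open>c\<close>, the map \<open>\<nu>\<close> into the tangent bundle is
  \<open>y \<mapsto> (snd c (f y), \<nu> y c)\<close>.
\<close>

definition front ::
  "('m::topological_space, 3) riem \<Rightarrow> (real^2) set \<Rightarrow> (real^2 \<Rightarrow> 'm)
   \<Rightarrow> (real^2 \<Rightarrow> ('m, 3) tvec) \<Rightarrow> bool" where
  "front M U f \<nu> \<longleftrightarrow>
     smooth_map_into M U f \<and> unit_normal_field M U f \<nu> \<and>
     (\<forall>x\<in>U. \<forall>c\<in>charts_at M (f x).
        inj (frechet_derivative (\<lambda>y. (snd c (f y), \<nu> y c)) (at x)))"

definition singular_set :: "('m, 3) riem \<Rightarrow> (real^2) set \<Rightarrow> (real^2 \<Rightarrow> 'm) \<Rightarrow> (real^2) set" where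
  "singular_set M U f = {x \<in> U. \<not> inj (tangent_map M f x)}"

abbreviation e_u :: "real^2" where "e_u \<equiv> axis 1 1"
abbreviation e_v :: "real^2" where "e_v \<equiv> axis 2 1"

definition area_density ::
  "('m, 3) riem \<Rightarrow> (real^2 \<Rightarrow> 'm) \<Rightarrow> (real^2 \<Rightarrow> ('m, 3) tvec) \<Rightarrow> real^2 \<Rightarrow> real" where
  "area_density M f \<nu> x =
     volume_form M (f x) (tangent_map M f x e_u) (tangent_map M f x e_v) (\<nu> x)"

definition nondegenerate_at ::
  "('m, 3) riem \<Rightarrow> (real^2 \<Rightarrow> 'm) \<Rightarrow> (real^2 \<Rightarrow> ('m, 3) tvec) \<Rightarrow> real^2 \<Rightarrow> bool" where
  "nondegenerate_at M f \<nu> p \<longleftrightarrow> frechet_derivative (area_density M f \<nu>) (at p) \<noteq> (\<lambda>_. 0)"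


section \<open>Gaussian curvature and the signed area element\<close>

definition first_fundamental_form ::
  "('m, 3) riem \<Rightarrow> (real^2 \<Rightarrow> 'm) \<Rightarrow> real^2 \<Rightarrow> real^2^2" where
  "first_fundamental_form M f x =
     (\<chi> i j. metric M (f x) (tangent_map M f x (axis i 1)) (tangent_map M f x (axis j 1)))"

text \<open>Meaningful only at regular points.\<close>

definition gauss_curvature :: "('m, 3) riem \<Rightarrow> (real^2 \<Rightarrow> 'm) \<Rightarrow> real^2 \<Rightarrow> real" where
  "gauss_curvature M f x = gauss_curv_metric (first_fundamental_form M f) x"

type_synonym two_form = "real^2 \<Rightarrow> real^2 \<Rightarrow> real^2 \<Rightarrow> real"

definition du_wedge_dv :: two_form where
  "du_wedge_dv x a b = a $ 1 * b $ 2 - a $ 2 * b $ 1"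

definition signed_area_element ::
  "('m, 3) riem \<Rightarrow> (real^2 \<Rightarrow> 'm) \<Rightarrow> (real^2 \<Rightarrow> ('m, 3) tvec) \<Rightarrow> two_form" where
  "signed_area_element M f \<nu> x a b = area_density M f \<nu> x * du_wedge_dv x a b"

definition smooth_two_form :: "(real^2) set \<Rightarrow> two_form \<Rightarrow> bool" where
  "smooth_two_form U \<omega> \<longleftrightarrow>
     (\<forall>x\<in>U. bilinear (\<omega> x) \<and> (\<forall>a. \<omega> x a a = 0)) \<and>
     (\<forall>a b. smooth_on U (\<lambda>x. \<omega> x a b))"

definition smooth_extension_K_dA ::
  "('m, 3) riem \<Rightarrow> (real^2) set \<Rightarrow> (real^2 \<Rightarrow> 'm) \<Rightarrow> (real^2 \<Rightarrow> ('m, 3) tvec) \<Rightarrow> two_form \<Rightarrow> bool"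
where
  "smooth_extension_K_dA M U f \<nu> \<omega> \<longleftrightarrow>
     smooth_two_form U \<omega> \<and>
     (\<forall>x \<in> U - singular_set M U f. \<forall>a b.
        \<omega> x a b = gauss_curvature M f x * signed_area_element M f \<nu> x a b)"


section \<open>Limiting normal curvature\<close>

text \<open>
  A coordinate system \<open>(u,v)\<close> centered at \<open>p\<close> is given by its inverse \<open>\<psi>\<close>, the
  parametrization of a neighborhood of \<open>p\<close> by a neighborhood \<open>V\<close> of the origin of the
  \<open>(u,v)\<close>-plane.
\<close>

definition positive_coordinates ::
  "(real^2) set \<Rightarrow> real^2 \<Rightarrow> (real^2) set \<Rightarrow> (real^2 \<Rightarrow> real^2) \<Rightarrow> bool" where
  "positive_coordinates U p V \<psi> \<longleftrightarrow>
     open V \<and> 0 \<in> V \<and> \<psi> 0 = p \<and> open (\<psi> ` V) \<and> \<psi> ` V \<subseteq> U \<and> inj_on \<psi> V \<and>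
     smooth_on V \<psi> \<and> smooth_on (\<psi> ` V) (inv_into V \<psi>) \<and>
     (\<forall>y\<in>V. det (matrix (frechet_derivative \<psi> (at y))) > 0)"

definition admissible_coordinates ::
  "('m, 3) riem \<Rightarrow> (real^2) set \<Rightarrow> (real^2 \<Rightarrow> 'm) \<Rightarrow> real^2
   \<Rightarrow> (real^2) set \<Rightarrow> (real^2 \<Rightarrow> real^2) \<Rightarrow> bool" where
  "admissible_coordinates M U f p V \<psi> \<longleftrightarrow>
     positive_coordinates U p V \<psi> \<and> tangent_map M (f \<circ> \<psi>) 0 e_v = (\<lambda>_. 0)"

text \<open>The quotient \<open>\<langle>h\<^sub>u\<^sub>u, n\<rangle> / \<bar>h\<^sub>u\<bar>\<^sup>2\<close> at the origin, for \<open>h\<close> expressed in the coordinates \<open>(u,v)\<close>.\<close>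

definition normal_curvature_quotient ::
  "('m, 3) riem \<Rightarrow> (real^2 \<Rightarrow> 'm) \<Rightarrow> ('m, 3) tvec \<Rightarrow> real" where
  "normal_curvature_quotient M h n =
     metric M (h 0) (cov_deriv M h (\<lambda>y. tangent_map M h y e_u) 0 e_u) n
     / metric M (h 0) (tangent_map M h 0 e_u) (tangent_map M h 0 e_u)"

text \<open>
  \<open>THE\<close> is justified at singular points of rank one: the quotient is the same for all
  admissible coordinates.
\<close>

definition limiting_normal_curvature ::
  "('m, 3) riem \<Rightarrow> (real^2) set \<Rightarrow> (real^2 \<Rightarrow> 'm) \<Rightarrow> (real^2 \<Rightarrow> ('m, 3) tvec) \<Rightarrow> real^2 \<Rightarrow> real"
where
  "limiting_normal_curvature M U f \<nu> p =
     (THE k. \<exists>V \<psi>. admissible_coordinates M U f p V \<psi> \<and>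
                   k = normal_curvature_quotient M (f \<circ> \<psi>) (\<nu> p))"


section \<open>Behaviour near the singular curve\<close>

definition unbounded_near :: "(real^2 \<Rightarrow> real) \<Rightarrow> (real^2) set \<Rightarrow> real^2 \<Rightarrow> bool" where
  "unbounded_near h R p \<longleftrightarrow> (\<forall>W. open W \<and> p \<in> W \<longrightarrow> \<not> bounded (h ` (W \<inter> R)))"

definition two_sides ::
  "(real^2) set \<Rightarrow> (real^2) set \<Rightarrow> (real^2) set \<Rightarrow> (real^2) set \<Rightarrow> bool" where
  "two_sides W C S T \<longleftrightarrow>
     open W \<and> connected W \<and>
     open S \<and> connected S \<and> S \<noteq> {} \<and> open T \<and> connected T \<and> T \<noteq> {} \<and>
     S \<inter> T = {} \<and> S \<union> T = W - C \<and> W \<inter> C \<subseteq> closure S \<inter> closure T"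

definition changes_sign_across :: "(real^2 \<Rightarrow> real) \<Rightarrow> (real^2) set \<Rightarrow> (real^2) set \<Rightarrow> real^2 \<Rightarrow> bool"
where
  "changes_sign_across h U C p \<longleftrightarrow>
     (\<exists>W S T. p \<in> W \<and> W \<subseteq> U \<and> two_sides W C S T \<and> (\<forall>x\<in>S. h x > 0) \<and> (\<forall>x\<in>T. h x < 0))"


section \<open>The Gauss map of a front in Euclidean space\<close>

text \<open>
  As the sphere is an embedded submanifold, the Gauss map is an immersion into the sphere at a
  point iff its derivative as a map into the ambient space is injective there.
\<close>

definition gauss_map ::
  "(real^2 \<Rightarrow> (real^3, 3) tvec) \<Rightarrow> real^2 \<Rightarrow> real^3" where
  "gauss_map \<nu> x = \<nu> x euclidean_chart"

end

theory Submission
  imports Defs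
begin

text \<open>
  In a chart around \<open>f p\<close>, the Gauss equation for \<open>f\<close> reads
  \<open>\<langle>R(\<partial>\<^sub>u,\<partial>\<^sub>v)\<partial>\<^sub>v,\<partial>\<^sub>u\<rangle> = \<langle>\<Omega> f\<^sub>v, f\<^sub>u\<rangle> + det II\<close>, where \<open>\<Omega>\<close> is the curvature of the pulled
  back Levi-Civita connection. Both \<open>f\<^sub>u, f\<^sub>v\<close> and \<open>\<nabla>\<^sub>u\<nu>, \<nabla>\<^sub>v\<nu>\<close> are orthogonal to \<open>\<nu>\<close>, and the
  cross product of two vectors orthogonal to \<open>\<nu>\<close> is a multiple of \<open>\<nu>\<close>. Hence both terms on
  the right are divisible by \<open>\<lambda> = det\<^sub>g(f\<^sub>u, f\<^sub>v, \<nu>)\<close>; as \<open>det I = \<lambda>\<^sup>2\<close>, the product \<open>K\<lambda>\<close> is a smooth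
  function. At a singular point \<open>f\<^sub>u\<close> and \<open>f\<^sub>v\<close> are dependent, so \<open>\<Omega>\<close> vanishes and \<open>K\<lambda>\<close> takes the
  value \<open>det\<^sub>g(\<nabla>\<^sub>u\<nu>, \<nabla>\<^sub>v\<nu>, \<nu>)\<close>. In admissible coordinates \<open>\<nabla>\<^sub>v\<nu>\<close> is nonzero, because \<open>f\<close> is a
  front, and orthogonal to \<open>f\<^sub>u\<close>, so this value vanishes iff \<open>\<langle>f\<^sub>u, \<nabla>\<^sub>u\<nu>\<rangle> = - \<langle>f\<^sub>u\<^sub>u, \<nu>\<rangle>\<close> does.
  Otherwise \<open>K\<close> behaves like a nonzero constant divided by \<open>\<lambda>\<close>, and \<open>\<lambda>\<close> changes sign across the
  singular curve by the inverse function theorem.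
\<close>

section \<open>Calculus of smooth functions\<close>

text \<open>\<open>K\<close> is defined through the Christoffel symbols of the induced metric, which
  contain the inverse of the first fundamental form and have no meaning where it degenerates. The
  Gauss equation is therefore proved only where \<open>area\<close> is nonzero. What crosses the
  singular set is its numerator, an explicit expression in \<open>G\<close>, \<open>n\<close> and
  the connection matrices \<open>A\<close>.

  This numerator belongs to one chart of the ambient manifold. Non-degeneracy makes regular points
  accumulate at every singular point, so continuity forces the expressions from two charts, and any
  other smooth extension, to agree there.

  A tangent vector is a family of coordinate vectors over all charts, so an inner product can be
  computed in one chart only after both arguments are known to be tangent. For the covariant
  derivative in the definition of the limiting normal curvature this amounts to the transformation
  law of the Christoffel symbols. The law is obtained from the uniqueness of the Levi-Civita
  connection instead of a computation with indices.\<close>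

lemma frechet_derivative_cong_open:
  assumes "open S" "x \<in> S" "\<And>y. y \<in> S \<Longrightarrow> f y = g y"
  shows "frechet_derivative f (at x) = frechet_derivative g (at x)"
proof -
  have "(f has_derivative f') (at x) \<longleftrightarrow> (g has_derivative f') (at x)" for f'
    using assms has_derivative_transform_within_open[of f f' x UNIV S g]
      has_derivative_transform_within_open[of g f' x UNIV S f] by auto
  then show ?thesis unfolding frechet_derivative_def by simp
qed

lemma differentiable_cong_open:
  assumes "open S" "x \<in> S" "\<And>y. y \<in> S \<Longrightarrow> f y = g y"
  shows "f differentiable (at x) \<longleftrightarrow> g differentiable (at x)"
  using assms has_derivative_transform_within_open[of f _ x UNIV S g]
      has_derivative_transform_within_open[of g _ x UNIV S f] unfolding differentiable_def by metis

lemma Ck_on_cong: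
  assumes "open S" "\<And>x. x \<in> S \<Longrightarrow> f x = g x"
  shows "Ck_on k S f \<longleftrightarrow> Ck_on k S g"
  using assms(2)
proof (induction k arbitrary: f g)
  case 0
  then show ?case by (simp cong: continuous_on_cong)
next
  case (Suc k)
  have "Ck_on k S (\<lambda>x. frechet_derivative f (at x) a) =
    Ck_on k S (\<lambda>x. frechet_derivative g (at x) a)" for a
    using frechet_derivative_cong_open[OF assms(1) _ Suc.prems]
    by (intro Suc.IH) simp
  moreover have "\<forall>x\<in>S. f differentiable at x \<longleftrightarrow> g differentiable at x"
    by (intro ballI differentiable_cong_open[OF assms(1)] Suc.prems)
  ultimately show ?case unfolding Ck_on.simps by blast
qed

section \<open>Closure properties of functions of class C^k\<close>

lemma Ck_on_subset: "Ck_on k S f \<Longrightarrow> T \<subseteq> S \<Longrightarrow> Ck_on k T f"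
  by (induction k arbitrary: f) (auto intro: continuous_on_subset)

lemma Ck_on_SucD: "Ck_on (Suc k) S f \<Longrightarrow> Ck_on k S f"
proof (induction k arbitrary: f)
  case 0
  then show ?case
    by (auto intro!: differentiable_imp_continuous_on differentiable_at_imp_differentiable_on)
next
  case (Suc k)
  then show ?case by (metis Ck_on.simps(2))
qed

lemma Ck_on_const: "Ck_on k S (\<lambda>x. c)"
  by (induction k arbitrary: c) auto

lemma Ck_on_bounded_linear:
  assumes "bounded_linear L"
  shows "Ck_on k S L"
proof (cases k)
  case 0
  then show ?thesis using assms by (simp add: linear_continuous_on)
next
  case (Suc m)
  have L: "(L has_derivative L) (at x)" for x
    using assms by (rule bounded_linear_imp_has_derivative)
  then show ?thesis
    unfolding Suc using frechet_derivative_at[OF L, symmetric]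
    by (auto simp: differentiable_def Ck_on_const)
qed

text \<open>The inductions on \<open>k\<close> below run through this rule: each operation supplies
  its own derivative formula, and only that formula has to be of class C^k.\<close>

lemma Ck_on_Suc_intro:
  assumes "open S" "\<And>x. x \<in> S \<Longrightarrow> (f has_derivative f' x) (at x)"
    and "\<And>a. Ck_on k S (\<lambda>x. f' x a)"
  shows "Ck_on (Suc k) S f"
proof -
  have eq: "f' x = frechet_derivative f (at x)" if "x \<in> S" for x
    using assms(2) frechet_derivative_at that by blast
  have "Ck_on k S (\<lambda>x. frechet_derivative f (at x) a)" for a
    using assms(3)[of a] Ck_on_cong[OF assms(1), of "\<lambda>x. f' x a"] eq by simp
  moreover have "\<forall>x\<in>S. f differentiable (at x)"
    using assms(2) differentiable_def by blast
  ultimately show ?thesis by simp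
qed

lemma Ck_on_has_derivative:
  "Ck_on (Suc k) S f \<Longrightarrow> x \<in> S \<Longrightarrow> (f has_derivative frechet_derivative f (at x)) (at x)"
  by (simp flip: frechet_derivative_works)

lemma Ck_on_linear_compose:
  assumes "open S" "bounded_linear L" "Ck_on k S f"
  shows "Ck_on k S (\<lambda>x. L (f x))"
  using assms(3)
proof (induction k arbitrary: f)
  case 0
  then show ?case using assms(2) by (simp add: bounded_linear.continuous_on)
next
  case (Suc k)
  show ?case
  proof (rule Ck_on_Suc_intro[OF assms(1)])
    show "((\<lambda>x. L (f x)) has_derivative (\<lambda>a. L (frechet_derivative f (at x) a))) (at x)"
      if "x \<in> S" for x
      using bounded_linear.has_derivative[OF assms(2) Ck_on_has_derivative[OF Suc.prems that]] .
    show "Ck_on k S (\<lambda>x. L (frechet_derivative f (at x) a))" for a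
      using Suc by simp
  qed
qed

lemma Ck_on_add:
  assumes "open S" "Ck_on k S f" "Ck_on k S g"
  shows "Ck_on k S (\<lambda>x. f x + g x)"
  using assms(2,3)
proof (induction k arbitrary: f g)
  case 0
  then show ?case by (simp add: continuous_on_add)
next
  case (Suc k)
  show ?case
  proof (rule Ck_on_Suc_intro[OF assms(1)])
    show "((\<lambda>x. f x + g x) has_derivative
        (\<lambda>a. frechet_derivative f (at x) a + frechet_derivative g (at x) a)) (at x)"
      if "x \<in> S" for x
      using Suc.prems that by (intro has_derivative_add Ck_on_has_derivative)
    show "Ck_on k S (\<lambda>x. frechet_derivative f (at x) a + frechet_derivative g (at x) a)" for a
      using Suc by simp
  qed
qed

lemma Ck_on_bilinear:
  assumes "open S" "bounded_bilinear B" "Ck_on k S f" "Ck_on k S g"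
  shows "Ck_on k S (\<lambda>x. B (f x) (g x))"
  using assms(3,4)
proof (induction k arbitrary: f g)
  case 0
  then show ?case using assms(2) by (simp add: bounded_bilinear.continuous_on)
next
  case (Suc k)
  show ?case
  proof (rule Ck_on_Suc_intro[OF assms(1)])
    show "((\<lambda>x. B (f x) (g x)) has_derivative
        (\<lambda>a. B (f x) (frechet_derivative g (at x) a) + B (frechet_derivative f (at x) a) (g x)))
        (at x)"
      if "x \<in> S" for x
      using Suc.prems that by (intro bounded_bilinear.FDERIV[OF assms(2)] Ck_on_has_derivative)
    show "Ck_on k S (\<lambda>x. B (f x) (frechet_derivative g (at x) a)
        + B (frechet_derivative f (at x) a) (g x))" for a
      using Suc.prems Ck_on_SucD[OF Suc.prems(1)] Ck_on_SucD[OF Suc.prems(2)]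
      by (intro Ck_on_add assms(1) Suc.IH) auto
  qed
qed

lemma Ck_on_sum:
  assumes "open S" "\<And>i. i \<in> I \<Longrightarrow> Ck_on k S (f i)"
  shows "Ck_on k S (\<lambda>x. \<Sum>i\<in>I. f i x)"
  using assms(2)
  by (induction I rule: infinite_finite_induct) (auto simp: Ck_on_const Ck_on_add assms(1))

lemma Ck_on_compose:
  fixes f :: "'a::euclidean_space \<Rightarrow> 'b::euclidean_space"
  assumes "open S" "open T" "f ` S \<subseteq> T" "Ck_on k S f" "Ck_on k T g"
  shows "Ck_on k S (\<lambda>x. g (f x))"
  using assms(4,5)
proof (induction k arbitrary: g)
  case 0
  then show ?case using assms(3) by (auto intro: continuous_on_compose2)
next
  case (Suc k)
  show ?case
  proof (rule Ck_on_Suc_intro[OF assms(1)])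
    fix x assume x: "x \<in> S"
    let ?f' = "frechet_derivative f (at x)" and ?g' = "frechet_derivative g (at (f x))"
    have g: "(g has_derivative ?g') (at (f x))"
      using Suc.prems(2) x assms(3) by (intro Ck_on_has_derivative) auto
    have "((\<lambda>x. g (f x)) has_derivative (\<lambda>a. ?g' (?f' a))) (at x)"
      using has_derivative_compose[OF Ck_on_has_derivative[OF Suc.prems(1) x] g] .
    \<comment> \<open>\<open>Ck_on\<close> controls derivatives along fixed directions only, while
      the direction \<open>?f' a\<close> varies with the point. Expanding it in the basis leaves
      fixed directions with real coefficients.\<close>
    moreover have "?g' (?f' a) = (\<Sum>b\<in>Basis. (?f' a \<bullet> b) *\<^sub>R ?g' b)" for a
    proof -
      have "?g' (?f' a) = ?g' (\<Sum>b\<in>Basis. (?f' a \<bullet> b) *\<^sub>R b)"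
        by (simp add: euclidean_representation)
      also have "\<dots> = (\<Sum>b\<in>Basis. (?f' a \<bullet> b) *\<^sub>R ?g' b)"
        using has_derivative_linear[OF g] by (simp add: linear_sum linear_scale)
      finally show ?thesis .
    qed
    ultimately show "((\<lambda>x. g (f x)) has_derivative
        (\<lambda>a. \<Sum>b\<in>Basis. (?f' a \<bullet> b) *\<^sub>R ?g' b)) (at x)" by simp
  next
    fix a
    have "Ck_on k S (\<lambda>x. frechet_derivative f (at x) a \<bullet> b)" for b
      using Suc.prems(1)
      by (intro Ck_on_linear_compose[OF assms(1) bounded_linear_inner_left]) simp
    moreover have "Ck_on k S (\<lambda>x. frechet_derivative g (at (f x)) b)" for b
      using Suc.IH[of "\<lambda>y. frechet_derivative g (at y) b"] Suc.prems Ck_on_SucD[OF Suc.prems(1)]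
      by simp
    ultimately show "Ck_on k S (\<lambda>x. \<Sum>b\<in>Basis. (frechet_derivative f (at x) a \<bullet> b) *\<^sub>R
        frechet_derivative g (at (f x)) b)"
      by (intro Ck_on_sum assms(1) Ck_on_bilinear[OF _ bounded_bilinear_scaleR])
  qed
qed

text \<open>The derivative is a polynomial in the inverse and the derivative of \<open>f\<close>, so
  the induction closes.\<close>

lemma Ck_on_inverse:
  fixes f :: "'a::euclidean_space \<Rightarrow> real"
  assumes "open S" "\<And>x. x \<in> S \<Longrightarrow> f x \<noteq> 0" "Ck_on k S f"
  shows "Ck_on k S (\<lambda>x. inverse (f x))"
  using assms(3)
proof (induction k)
  case 0
  then show ?case using assms(2) by (auto intro: continuous_on_inverse)
next
  case (Suc k)
  have IH: "Ck_on k S (\<lambda>x. inverse (f x))" using Suc.IH Ck_on_SucD[OF Suc.prems] .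
  show ?case
  proof (rule Ck_on_Suc_intro[OF assms(1)])
    show "((\<lambda>x. inverse (f x)) has_derivative
        (\<lambda>a. - (inverse (f x) * frechet_derivative f (at x) a * inverse (f x)))) (at x)"
      if "x \<in> S" for x
      using Deriv.has_derivative_inverse[OF assms(2)[OF that] Ck_on_has_derivative[OF Suc.prems that]] .
    show "Ck_on k S (\<lambda>x. - (inverse (f x) * frechet_derivative f (at x) a * inverse (f x)))" for a
      using IH Suc.prems
      by (intro Ck_on_linear_compose[OF assms(1) bounded_linear_minus[OF bounded_linear_ident]]
          Ck_on_bilinear[OF assms(1) bounded_bilinear_mult]) auto
  qed
qed

lemma Ck_on_sqrt:
  fixes f :: "'a::euclidean_space \<Rightarrow> real"
  assumes "open S" "\<And>x. x \<in> S \<Longrightarrow> f x > 0" "Ck_on k S f"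
  shows "Ck_on k S (\<lambda>x. sqrt (f x))"
  using assms(3)
proof (induction k)
  case 0
  then show ?case by (auto intro: continuous_on_real_sqrt)
next
  case (Suc k)
  have "Ck_on k S (\<lambda>x. sqrt (f x))" using Suc.IH Ck_on_SucD[OF Suc.prems] .
  then have IH: "Ck_on k S (\<lambda>x. inverse (sqrt (f x)))"
    using assms(2) by (intro Ck_on_inverse assms(1)) (auto simp: less_le)
  show ?case
  proof (rule Ck_on_Suc_intro[OF assms(1)])
    show "((\<lambda>x. sqrt (f x)) has_derivative
        (\<lambda>a. (1/2) * (frechet_derivative f (at x) a * inverse (sqrt (f x))))) (at x)"
      if "x \<in> S" for x
      using has_derivative_real_sqrt[OF assms(2)[OF that] Ck_on_has_derivative[OF Suc.prems that]]
      by (simp add: field_simps)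
    show "Ck_on k S (\<lambda>x. (1/2) * (frechet_derivative f (at x) a * inverse (sqrt (f x))))" for a
      using IH Suc.prems
      by (intro Ck_on_linear_compose[OF assms(1) bounded_linear_mult_right]
          Ck_on_bilinear[OF assms(1) bounded_bilinear_mult]) auto
  qed
qed

text \<open>Lets a function given by a different formula near each point be smooth on its whole
  domain; the extension of the curvature form is of this kind.\<close>

lemma Ck_on_local:
  assumes "\<And>x. x \<in> S \<Longrightarrow> \<exists>T. open T \<and> x \<in> T \<and> Ck_on k T f"
  shows "Ck_on k S f"
  using assms
proof (induction k arbitrary: f)
  case 0
  have "isCont f x" if "x \<in> S" for x
    using 0[OF that] by (auto simp: continuous_on_eq_continuous_at)
  then show ?case by (simp add: continuous_at_imp_continuous_on)
next
  case (Suc k)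
  have "f differentiable (at x)" if "x \<in> S" for x
    using Suc.prems[OF that] by auto
  moreover have "Ck_on k S (\<lambda>x. frechet_derivative f (at x) a)" for a
    using Suc.prems by (intro Suc.IH) (metis Ck_on.simps(2))
  ultimately show ?case by simp
qed

section \<open>Closure properties of smooth functions\<close>

lemma smooth_on_cong:
  "open S \<Longrightarrow> (\<And>x. x \<in> S \<Longrightarrow> f x = g x) \<Longrightarrow> smooth_on S f \<longleftrightarrow> smooth_on S g"
  unfolding smooth_on_def using Ck_on_cong by metis

lemma smooth_on_subset: "smooth_on S f \<Longrightarrow> T \<subseteq> S \<Longrightarrow> smooth_on T f"
  unfolding smooth_on_def using Ck_on_subset by blast

lemma smooth_on_local:
  "(\<And>x. x \<in> S \<Longrightarrow> \<exists>T. open T \<and> x \<in> T \<and> smooth_on T f) \<Longrightarrow> smooth_on S f"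
  unfolding smooth_on_def by (meson Ck_on_local)

lemma smooth_on_const: "smooth_on S (\<lambda>x. c)"
  by (simp add: smooth_on_def Ck_on_const)

lemma smooth_on_bounded_linear: "bounded_linear L \<Longrightarrow> smooth_on S L"
  by (simp add: smooth_on_def Ck_on_bounded_linear)

lemma smooth_on_linear_compose:
  "open S \<Longrightarrow> bounded_linear L \<Longrightarrow> smooth_on S f \<Longrightarrow> smooth_on S (\<lambda>x. L (f x))"
  by (simp add: smooth_on_def Ck_on_linear_compose)

lemma smooth_on_add:
  "open S \<Longrightarrow> smooth_on S f \<Longrightarrow> smooth_on S g \<Longrightarrow> smooth_on S (\<lambda>x. f x + g x)"
  by (simp add: smooth_on_def Ck_on_add)

lemma smooth_on_bilinear:
  "open S \<Longrightarrow> bounded_bilinear B \<Longrightarrow> smooth_on S f \<Longrightarrow> smooth_on S g \<Longrightarrow>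
   smooth_on S (\<lambda>x. B (f x) (g x))"
  by (simp add: smooth_on_def Ck_on_bilinear)

lemma smooth_on_minus: "open S \<Longrightarrow> smooth_on S f \<Longrightarrow> smooth_on S (\<lambda>x. - f x)"
  by (rule smooth_on_linear_compose[OF _ bounded_linear_minus[OF bounded_linear_ident]])

lemma smooth_on_diff:
  "open S \<Longrightarrow> smooth_on S f \<Longrightarrow> smooth_on S g \<Longrightarrow> smooth_on S (\<lambda>x. f x - g x)"
  using smooth_on_add[of S f "\<lambda>x. - g x"] smooth_on_minus by force

lemma smooth_on_mult:
  fixes f g :: "_ \<Rightarrow> real"
  shows "open S \<Longrightarrow> smooth_on S f \<Longrightarrow> smooth_on S g \<Longrightarrow> smooth_on S (\<lambda>x. f x * g x)"
  by (rule smooth_on_bilinear[OF _ bounded_bilinear_mult])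

lemma smooth_on_inner:
  "open S \<Longrightarrow> smooth_on S f \<Longrightarrow> smooth_on S g \<Longrightarrow> smooth_on S (\<lambda>x. f x \<bullet> g x)"
  by (rule smooth_on_bilinear[OF _ bounded_bilinear_inner])

lemma smooth_on_sum:
  "open S \<Longrightarrow> (\<And>i. i \<in> I \<Longrightarrow> smooth_on S (f i)) \<Longrightarrow> smooth_on S (\<lambda>x. \<Sum>i\<in>I. f i x)"
  by (simp add: smooth_on_def Ck_on_sum)

lemma smooth_on_prod:
  fixes f :: "'i \<Rightarrow> 'a::euclidean_space \<Rightarrow> real"
  assumes "open S" "\<And>i. i \<in> I \<Longrightarrow> smooth_on S (f i)"
  shows "smooth_on S (\<lambda>x. \<Prod>i\<in>I. f i x)"
  using assms(2)
  by (induction I rule: infinite_finite_induct) (auto simp: smooth_on_const smooth_on_mult assms(1))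

lemma smooth_on_compose:
  fixes f :: "'a::euclidean_space \<Rightarrow> 'b::euclidean_space"
  shows "open S \<Longrightarrow> open T \<Longrightarrow> f ` S \<subseteq> T \<Longrightarrow> smooth_on S f \<Longrightarrow> smooth_on T g \<Longrightarrow>
    smooth_on S (\<lambda>x. g (f x))"
  unfolding smooth_on_def using Ck_on_compose by blast

lemma smooth_on_divide:
  fixes f g :: "_ \<Rightarrow> real"
  shows "open S \<Longrightarrow> smooth_on S f \<Longrightarrow> smooth_on S g \<Longrightarrow> (\<And>x. x \<in> S \<Longrightarrow> g x \<noteq> 0) \<Longrightarrow>
    smooth_on S (\<lambda>x. f x / g x)"
  unfolding divide_inverse
  by (intro smooth_on_mult) (auto simp: smooth_on_def Ck_on_inverse)

lemma smooth_on_sqrt: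
  fixes f :: "_ \<Rightarrow> real"
  shows "open S \<Longrightarrow> smooth_on S f \<Longrightarrow> (\<And>x. x \<in> S \<Longrightarrow> f x > 0) \<Longrightarrow> smooth_on S (\<lambda>x. sqrt (f x))"
  by (auto simp: smooth_on_def Ck_on_sqrt)

lemma smooth_on_nth:
  "open S \<Longrightarrow> smooth_on S f \<Longrightarrow> smooth_on S (\<lambda>x. f x $ i)"
  by (rule smooth_on_linear_compose[OF _ bounded_linear_vec_nth])

lemma bounded_linear_axis: "bounded_linear (\<lambda>y::'b::euclidean_space. axis i y :: 'b^'n)"
  by (intro linear_conv_bounded_linear[THEN iffD1] linearI) (auto simp: axis_def vec_eq_iff)

lemma smooth_on_vec:
  fixes f :: "'a::euclidean_space \<Rightarrow> ('b::euclidean_space)^'n"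
  assumes "open S" "\<And>i. smooth_on S (\<lambda>x. f x $ i)"
  shows "smooth_on S f"
proof -
  have eq: "f = (\<lambda>x. \<Sum>i\<in>UNIV. axis i (f x $ i))"
    by (auto simp: vec_eq_iff axis_def if_distrib sum.delta cong: if_cong)
  show ?thesis
    by (subst eq, intro smooth_on_sum assms(1) smooth_on_linear_compose[OF _ bounded_linear_axis]
        assms(2))
qed

lemma smooth_on_differentiable:
  "smooth_on S f \<Longrightarrow> x \<in> S \<Longrightarrow> f differentiable (at x)"
  unfolding smooth_on_def by (metis Ck_on.simps(2))

lemma smooth_on_has_derivative:
  "smooth_on S f \<Longrightarrow> x \<in> S \<Longrightarrow> (f has_derivative frechet_derivative f (at x)) (at x)"
  using smooth_on_differentiable frechet_derivative_works by blast

lemma smooth_on_continuous: "smooth_on S f \<Longrightarrow> continuous_on S f"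
  unfolding smooth_on_def by (metis Ck_on.simps(1))

lemma smooth_on_isCont: "smooth_on S f \<Longrightarrow> x \<in> S \<Longrightarrow> isCont f x"
  using smooth_on_differentiable differentiable_imp_continuous_within by blast

lemma smooth_on_frechet_derivative:
  "smooth_on S f \<Longrightarrow> smooth_on S (\<lambda>x. frechet_derivative f (at x) a)"
  unfolding smooth_on_def by (metis Ck_on.simps(2))

lemma smooth_on_partial: "smooth_on S f \<Longrightarrow> smooth_on S (partial i f)"
  unfolding partial_def[abs_def] by (rule smooth_on_frechet_derivative)

section \<open>Smooth matrix-valued functions\<close>

lemma smooth_on_mat_vec_mult:
  fixes A :: "'a::euclidean_space \<Rightarrow> real^'n^'m"
  assumes "open S" "smooth_on S A" "smooth_on S v"
  shows "smooth_on S (\<lambda>x. A x *v v x)"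
  unfolding matrix_vector_mult_def
  by (rule smooth_on_vec)
     (simp_all add: assms smooth_on_sum smooth_on_mult smooth_on_nth)

lemma smooth_on_mat_mult:
  fixes A :: "'a::euclidean_space \<Rightarrow> real^'n^'m"
  assumes "open S" "smooth_on S A" "smooth_on S B"
  shows "smooth_on S (\<lambda>x. A x ** B x)"
  unfolding matrix_matrix_mult_def
  by (intro smooth_on_vec) (simp_all add: assms smooth_on_sum smooth_on_mult smooth_on_nth)

lemma smooth_on_det:
  fixes A :: "'a::euclidean_space \<Rightarrow> real^'n^'n"
  assumes "open S" "smooth_on S A"
  shows "smooth_on S (\<lambda>x. det (A x))"
  unfolding det_def
  by (intro smooth_on_sum smooth_on_mult smooth_on_prod smooth_on_const smooth_on_nth assms)

lemma matrix_inv_mult: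
  fixes A :: "real^'n^'n"
  assumes "det A \<noteq> 0"
  shows "A ** matrix_inv A = mat 1" "matrix_inv A ** A = mat 1"
proof -
  have "\<exists>A'. A ** A' = mat 1 \<and> A' ** A = mat 1"
    using assms invertible_det_nz invertible_def by blast
  then have "A ** matrix_inv A = mat 1 \<and> matrix_inv A ** A = mat 1"
    unfolding matrix_inv_def by (rule someI_ex)
  then show "A ** matrix_inv A = mat 1" "matrix_inv A ** A = mat 1" by auto
qed

text \<open>Cramer's rule makes the entries of the inverse quotients of determinants, which reduces
  smoothness of inversion to sums, products and one division.\<close>

lemma matrix_inv_cramer:
  fixes A :: "real^'n^'n"
  assumes "det A \<noteq> 0"
  shows "matrix_inv A $ k $ l = det (\<chi> i j. if j = k then axis l 1 $ i else A $ i $ j) / det A"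
proof -
  have "A *v (matrix_inv A *v axis l 1) = axis l 1"
    by (simp add: matrix_vector_mul_assoc matrix_inv_mult[OF assms])
  then have "(matrix_inv A *v axis l 1) $ k =
      det (\<chi> i j. if j = k then axis l 1 $ i else A $ i $ j) / det A"
    using cramer[OF assms] by (simp add: vec_eq_iff)
  then show ?thesis by (simp add: matrix_vector_mult_basis column_def)
qed

lemma smooth_on_matrix_inv:
  fixes A :: "'a::euclidean_space \<Rightarrow> real^'n^'n"
  assumes "open S" "smooth_on S A" "\<And>x. x \<in> S \<Longrightarrow> det (A x) \<noteq> 0"
  shows "smooth_on S (\<lambda>x. matrix_inv (A x))"
proof (intro smooth_on_vec assms(1))
  fix k l
  have "smooth_on S (\<lambda>x. (\<chi> i j. if j = k then axis l 1 $ i else A x $ i $ j) :: real^'n^'n)"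
  proof (intro smooth_on_vec assms(1))
    show "smooth_on S (\<lambda>x. (\<chi> i j. if j = k then axis l 1 $ i else A x $ i $ j) $ i $ j)" for i j
      by (cases "j = k") (auto simp: smooth_on_const smooth_on_nth assms)
  qed
  then have "smooth_on S
      (\<lambda>x. det (\<chi> i j. if j = k then axis l 1 $ i else A x $ i $ j) / det (A x))"
    by (intro smooth_on_divide smooth_on_det assms)
  then show "smooth_on S (\<lambda>x. matrix_inv (A x) $ k $ l)"
    using assms(3) by (subst smooth_on_cong[OF assms(1)]) (auto simp: matrix_inv_cramer)
qed

section \<open>Symmetry of second derivatives\<close>

lemma frechet_derivative_linear_compose:
  assumes "bounded_linear L" "f differentiable (at x)"
  shows "frechet_derivative (\<lambda>x. L (f x)) (at x) a = L (frechet_derivative f (at x) a)"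
  using frechet_derivative_at[OF bounded_linear.has_derivative[OF assms(1)
        frechet_derivative_works[THEN iffD1, OF assms(2)]]] by metis

text \<open>The mean value theorem is used twice: along \<open>a\<close> for the difference of
  \<open>f\<close> on two parallel segments, then along \<open>b\<close> for the derivative in
  direction \<open>a\<close>.\<close>

lemma second_difference_mean_value:
  fixes f :: "'a::euclidean_space \<Rightarrow> real"
  assumes "0 < h" and f: "smooth_on S f"
    and S: "\<And>s t. 0 \<le> s \<Longrightarrow> s \<le> h \<Longrightarrow> 0 \<le> t \<Longrightarrow> t \<le> h \<Longrightarrow> x + s *\<^sub>R a + t *\<^sub>R b \<in> S"
  shows "\<exists>s t. 0 < s \<and> s < h \<and> 0 < t \<and> t < h \<and>
    f (x + h *\<^sub>R a + h *\<^sub>R b) - f (x + h *\<^sub>R a) - f (x + h *\<^sub>R b) + f x =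
    h * h * frechet_derivative (\<lambda>y. frechet_derivative f (at y) a) (at (x + s *\<^sub>R a + t *\<^sub>R b)) b"
proof -
  have DERIV_line: "((\<lambda>s. g (y + s *\<^sub>R c)) has_field_derivative frechet_derivative g (at (y + s *\<^sub>R c)) c) (at s)"
    if "smooth_on S g" "y + s *\<^sub>R c \<in> S" for g :: "'a \<Rightarrow> real" and y c s
  proof -
    have "((\<lambda>s. y + s *\<^sub>R c) has_derivative (\<lambda>r. r *\<^sub>R c)) (at s)"
      by (auto intro!: derivative_eq_intros)
    from has_derivative_compose[OF this smooth_on_has_derivative[OF that]]
    have "((\<lambda>s. g (y + s *\<^sub>R c)) has_derivative
        (\<lambda>r. frechet_derivative g (at (y + s *\<^sub>R c)) (r *\<^sub>R c))) (at s)" .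
    moreover have "(\<lambda>r. frechet_derivative g (at (y + s *\<^sub>R c)) (r *\<^sub>R c)) =
        (*) (frechet_derivative g (at (y + s *\<^sub>R c)) c)"
      using linear_scale[OF linear_frechet_derivative[OF smooth_on_differentiable[OF that]]]
      by (intro ext) (simp add: mult.commute)
    ultimately show ?thesis unfolding has_field_derivative_def by simp
  qed
  let ?D = "\<lambda>y. frechet_derivative f (at y) a"
  have "\<exists>s. 0 < s \<and> s < h \<and>
    (f ((x + h *\<^sub>R b) + h *\<^sub>R a) - f (x + h *\<^sub>R a)) - (f ((x + h *\<^sub>R b) + 0 *\<^sub>R a) - f (x + 0 *\<^sub>R a))
    = (h - 0) * (?D ((x + h *\<^sub>R b) + s *\<^sub>R a) - ?D (x + s *\<^sub>R a))"
  proof (rule MVT2[OF assms(1), of "\<lambda>s. f ((x + h *\<^sub>R b) + s *\<^sub>R a) - f (x + s *\<^sub>R a)"])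
    fix s :: real assume s: "0 \<le> s" "s \<le> h"
    have "x + h *\<^sub>R b + s *\<^sub>R a \<in> S" using S[of s h] s assms(1) by (simp add: algebra_simps)
    moreover have "x + s *\<^sub>R a \<in> S" using S[of s 0] s assms(1) by simp
    ultimately show "((\<lambda>s. f ((x + h *\<^sub>R b) + s *\<^sub>R a) - f (x + s *\<^sub>R a)) has_field_derivative
      (?D ((x + h *\<^sub>R b) + s *\<^sub>R a) - ?D (x + s *\<^sub>R a))) (at s)"
      by (intro DERIV_diff DERIV_line f)
  qed
  then obtain s where s: "0 < s" "s < h" and eq1:
    "f (x + h *\<^sub>R a + h *\<^sub>R b) - f (x + h *\<^sub>R a) - f (x + h *\<^sub>R b) + f x
     = h * (?D ((x + s *\<^sub>R a) + h *\<^sub>R b) - ?D (x + s *\<^sub>R a))"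
    by (auto simp: algebra_simps)
  have "\<exists>t. 0 < t \<and> t < h \<and> ?D ((x + s *\<^sub>R a) + h *\<^sub>R b) - ?D ((x + s *\<^sub>R a) + 0 *\<^sub>R b)
    = (h - 0) * frechet_derivative ?D (at ((x + s *\<^sub>R a) + t *\<^sub>R b)) b"
    using S s by (intro MVT2[OF assms(1), of "\<lambda>t. ?D ((x + s *\<^sub>R a) + t *\<^sub>R b)"] DERIV_line
        smooth_on_frechet_derivative f) auto
  with eq1 s show ?thesis by (auto simp: mult.assoc)
qed

text \<open>The second difference is symmetric in \<open>a\<close> and \<open>b\<close>. Evaluating
  it in both orders gives two points arbitrarily close to \<open>x\<close> at which the two mixed
  derivatives agree, and continuity carries this to \<open>x\<close>.\<close>

lemma second_derivative_symmetric_real: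
  fixes f :: "'a::euclidean_space \<Rightarrow> real"
  assumes "open S" "smooth_on S f" "x \<in> S"
  shows "frechet_derivative (\<lambda>y. frechet_derivative f (at y) a) (at x) b =
         frechet_derivative (\<lambda>y. frechet_derivative f (at y) b) (at x) a"
proof -
  let ?H = "\<lambda>a b y. frechet_derivative (\<lambda>y. frechet_derivative f (at y) a) (at y) b"
  have cont: "isCont (?H a b) x" for a b
    by (intro smooth_on_isCont[OF _ assms(3)] smooth_on_frechet_derivative assms(2))
  have "dist (?H a b x) (?H b a x) \<le> e" if e: "e > 0" for e
  proof -
    obtain d1 where d1: "d1 > 0" "\<And>y. dist y x < d1 \<Longrightarrow> dist (?H a b y) (?H a b x) < e/2"
      using cont[of a b] e unfolding continuous_at_eps_delta by (meson half_gt_zero)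
    obtain d2 where d2: "d2 > 0" "\<And>y. dist y x < d2 \<Longrightarrow> dist (?H b a y) (?H b a x) < e/2"
      using cont[of b a] e unfolding continuous_at_eps_delta by (meson half_gt_zero)
    obtain d3 where d3: "d3 > 0" "ball x d3 \<subseteq> S"
      using assms(1,3) openE by blast
    define d where "d = min d1 (min d2 d3)"
    \<comment> \<open>With this \<open>K\<close> and \<open>h\<close> the whole parallelogram
      spanned by \<open>h *\<^sub>R a\<close> and \<open>h *\<^sub>R b\<close> stays within
      \<open>d / 2\<close> of \<open>x\<close>. The summand 1 keeps \<open>K\<close> positive when
      both directions vanish.\<close>
    define K where "K = norm a + norm b + 1"
    define h where "h = d / (2 * K)"
    have d: "d > 0" using d1 d2 d3 by (simp add: d_def)
    have K: "K > 0" unfolding K_def by (smt (verit) norm_ge_zero)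
    have h: "h > 0" using d K by (simp add: h_def)
    have near: "dist (x + s *\<^sub>R a + t *\<^sub>R b) x < d"
      if "0 \<le> s" "s \<le> h" "0 \<le> t" "t \<le> h" for s t
    proof -
      have "dist (x + s *\<^sub>R a + t *\<^sub>R b) x = norm (s *\<^sub>R a + t *\<^sub>R b)"
        by (simp add: dist_norm algebra_simps)
      also have "\<dots> \<le> s * norm a + t * norm b"
        using norm_triangle_ineq[of "s *\<^sub>R a" "t *\<^sub>R b"] that by simp
      also have "\<dots> \<le> h * norm a + h * norm b"
        using that by (intro add_mono mult_right_mono) auto
      also have "\<dots> \<le> h * K" using h by (simp add: K_def algebra_simps)
      also have "\<dots> = d / 2" using K by (simp add: h_def)
      also have "\<dots> < d" using d by simp
      finally show ?thesis .
    qed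
    have inS: "x + s *\<^sub>R a + t *\<^sub>R b \<in> S"
      if "0 \<le> s" "s \<le> h" "0 \<le> t" "t \<le> h" for s t
      using near[OF that] d3(2) by (auto simp: d_def dist_commute)
    have inS': "x + s *\<^sub>R b + t *\<^sub>R a \<in> S"
      if "0 \<le> s" "s \<le> h" "0 \<le> t" "t \<le> h" for s t
      using inS[OF that(3,4,1,2)] by (simp add: algebra_simps)
    obtain s t where st: "0 < s" "s < h" "0 < t" "t < h" and 1:
      "f (x + h *\<^sub>R a + h *\<^sub>R b) - f (x + h *\<^sub>R a) - f (x + h *\<^sub>R b) + f x =
       h * h * ?H a b (x + s *\<^sub>R a + t *\<^sub>R b)"
      using second_difference_mean_value[OF h assms(2) inS] by blast
    obtain s' t' where st': "0 < s'" "s' < h" "0 < t'" "t' < h" and 2: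
      "f (x + h *\<^sub>R b + h *\<^sub>R a) - f (x + h *\<^sub>R b) - f (x + h *\<^sub>R a) + f x =
       h * h * ?H b a (x + s' *\<^sub>R b + t' *\<^sub>R a)"
      using second_difference_mean_value[OF h assms(2) inS'] by blast
    have "f (x + h *\<^sub>R b + h *\<^sub>R a) = f (x + h *\<^sub>R a + h *\<^sub>R b)" by (simp add: algebra_simps)
    with 1 2 have "h * h * ?H a b (x + s *\<^sub>R a + t *\<^sub>R b) =
        h * h * ?H b a (x + s' *\<^sub>R b + t' *\<^sub>R a)" by linarith
    with h have eq: "?H a b (x + s *\<^sub>R a + t *\<^sub>R b) = ?H b a (x + s' *\<^sub>R b + t' *\<^sub>R a)"
      by simp
    have "dist (?H a b (x + s *\<^sub>R a + t *\<^sub>R b)) (?H a b x) < e/2"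
      using near[of s t] st by (intro d1) (auto simp: d_def)
    moreover have "dist (?H b a (x + s' *\<^sub>R b + t' *\<^sub>R a)) (?H b a x) < e/2"
      using near[of t' s'] st' by (intro d2) (auto simp: d_def algebra_simps)
    ultimately show ?thesis
      unfolding eq by (smt (verit) dist_commute dist_triangle_half_l less_le)
  qed
  then have "dist (?H a b x) (?H b a x) \<le> 0" using field_le_epsilon by (metis add_0)
  then show ?thesis by simp
qed

lemma second_derivative_symmetric:
  fixes f :: "'a::euclidean_space \<Rightarrow> 'b::euclidean_space"
  assumes "open S" "smooth_on S f" "x \<in> S"
  shows "frechet_derivative (\<lambda>y. frechet_derivative f (at y) a) (at x) b =
         frechet_derivative (\<lambda>y. frechet_derivative f (at y) b) (at x) a"
proof (rule euclidean_eqI)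
  fix e :: 'b
  let ?g = "\<lambda>y. f y \<bullet> e"
  have fst: "frechet_derivative ?g (at y) a = frechet_derivative f (at y) a \<bullet> e" if "y \<in> S" for y a
    by (rule frechet_derivative_linear_compose[OF bounded_linear_inner_left
        smooth_on_differentiable[OF assms(2) that]])
  have snd: "frechet_derivative (\<lambda>y. frechet_derivative ?g (at y) a) (at x) b =
    frechet_derivative (\<lambda>y. frechet_derivative f (at y) a) (at x) b \<bullet> e" for a b
  proof -
    have "frechet_derivative (\<lambda>y. frechet_derivative ?g (at y) a) (at x) b =
      frechet_derivative (\<lambda>y. frechet_derivative f (at y) a \<bullet> e) (at x) b"
      by (subst frechet_derivative_cong_open[OF assms(1,3)]) (simp_all add: fst)
    also have "\<dots> = frechet_derivative (\<lambda>y. frechet_derivative f (at y) a) (at x) b \<bullet> e"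
      by (rule frechet_derivative_linear_compose[OF bounded_linear_inner_left
        smooth_on_differentiable[OF smooth_on_frechet_derivative[OF assms(2)] assms(3)]])
    finally show ?thesis .
  qed
  have "smooth_on S ?g" using assms by (intro smooth_on_inner smooth_on_const)
  from second_derivative_symmetric_real[OF assms(1) this assms(3), of a b]
  show "frechet_derivative (\<lambda>y. frechet_derivative f (at y) a) (at x) b \<bullet> e =
        frechet_derivative (\<lambda>y. frechet_derivative f (at y) b) (at x) a \<bullet> e"
    unfolding snd .
qed

section \<open>Partial derivatives and Christoffel symbols\<close>

lemma axis_decomp: "(x :: real^'n) = (\<Sum>i\<in>UNIV. x $ i *\<^sub>R axis i 1)"
  using basis_expansion[of x] by (simp add: scalar_mult_eq_scaleR)

lemma partial_cong_open:
  "open S \<Longrightarrow> x \<in> S \<Longrightarrow> (\<And>y. y \<in> S \<Longrightarrow> f y = g y) \<Longrightarrow> partial i f x = partial i g x"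
  unfolding partial_def using frechet_derivative_cong_open by metis

lemma partial_eq: "(f has_derivative f') (at x) \<Longrightarrow> partial i f x = f' (axis i 1)"
  unfolding partial_def using frechet_derivative_at by metis

lemma partial_const [simp]: "partial i (\<lambda>x. c) x = 0"
  by (simp add: partial_def)

lemma partial_add:
  "f differentiable (at x) \<Longrightarrow> g differentiable (at x) \<Longrightarrow>
   partial i (\<lambda>x. f x + g x) x = partial i f x + partial i g x"
  by (subst partial_eq[OF has_derivative_add]) (simp_all add: frechet_derivative_works partial_def)

lemma partial_bilinear:
  assumes "bounded_bilinear B" "f differentiable (at x)" "g differentiable (at x)"
  shows "partial i (\<lambda>x. B (f x) (g x)) x = B (f x) (partial i g x) + B (partial i f x) (g x)"
  using bounded_bilinear.FDERIV[OF assms(1) assms(2,3)[unfolded frechet_derivative_works]]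
  by (subst partial_eq) (auto simp: partial_def)

lemma partial_linear:
  assumes "bounded_linear L" "f differentiable (at x)"
  shows "partial i (\<lambda>x. L (f x)) x = L (partial i f x)"
  unfolding partial_def by (rule frechet_derivative_linear_compose[OF assms])

lemma partial_symmetric:
  fixes f :: "real^'n \<Rightarrow> 'b::euclidean_space"
  shows "open S \<Longrightarrow> smooth_on S f \<Longrightarrow> x \<in> S \<Longrightarrow>
    partial i (partial j f) x = partial j (partial i f) x"
  unfolding partial_def using second_derivative_symmetric by blast

lemma partial_sum:
  assumes "\<And>k. k \<in> I \<Longrightarrow> f k differentiable (at x)" "finite I"
  shows "partial i (\<lambda>x. \<Sum>k\<in>I. f k x) x = (\<Sum>k\<in>I. partial i (f k) x)"
  using assms(2,1)
proof (induction I rule: finite_induct)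
  case (insert k F)
  then show ?case by (simp add: partial_add)
qed auto

lemma bounded_bilinear_matrix_vector_mult:
  "bounded_bilinear ((*v) :: real^'n^'m \<Rightarrow> real^'n \<Rightarrow> real^'m)"
  unfolding bilinear_conv_bounded_bilinear[symmetric] bilinear_def
  by (auto intro!: linearI simp: matrix_vector_mult_def vec_eq_iff sum.distrib sum_distrib_left
      algebra_simps)

lemma christoffel_cong_open:
  assumes "open S" "x \<in> S" "\<And>y. y \<in> S \<Longrightarrow> G y = H y"
  shows "christoffel G x k i j = christoffel H x k i j"
  unfolding christoffel_def
  by (intro arg_cong2[where f="(/)"] sum.cong arg_cong2[where f="(*)"] arg_cong2[where f="(+)"]
      arg_cong2[where f="(-)"] partial_cong_open[OF assms(1,2)]) (simp_all add: assms)

text \<open>The curvature depends only on the germ of the metric, so the first fundamental form may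
  be replaced by its expression in a chart.\<close>

lemma gauss_curv_metric_cong_open:
  assumes "open S" "x \<in> S" "\<And>y. y \<in> S \<Longrightarrow> G y = H y"
  shows "gauss_curv_metric G x = gauss_curv_metric H x"
proof -
  have chr: "christoffel G y k i j = christoffel H y k i j" if "y \<in> S" for y k i j
    using christoffel_cong_open[OF assms(1) that assms(3)] .
  have "partial a (\<lambda>y. christoffel G y k i j) x = partial a (\<lambda>y. christoffel H y k i j) x" for a k i j
    by (rule partial_cong_open[OF assms(1,2)]) (rule chr)
  then have "curvature G x l i j k = curvature H x l i j k" for l i j k
    unfolding curvature_def by (simp add: chr[OF assms(2)])
  then show ?thesis unfolding gauss_curv_metric_def using assms by simp
qed

lemma smooth_on_christoffel:
  fixes G :: "real^'n \<Rightarrow> real^'n^'n"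
  assumes "open S" "smooth_on S G" "\<And>x. x \<in> S \<Longrightarrow> det (G x) \<noteq> 0"
  shows "smooth_on S (\<lambda>x. christoffel G x k i j)"
proof -
  have "smooth_on S (partial a (\<lambda>y. G y $ b $ c))" for a b c
    by (intro smooth_on_partial smooth_on_nth assms)
  then have "smooth_on S (\<lambda>x. (1/2) * (\<Sum>l\<in>UNIV. matrix_inv (G x) $ k $ l *
        (partial i (\<lambda>y. G y $ j $ l) x + partial j (\<lambda>y. G y $ i $ l) x
         - partial l (\<lambda>y. G y $ i $ j) x)))"
    by (intro smooth_on_mult smooth_on_const smooth_on_sum smooth_on_add smooth_on_diff
        smooth_on_nth smooth_on_matrix_inv assms)
  then show ?thesis unfolding christoffel_def by simp
qed

text \<open>Lowering the index cancels the \<open>matrix_inv\<close> of the definition and leaves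
  the Christoffel symbols of the first kind.\<close>

lemma christoffel_lower:
  fixes G :: "real^'n \<Rightarrow> real^'n^'n"
  assumes "det (G x) \<noteq> 0"
  shows "(\<Sum>k\<in>UNIV. G x $ l $ k * christoffel G x k i j) =
    (partial i (\<lambda>y. G y $ j $ l) x + partial j (\<lambda>y. G y $ i $ l) x
     - partial l (\<lambda>y. G y $ i $ j) x) / 2"
proof -
  define c :: "real^'n" where "c = (\<chi> l. partial i (\<lambda>y. G y $ j $ l) x + partial j (\<lambda>y. G y $ i $ l) x
     - partial l (\<lambda>y. G y $ i $ j) x)"
  have "christoffel G x k i j = (matrix_inv (G x) *v c) $ k / 2" for k
    by (simp add: christoffel_def c_def matrix_vector_mult_def)
  then have "(\<Sum>k\<in>UNIV. G x $ l $ k * christoffel G x k i j) =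
      (\<Sum>k\<in>UNIV. G x $ l $ k * (matrix_inv (G x) *v c) $ k) / 2"
    by (simp only: sum_divide_distrib times_divide_eq_right)
  also have "(\<Sum>k\<in>UNIV. G x $ l $ k * (matrix_inv (G x) *v c) $ k) =
      (G x *v (matrix_inv (G x) *v c)) $ l"
    by (subst (2) matrix_vector_mult_def) simp
  also have "G x *v (matrix_inv (G x) *v c) = c"
    by (simp add: matrix_vector_mul_assoc matrix_inv_mult[OF assms])
  finally show ?thesis by (simp add: c_def)
qed

lemma det_nonzero_iff_ker:
  fixes B :: "real^'n^'n"
  shows "det B \<noteq> 0 \<longleftrightarrow> (\<forall>v. B *v v = 0 \<longrightarrow> v = 0)"
  unfolding invertible_det_nz[symmetric] invertible_left_inverse matrix_left_invertible_ker ..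

lemma bounded_bilinear_differentiable:
  "bounded_bilinear B \<Longrightarrow> f differentiable (at x) \<Longrightarrow> g differentiable (at x) \<Longrightarrow>
   (\<lambda>x. B (f x) (g x)) differentiable (at x)"
  unfolding differentiable_def using bounded_bilinear.FDERIV by blast

section \<open>Gram matrices\<close>

locale gram_matrix =
  fixes G :: "real^'n^'n"
  assumes sym: "transpose G = G"
    and pos: "v \<noteq> 0 \<Longrightarrow> v \<bullet> (G *v v) > 0"
begin

lemma ip_commute: "v \<bullet> (G *v w) = w \<bullet> (G *v v)"
  by (metis sym dot_lmul_matrix inner_commute transpose_matrix_vector)

lemma kernel_trivial: "G *v v = 0 \<longleftrightarrow> v = 0"
  using pos[of v] by force

lemma det_nonzero: "det G \<noteq> 0"
  unfolding det_nonzero_iff_ker by (simp add: kernel_trivial)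

text \<open>A path of symmetric matrices from \<open>mat 1\<close> to \<open>G\<close> avoids singular ones.\<close>

lemma det_pos: "det G > 0"
proof (rule ccontr)
  assume "\<not> det G > 0"
  let ?P = "\<lambda>t. t *\<^sub>R G + (1 - t) *\<^sub>R mat 1 :: real^'n^'n"
  have "continuous_on {0..1} (\<lambda>t. det (?P t))"
    unfolding det_def by (intro continuous_intros)
  then obtain t where t: "0 \<le> t" "t \<le> 1" "det (?P t) = 0"
    using IVT2'[of "\<lambda>t. det (?P t)" 1 0 0] \<open>\<not> det G > 0\<close> by auto
  have "v \<bullet> (?P t *v v) > 0" if "v \<noteq> 0" for v
  proof -
    have "v \<bullet> (?P t *v v) = t * (v \<bullet> (G *v v)) + (1 - t) * (v \<bullet> v)"
      by (simp add: matrix_vector_mult_add_rdistrib scaleR_matrix_vector_assoc[symmetric]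
          inner_add_right)
    then show ?thesis using t pos[OF that] that
      by (smt (verit) inner_gt_zero_iff mult_nonneg_nonneg mult_pos_pos)
  qed
  then have "?P t *v v = 0 \<Longrightarrow> v = 0" for v by force
  then have "det (?P t) \<noteq> 0"
    unfolding det_nonzero_iff_ker by blast
  with t show False by simp
qed

end

locale gram_matrix_3 = gram_matrix G for G :: "real^3^3"
begin

text \<open>\<open>v \<times> w\<close> is Euclidean orthogonal to \<open>v\<close> and \<open>w\<close>, as is \<open>G *v n\<close>.\<close>

lemma cross_eq:
  assumes "n \<bullet> (G *v n) = 1" "n \<bullet> (G *v v) = 0" "n \<bullet> (G *v w) = 0"
  shows "cross3 v w = det (vector [v, w, n] :: real^3^3) *\<^sub>R (G *v n)"
proof -
  let ?m = "G *v n"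
  have m: "?m \<bullet> v = 0" "?m \<bullet> w = 0" "n \<bullet> ?m = 1"
    using assms ip_commute[of n v] ip_commute[of n w] by (simp_all add: inner_commute)
  have "cross3 n (cross3 ?m (cross3 v w)) = 0"
    by (simp add: Lagrange m)
  then have "(n \<bullet> cross3 v w) *\<^sub>R ?m = cross3 v w"
    by (simp add: Lagrange[of n] m)
  moreover have "n \<bullet> cross3 v w = det (vector [v, w, n] :: real^3^3)"
    unfolding dot_cross_det det_3 vector_3 by (simp add: algebra_simps)
  ultimately show ?thesis by simp
qed

text \<open>By the cofactor identity, \<open>G\<close> maps the left side to \<open>det G\<close>
  times \<open>cross3 v w\<close>; symmetry of \<open>G\<close> removes the transpose. By
  \<open>cross_eq\<close> this is \<open>G\<close> applied to the right side, and \<open>G\<close>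
  is injective.\<close>

lemma cross_mult_eq:
  assumes "n \<bullet> (G *v n) = 1" "n \<bullet> (G *v v) = 0" "n \<bullet> (G *v w) = 0"
  shows "cross3 (G *v v) (G *v w) = (det G * det (vector [v, w, n] :: real^3^3)) *\<^sub>R n"
proof -
  have "G *v cross3 (G *v v) (G *v w) = det G *\<^sub>R cross3 v w"
    using cross_matrix_mult[of G v w] by (simp only: sym)
  also have "\<dots> = G *v ((det G * det (vector [v, w, n] :: real^3^3)) *\<^sub>R n)"
    by (simp add: cross_eq[OF assms] matrix_vector_mult_scaleR)
  finally have "G *v (cross3 (G *v v) (G *v w) -
      (det G * det (vector [v, w, n] :: real^3^3)) *\<^sub>R n) = 0"
    by (simp add: matrix_vector_mult_diff_distrib)
  then show ?thesis by (simp add: kernel_trivial)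
qed

text \<open>The Binet-Cauchy identity turns the left side into the inner product of
  \<open>cross3 a b\<close> with \<open>cross3 (G *v v) (G *v w)\<close>, which are multiples of
  \<open>G *v n\<close> and \<open>n\<close>. Both the first and the second fundamental form get
  their determinants from this one identity.\<close>

lemma gram_det_eq:
  assumes "n \<bullet> (G *v n) = 1" "n \<bullet> (G *v a) = 0" "n \<bullet> (G *v b) = 0"
    "n \<bullet> (G *v v) = 0" "n \<bullet> (G *v w) = 0"
  shows "(a \<bullet> (G *v v)) * (b \<bullet> (G *v w)) - (a \<bullet> (G *v w)) * (b \<bullet> (G *v v)) =
    det G * det (vector [a, b, n] :: real^3^3) * det (vector [v, w, n] :: real^3^3)"
proof -
  have "(a \<bullet> (G *v v)) * (b \<bullet> (G *v w)) - (a \<bullet> (G *v w)) * (b \<bullet> (G *v v)) =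
      cross3 a b \<bullet> cross3 (G *v v) (G *v w)"
    by (simp add: dot_cross)
  then show ?thesis
    using assms by (simp add: cross_eq cross_mult_eq inner_commute)
qed

text \<open>A skew form on 3-space is the cross product paired with a fixed axial vector, and the
  cross product of two tangential vectors is a multiple of \<open>G *v n\<close>. This is where the
  factor \<open>area\<close> of the ambient curvature term comes from.\<close>

lemma skew_form_eq:
  assumes "n \<bullet> (G *v n) = 1" "n \<bullet> (G *v v) = 0" "n \<bullet> (G *v w) = 0"
    and skew: "\<And>x y. x \<bullet> (S *v y) = - (y \<bullet> (S *v x))"
  shows "v \<bullet> (S *v w) = det (vector [v, w, n] :: real^3^3) *
    ((G *v n) \<bullet> vector [S $ 2 $ 3, S $ 3 $ 1, S $ 1 $ 2])"
proof -
  have "S $ i $ j = - (S $ j $ i)" for i j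
    using skew[of "axis i 1" "axis j 1"]
    by (simp add: matrix_vector_mult_basis inner_axis' column_def)
  then have S: "S $ 1 $ 1 = 0" "S $ 2 $ 2 = 0" "S $ 3 $ 3 = 0"
    "S $ 2 $ 1 = - (S $ 1 $ 2)" "S $ 3 $ 2 = - (S $ 2 $ 3)" "S $ 1 $ 3 = - (S $ 3 $ 1)"
    by (smt (verit))+
  have "v \<bullet> (S *v w) = cross3 v w \<bullet> vector [S $ 2 $ 3, S $ 3 $ 1, S $ 1 $ 2]"
    by (simp add: matrix_vector_mult_def inner_vec_def sum_3 cross3_def vector_3 S algebra_simps)
  then show ?thesis by (simp add: cross_eq[OF assms(1-3)])
qed

text \<open>A kernel vector of the transposed matrix is a linear relation among \<open>v\<close>,
  \<open>w\<close>, \<open>n\<close>; pairing the relation with \<open>n\<close> shows that the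
  coefficient of \<open>n\<close> is zero.\<close>

lemma det_eq_0_iff_dependent:
  assumes "n \<bullet> (G *v n) = 1" "n \<bullet> (G *v v) = 0" "n \<bullet> (G *v w) = 0"
  shows "det (vector [v, w, n] :: real^3^3) = 0 \<longleftrightarrow>
    (\<exists>a :: real^2. a \<noteq> 0 \<and> a $ 1 *\<^sub>R v + a $ 2 *\<^sub>R w = 0)"
proof
  assume "\<exists>a :: real^2. a \<noteq> 0 \<and> a $ 1 *\<^sub>R v + a $ 2 *\<^sub>R w = 0"
  then obtain a :: "real^2" where a: "a \<noteq> 0" "a $ 1 *\<^sub>R v + a $ 2 *\<^sub>R w = 0" by blast
  have "a $ 1 * det (vector [v, w, n] :: real^3^3) = det (vector [a $ 1 *\<^sub>R v + a $ 2 *\<^sub>R w, w, n] :: real^3^3)"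
    "a $ 2 * det (vector [v, w, n] :: real^3^3) = det (vector [v, a $ 1 *\<^sub>R v + a $ 2 *\<^sub>R w, n] :: real^3^3)"
    unfolding det_3 by (simp_all add: algebra_simps)
  then show "det (vector [v, w, n] :: real^3^3) = 0"
    using a(1) unfolding a(2) by (auto simp: vec_eq_iff forall_2 det_3)
next
  let ?B = "vector [v, w, n] :: real^3^3"
  assume "det ?B = 0"
  then have "det (transpose ?B) = 0" by (simp add: det_transpose)
  then obtain y where y: "y \<noteq> 0" "transpose ?B *v y = 0"
    using det_nonzero_iff_ker by blast
  have sum: "y $ 1 *\<^sub>R v + y $ 2 *\<^sub>R w + y $ 3 *\<^sub>R n = 0"
    using y(2) by (simp add: vec_eq_iff forall_3 matrix_vector_mult_def transpose_def sum_3 mult.commute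
        del: transpose_matrix_vector)
  have "n \<bullet> (G *v (y $ 1 *\<^sub>R v + y $ 2 *\<^sub>R w + y $ 3 *\<^sub>R n)) = y $ 3"
    by (simp add: assms matrix_vector_right_distrib matrix_vector_mult_scaleR inner_add_right)
  then have y3: "y $ 3 = 0" unfolding sum by simp
  have "(vector [y $ 1, y $ 2] :: real^2) \<noteq> 0"
    using y(1) y3 by (auto simp: vec_eq_iff forall_2 forall_3)
  then show "\<exists>a :: real^2. a \<noteq> 0 \<and> a $ 1 *\<^sub>R v + a $ 2 *\<^sub>R w = 0"
    using sum y3 by (intro exI[of _ "vector [y $ 1, y $ 2]"]) simp
qed

end

section \<open>The Gauss equation along a frontal\<close>

text \<open>
  \<open>G\<close> and \<open>A i\<close> are the fibre metric and the connection matrices of the pull-back of the tangent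
  bundle of the ambient manifold, \<open>X i\<close> is the \<open>i\<close>-th partial derivative of the map.
\<close>

locale frontal_data =
  fixes V :: "(real^2) set" and G :: "real^2 \<Rightarrow> real^3^3" and A :: "2 \<Rightarrow> real^2 \<Rightarrow> real^3^3"
    and X :: "2 \<Rightarrow> real^2 \<Rightarrow> real^3" and n :: "real^2 \<Rightarrow> real^3"
  assumes open_V: "open V"
    and smooth_G: "smooth_on V G" and smooth_A: "\<And>i. smooth_on V (A i)"
    and smooth_X: "\<And>i. smooth_on V (X i)" and smooth_n: "smooth_on V n"
    and gram: "\<And>x. x \<in> V \<Longrightarrow> gram_matrix_3 (G x)"
    and metric_connection: "\<And>x i v w. x \<in> V \<Longrightarrow>
      v \<bullet> (partial i G x *v w) = (A i x *v v) \<bullet> (G x *v w) + v \<bullet> (G x *v (A i x *v w))"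
    and torsion_free: "\<And>x i j. x \<in> V \<Longrightarrow>
      partial i (X j) x + A i x *v X j x = partial j (X i) x + A j x *v X i x"
    and unit: "\<And>x. x \<in> V \<Longrightarrow> n x \<bullet> (G x *v n x) = 1"
    and normal: "\<And>x i. x \<in> V \<Longrightarrow> n x \<bullet> (G x *v X i x) = 0"
begin

definition ip :: "real^2 \<Rightarrow> real^3 \<Rightarrow> real^3 \<Rightarrow> real" where
  "ip x v w = v \<bullet> (G x *v w)"

definition cov :: "2 \<Rightarrow> (real^2 \<Rightarrow> real^3) \<Rightarrow> real^2 \<Rightarrow> real^3" where
  "cov i Y x = partial i Y x + A i x *v Y x"

definition curv :: "real^2 \<Rightarrow> real^3^3" where
  "curv x = partial 1 (A 2) x - partial 2 (A 1) x + A 1 x ** A 2 x - A 2 x ** A 1 x"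

definition N :: "2 \<Rightarrow> real^2 \<Rightarrow> real^3" where "N i = cov i n"

definition first_form :: "real^2 \<Rightarrow> real^2^2" where
  "first_form x = (\<chi> i j. ip x (X i x) (X j x))"

text \<open>The bare coordinate determinant; the factor \<open>sqrt (det (G x))\<close> that turns
  it into the Riemannian area density enters in \<open>density\<close>.\<close>

definition area :: "real^2 \<Rightarrow> real" where
  "area x = det (vector [X 1 x, X 2 x, n x] :: real^3^3)"

definition gauss_area :: "real^2 \<Rightarrow> real" where
  "gauss_area x = det (vector [N 1 x, N 2 x, n x] :: real^3^3)"

text \<open>The quotient of \<open>ip x (X 1 x) (curv x *v X 2 x)\<close> by \<open>area x\<close>,
  written without division: the axial vector of the skew form \<open>G x ** curv x\<close> paired
  with the conormal.\<close>

definition ambient_term :: "real^2 \<Rightarrow> real" where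
  "ambient_term x = (let S = G x ** curv x in (G x *v n x) \<bullet> vector [S $ 2 $ 3, S $ 3 $ 1, S $ 1 $ 2])"

section \<open>Smoothness of the derived data and the product rule\<close>

lemma ip_commute: "x \<in> V \<Longrightarrow> ip x v w = ip x w v"
  unfolding ip_def by (rule gram_matrix.ip_commute[OF gram_matrix_3.axioms[OF gram]])

lemma ip_linear:
  "ip x (v + v') w = ip x v w + ip x v' w" "ip x v (w + w') = ip x v w + ip x v w'"
  "ip x (v - v') w = ip x v w - ip x v' w" "ip x v (w - w') = ip x v w - ip x v w'"
  "ip x (c *\<^sub>R v) w = c * ip x v w" "ip x v (c *\<^sub>R w) = c * ip x v w"
  "ip x 0 w = 0" "ip x v 0 = 0" "ip x (- v) w = - ip x v w" "ip x v (- w) = - ip x v w"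
  using matrix_vector_mult_diff_distrib[of "G x" 0 w]
  by (simp_all add: ip_def inner_add_left inner_diff_left matrix_vector_right_distrib
      inner_add_right matrix_vector_mult_diff_distrib inner_diff_right matrix_vector_mult_scaleR)

lemma smooth_ip: "smooth_on V Y \<Longrightarrow> smooth_on V Z \<Longrightarrow> smooth_on V (\<lambda>x. ip x (Y x) (Z x))"
  unfolding ip_def by (intro smooth_on_inner smooth_on_mat_vec_mult open_V smooth_G)

lemma smooth_cov: "smooth_on V Y \<Longrightarrow> smooth_on V (cov i Y)"
  unfolding cov_def[abs_def]
  by (intro smooth_on_add smooth_on_mat_vec_mult smooth_on_partial open_V smooth_A)

lemma smooth_N: "smooth_on V (N i)"
  unfolding N_def by (intro smooth_cov smooth_n)

lemma smooth_det_vector: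
  assumes "smooth_on V a" "smooth_on V b" "smooth_on V c"
  shows "smooth_on V (\<lambda>x. det (vector [a x, b x, c x] :: real^3^3))"
  unfolding det_3 vector_3
  by (intro smooth_on_add smooth_on_diff smooth_on_mult smooth_on_nth open_V assms)

lemma smooth_area: "smooth_on V area"
  unfolding area_def[abs_def] by (intro smooth_det_vector smooth_X smooth_n)

lemma smooth_gauss_area: "smooth_on V gauss_area"
  unfolding gauss_area_def[abs_def] by (intro smooth_det_vector smooth_N smooth_n)

lemma smooth_first_form: "smooth_on V first_form"
proof (intro smooth_on_vec open_V)
  show "smooth_on V (\<lambda>x. first_form x $ i $ j)" for i j
    unfolding first_form_def by (simp add: smooth_ip smooth_X)
qed

lemma smooth_curv: "smooth_on V curv"
  unfolding curv_def[abs_def]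
  by (intro smooth_on_add smooth_on_diff smooth_on_mat_mult smooth_on_partial open_V smooth_A)

lemma smooth_ambient_term: "smooth_on V ambient_term"
proof -
  have S: "smooth_on V (\<lambda>x. (G x ** curv x) $ i $ j)" for i j
    by (intro smooth_on_nth smooth_on_mat_mult open_V smooth_G smooth_curv)
  have "smooth_on V (\<lambda>x. vector [(G x ** curv x) $ 2 $ 3, (G x ** curv x) $ 3 $ 1,
      (G x ** curv x) $ 1 $ 2] :: real^3)"
  proof (intro smooth_on_vec open_V)
    fix i :: 3
    show "smooth_on V (\<lambda>x. (vector [(G x ** curv x) $ 2 $ 3, (G x ** curv x) $ 3 $ 1,
      (G x ** curv x) $ 1 $ 2] :: real^3) $ i)"
      using exhaust_3[of i] S by auto
  qed
  then show ?thesis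
    unfolding ambient_term_def[abs_def] Let_def
    by (intro smooth_on_inner smooth_on_mat_vec_mult open_V smooth_G smooth_n)
qed

lemma partial_ip:
  assumes "x \<in> V" "Y differentiable (at x)" "Z differentiable (at x)"
  shows "partial i (\<lambda>x. ip x (Y x) (Z x)) x = ip x (cov i Y x) (Z x) + ip x (Y x) (cov i Z x)"
proof -
  have G: "G differentiable (at x)" by (rule smooth_on_differentiable[OF smooth_G assms(1)])
  have "(\<lambda>x. G x *v Z x) differentiable (at x)"
    using bounded_bilinear_differentiable[OF bounded_bilinear_matrix_vector_mult G assms(3)] .
  then have "partial i (\<lambda>x. ip x (Y x) (Z x)) x =
      Y x \<bullet> (G x *v partial i Z x + partial i G x *v Z x) + partial i Y x \<bullet> (G x *v Z x)"
    unfolding ip_def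
    by (simp add: partial_bilinear[OF bounded_bilinear_inner assms(2)]
        partial_bilinear[OF bounded_bilinear_matrix_vector_mult G assms(3)])
  also have "\<dots> = ip x (cov i Y x) (Z x) + ip x (Y x) (cov i Z x)"
    by (simp add: ip_def cov_def metric_connection[OF assms(1)] inner_add_left inner_add_right
        matrix_vector_right_distrib)
  finally show ?thesis .
qed

lemma partial_ip_smooth:
  "x \<in> V \<Longrightarrow> smooth_on V Y \<Longrightarrow> smooth_on V Z \<Longrightarrow>
   partial i (\<lambda>x. ip x (Y x) (Z x)) x = ip x (cov i Y x) (Z x) + ip x (Y x) (cov i Z x)"
  by (intro partial_ip smooth_on_differentiable)

section \<open>Curvature of the connection\<close>

lemma partial_cov:
  assumes "x \<in> V" "smooth_on V Y"
  shows "partial i (cov j Y) x =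
    partial i (partial j Y) x + (A j x *v partial i Y x + partial i (A j) x *v Y x)"
proof -
  have "(\<lambda>x. A j x *v Y x) differentiable (at x)" "partial j Y differentiable (at x)"
    by (rule smooth_on_differentiable[OF _ assms(1)],
        intro smooth_on_mat_vec_mult smooth_on_partial open_V smooth_A assms(2))+
  then show ?thesis
    unfolding cov_def[abs_def]
    by (simp add: partial_add partial_bilinear[OF bounded_bilinear_matrix_vector_mult]
        smooth_on_differentiable[OF smooth_A assms(1)]
        smooth_on_differentiable[OF assms(2,1)])
qed

text \<open>The second partial derivatives of \<open>Y\<close> cancel by symmetry, and the terms
  with first derivatives are the same in both orders; only terms linear in \<open>Y\<close> itself
  survive.\<close>

lemma cov_commutator:
  assumes "x \<in> V" "smooth_on V Y"
  shows "cov 1 (cov 2 Y) x - cov 2 (cov 1 Y) x = curv x *v Y x"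
  unfolding cov_def[of _ "cov _ Y"] partial_cov[OF assms]
  unfolding cov_def curv_def partial_symmetric[OF open_V assms(2,1), of 1 2]
  by (simp add: matrix_vector_right_distrib matrix_vector_mult_add_rdistrib
      matrix_vector_mult_diff_rdistrib matrix_vector_mul_assoc)

text \<open>Second partial derivatives of the function \<open>ip y v w\<close> with constant
  \<open>v\<close>, \<open>w\<close> commute. Expanded by metric compatibility, the mixed products
  cancel in the difference and the two commutators remain.\<close>

lemma curv_skew:
  assumes "x \<in> V"
  shows "ip x v (curv x *v w) = - ip x w (curv x *v v)"
proof -
  have c: "smooth_on V (\<lambda>_. u)" for u :: "real^3" by (rule smooth_on_const)
  have D: "partial i (partial j (\<lambda>y. ip y v w)) x =
      ip x (cov i (cov j (\<lambda>_. v)) x) w + ip x (cov j (\<lambda>_. v) x) (cov i (\<lambda>_. w) x) +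
      (ip x (cov i (\<lambda>_. v) x) (cov j (\<lambda>_. w) x) + ip x v (cov i (cov j (\<lambda>_. w)) x))" for i j
  proof -
    have "partial i (partial j (\<lambda>y. ip y v w)) x =
      partial i (\<lambda>y. ip y (cov j (\<lambda>_. v) y) w + ip y v (cov j (\<lambda>_. w) y)) x"
      using partial_ip_smooth[OF _ c c] by (intro partial_cong_open[OF open_V assms]) auto
    also have "\<dots> = partial i (\<lambda>y. ip y (cov j (\<lambda>_. v) y) w) x
        + partial i (\<lambda>y. ip y v (cov j (\<lambda>_. w) y)) x"
      by (intro partial_add smooth_on_differentiable[OF _ assms] smooth_ip smooth_cov c)
    finally show ?thesis
      using partial_ip_smooth[OF assms smooth_cov[OF c] c] partial_ip_smooth[OF assms c smooth_cov[OF c]]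
      by simp
  qed
  have "smooth_on V (\<lambda>y. ip y v w)" by (intro smooth_ip c)
  from partial_symmetric[OF open_V this assms, of 1 2]
  have "ip x (cov 1 (cov 2 (\<lambda>_. v)) x - cov 2 (cov 1 (\<lambda>_. v)) x) w
      + ip x v (cov 1 (cov 2 (\<lambda>_. w)) x - cov 2 (cov 1 (\<lambda>_. w)) x) = 0"
    unfolding D by (simp add: ip_linear)
  then have "ip x (curv x *v v) w + ip x v (curv x *v w) = 0"
    unfolding cov_commutator[OF assms c] .
  then show ?thesis using ip_commute[OF assms, of w] by simp
qed

lemma ambient_curvature_eq:
  assumes "x \<in> V"
  shows "ip x (X 1 x) (curv x *v X 2 x) = area x * ambient_term x"
proof -
  have "a \<bullet> ((G x ** curv x) *v b) = - (b \<bullet> ((G x ** curv x) *v a))" for a b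
    using curv_skew[OF assms, of a b] by (simp add: ip_def matrix_vector_mul_assoc)
  from gram_matrix_3.skew_form_eq[OF gram[OF assms] unit[OF assms] normal[OF assms] normal[OF assms] this]
  show ?thesis
    by (simp add: ip_def matrix_vector_mul_assoc area_def ambient_term_def Let_def)
qed

section \<open>First and second fundamental forms\<close>

lemma N_tangent: "x \<in> V \<Longrightarrow> n x \<bullet> (G x *v N i x) = 0"
proof -
  assume x: "x \<in> V"
  have "partial i (\<lambda>y. ip y (n y) (n y)) x = partial i (\<lambda>y. 1) x"
    using unit by (intro partial_cong_open[OF open_V x]) (simp add: ip_def)
  then have "ip x (n x) (N i x) = 0"
    using partial_ip_smooth[OF x smooth_n smooth_n, of i] ip_commute[OF x, of "n x" "N i x"]
    by (simp add: N_def)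
  then show ?thesis by (simp add: ip_def)
qed

lemma second_form_eq:
  assumes "x \<in> V"
  shows "ip x (cov i (X j) x) (n x) = - ip x (X j x) (N i x)"
proof -
  have "partial i (\<lambda>y. ip y (X j y) (n y)) x = partial i (\<lambda>y. 0) x"
    using normal ip_commute by (intro partial_cong_open[OF open_V assms]) (simp add: ip_def)
  then show ?thesis
    using partial_ip_smooth[OF assms smooth_X smooth_n, of i j] by (simp add: N_def)
qed

lemma cov_X_commute: "x \<in> V \<Longrightarrow> cov i (X j) x = cov j (X i) x"
  unfolding cov_def by (rule torsion_free)

text \<open>By the Weingarten relation the entries are the products of \<open>X j\<close> with
  \<open>N i\<close> up to sign. As all four vectors are tangential, \<open>gram_det_eq\<close>
  factors the determinant into \<open>area\<close> and \<open>gauss_area\<close>.\<close>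

lemma det_second_form:
  assumes "x \<in> V"
  shows "ip x (cov 1 (X 1) x) (n x) * ip x (cov 2 (X 2) x) (n x)
      - ip x (cov 1 (X 2) x) (n x) * ip x (cov 1 (X 2) x) (n x) =
    det (G x) * area x * gauss_area x"
proof -
  have "ip x (X 2 x) (N 1 x) = ip x (X 1 x) (N 2 x)"
    using second_form_eq[OF assms, of 1 2] second_form_eq[OF assms, of 2 1]
      cov_X_commute[OF assms, of 1 2] by simp
  moreover have "ip x (X 1 x) (N 1 x) * ip x (X 2 x) (N 2 x)
      - ip x (X 1 x) (N 2 x) * ip x (X 2 x) (N 1 x) = det (G x) * area x * gauss_area x"
    unfolding ip_def area_def gauss_area_def
    by (intro gram_matrix_3.gram_det_eq gram unit normal N_tangent assms)
  ultimately show ?thesis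
    by (simp add: second_form_eq[OF assms])
qed

lemma det_first_form:
  assumes "x \<in> V"
  shows "det (first_form x) = det (G x) * area x * area x"
proof -
  have "ip x (X 1 x) (X 1 x) * ip x (X 2 x) (X 2 x)
      - ip x (X 1 x) (X 2 x) * ip x (X 2 x) (X 1 x) = det (G x) * area x * area x"
    unfolding ip_def area_def
    by (intro gram_matrix_3.gram_det_eq gram unit normal assms)
  then show ?thesis by (simp add: det_2 first_form_def)
qed

text \<open>The Koszul formula for the induced metric: of the six terms produced by metric
  compatibility, four cancel by torsion-freeness. Nonvanishing \<open>area\<close> makes the first
  form invertible.\<close>

lemma christoffel_first_form:
  assumes "x \<in> V" "area x \<noteq> 0"
  shows "(\<Sum>k\<in>UNIV. ip x (X l x) (X k x) * christoffel first_form x k i j) =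
    ip x (X l x) (cov i (X j) x)"
proof -
  have d: "partial k (\<lambda>y. first_form y $ a $ b) x =
      ip x (cov k (X a) x) (X b x) + ip x (X a x) (cov k (X b) x)" for k a b
    using partial_ip_smooth[OF assms(1) smooth_X smooth_X] by (simp add: first_form_def)
  have "det (first_form x) \<noteq> 0"
    using assms gram_matrix.det_pos[OF gram_matrix_3.axioms[OF gram[OF assms(1)]]] by (simp add: det_first_form)
  from christoffel_lower[of first_form x l i j, OF this] show ?thesis
    unfolding d
    by (simp add: first_form_def ip_commute[OF assms(1), of "cov _ _ _"]
        cov_X_commute[OF assms(1), of j i] cov_X_commute[OF assms(1), of l i]
        cov_X_commute[OF assms(1), of l j])
qed

text \<open>The Gauss formula. Both sides have the same inner products with \<open>X 1\<close>,
  \<open>X 2\<close> and \<open>n\<close>, which form a basis where \<open>area\<close> is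
  nonzero.\<close>

lemma tangential_part:
  assumes "x \<in> V" "area x \<noteq> 0"
  shows "(\<Sum>k\<in>UNIV. christoffel first_form x k i j *\<^sub>R X k x) =
    cov i (X j) x - ip x (cov i (X j) x) (n x) *\<^sub>R n x"
    (is "?T = ?R")
proof -
  let ?z = "G x *v (?T - ?R)"
  have nn: "ip x (n x) (n x) = 1" "ip x (X k x) (n x) = 0" "ip x (n x) (X k x) = 0" for k
    using unit[OF assms(1)] normal[OF assms(1)] ip_commute[OF assms(1)] by (simp_all add: ip_def)
  have "X l x \<bullet> ?z = 0" for l
  proof -
    have "ip x (X l x) ?T = ip x (X l x) (cov i (X j) x)"
      using christoffel_first_form[OF assms, of l i j] by (simp add: ip_linear sum_2 mult.commute)
    then show ?thesis unfolding ip_def[symmetric] by (simp add: ip_linear nn del: sum_2)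
  qed
  moreover have "n x \<bullet> ?z = 0"
    unfolding ip_def[symmetric] by (simp add: ip_linear nn sum_2 ip_commute[OF assms(1), of "n x" "cov i (X j) x"])
  ultimately have "(vector [X 1 x, X 2 x, n x] :: real^3^3) *v ?z = 0"
    by (simp add: vec_eq_iff matrix_vector_mul_component forall_3)
  then have "?z = 0"
    using assms(2) unfolding area_def det_nonzero_iff_ker by blast
  then show ?thesis using gram_matrix.kernel_trivial[OF gram_matrix_3.axioms[OF gram[OF assms(1)]]] by simp
qed

text \<open>Lowered by \<open>X 1\<close>, the Riemann tensor becomes a commutator of covariant
  derivatives together with products of the \<open>cov i (X j)\<close>. Removing their tangential
  parts leaves the products of normal parts, that is, the determinant of the second form. The
  numerator contributes one factor \<open>area\<close> against two in \<open>det_first_form\<close>,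
  so exactly one stays in the denominator.\<close>

theorem gauss_equation:
  assumes x: "x \<in> V" and "area x \<noteq> 0"
  shows "gauss_curv_metric first_form x = (ambient_term x + det (G x) * gauss_area x) / (det (G x) * area x)"
proof -
  \<comment> \<open>Derivatives of the Christoffel symbols require an open set on which the first
    form is invertible.\<close>
  define V' where "V' = {y \<in> V. area y \<noteq> 0}"
  have "open V'"
  proof -
    have "V' = V \<inter> area -` (- {0})" by (auto simp: V'_def)
    moreover have "open (V \<inter> area -` (- {0}))"
      using smooth_on_continuous[OF smooth_area] open_V by (intro continuous_open_preimage) auto
    ultimately show ?thesis by simp
  qed
  have xV': "x \<in> V'" using assms by (simp add: V'_def)
  have dG: "det (G y) > 0" if "y \<in> V" for y using gram_matrix.det_pos[OF gram_matrix_3.axioms[OF gram[OF that]]] .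
  let ?c = "\<lambda>k i j y. christoffel first_form y k i j"
  have smooth_c: "smooth_on V' (?c k i j)" for k i j
  proof (rule smooth_on_christoffel[OF \<open>open V'\<close>])
    show "smooth_on V' first_form" using smooth_on_subset[OF smooth_first_form] by (auto simp: V'_def)
    show "det (first_form y) \<noteq> 0" if "y \<in> V'" for y
      using that dG[of y] by (auto simp: V'_def det_first_form)
  qed
  have diff_c: "?c k i j differentiable (at x)" for k i j
    by (rule smooth_on_differentiable[OF smooth_c xV'])
  have diff_h: "(\<lambda>y. ip y (X l y) (X k y)) differentiable (at x)" for k l
    by (intro smooth_on_differentiable[OF _ x] smooth_ip smooth_X)
  \<comment> \<open>Differentiates the identity \<open>christoffel_first_form\<close> and solves for
    the terms with a differentiated Christoffel symbol, so the derivative of the inverse matrix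
    never appears.\<close>
  have deriv: "(\<Sum>k\<in>UNIV. ip x (X 1 x) (X k x) * partial a (?c k i j) x) =
      ip x (cov a (X 1) x) (cov i (X j) x) + ip x (X 1 x) (cov a (cov i (X j)) x)
      - (\<Sum>k\<in>UNIV. (ip x (cov a (X 1) x) (X k x) + ip x (X 1 x) (cov a (X k) x)) * ?c k i j x)"
    for a i j
  proof -
    have "partial a (\<lambda>y. \<Sum>k\<in>UNIV. ip y (X 1 y) (X k y) * ?c k i j y) x =
        partial a (\<lambda>y. ip y (X 1 y) (cov i (X j) y)) x"
      using christoffel_first_form
      by (intro partial_cong_open[OF \<open>open V'\<close> xV']) (simp add: V'_def)
    moreover have "partial a (\<lambda>y. \<Sum>k\<in>UNIV. ip y (X 1 y) (X k y) * ?c k i j y) x =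
        (\<Sum>k\<in>UNIV. partial a (\<lambda>y. ip y (X 1 y) (X k y) * ?c k i j y) x)"
      by (intro partial_sum differentiable_mult diff_h diff_c) simp
    moreover have "partial a (\<lambda>y. ip y (X 1 y) (X k y) * ?c k i j y) x =
        ip x (X 1 x) (X k x) * partial a (?c k i j) x +
        (ip x (cov a (X 1) x) (X k x) + ip x (X 1 x) (cov a (X k) x)) * ?c k i j x" for k
      unfolding partial_bilinear[OF bounded_bilinear_mult diff_h diff_c]
        partial_ip_smooth[OF x smooth_X smooth_X] ..
    ultimately show ?thesis
      by (simp only: partial_ip_smooth[OF x smooth_X smooth_cov[OF smooth_X]] sum.distrib
          eq_diff_eq)
  qed
  have low: "(\<Sum>l\<in>UNIV. ip x (X 1 x) (X l x) * (\<Sum>m\<in>UNIV. ?c l i m x * ?c m j k x)) =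
      (\<Sum>m\<in>UNIV. ip x (X 1 x) (cov i (X m) x) * ?c m j k x)" for i j k
    unfolding christoffel_first_form[OF assms, symmetric]
    by (simp add: sum_2 algebra_simps)
  \<comment> \<open>Pairing the Gauss formula with an arbitrary vector replaces each remaining
    Christoffel sum by a full product minus the product of normal components.\<close>
  have proj: "(\<Sum>k\<in>UNIV. ip x Y (X k x) * ?c k i j x) =
      ip x Y (cov i (X j) x) - ip x (cov i (X j) x) (n x) * ip x Y (n x)" for Y i j
  proof -
    have "(\<Sum>k\<in>UNIV. ip x Y (X k x) * ?c k i j x) = ip x Y (\<Sum>k\<in>UNIV. ?c k i j x *\<^sub>R X k x)"
      by (simp add: sum_2 ip_linear)
    then show ?thesis unfolding tangential_part[OF assms] by (simp add: ip_linear)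
  qed
  have "(\<Sum>l\<in>UNIV. first_form x $ l $ 1 * curvature first_form x l 1 2 2) =
      (\<Sum>l\<in>UNIV. ip x (X 1 x) (X l x) * partial 1 (?c l 2 2) x)
      - (\<Sum>l\<in>UNIV. ip x (X 1 x) (X l x) * partial 2 (?c l 1 2) x)
      + (\<Sum>l\<in>UNIV. ip x (X 1 x) (X l x) * (\<Sum>m\<in>UNIV. ?c l 1 m x * ?c m 2 2 x))
      - (\<Sum>l\<in>UNIV. ip x (X 1 x) (X l x) * (\<Sum>m\<in>UNIV. ?c l 2 m x * ?c m 1 2 x))"
    unfolding curvature_def first_form_def
    by (simp add: sum_2 ip_commute[OF x, of "X 2 x" "X 1 x"] algebra_simps)
  also have "\<dots> = ip x (cov 1 (X 1) x) (cov 2 (X 2) x) - ip x (cov 2 (X 1) x) (cov 1 (X 2) x)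
      + ip x (X 1 x) (cov 1 (cov 2 (X 2)) x - cov 2 (cov 1 (X 2)) x)
      - (\<Sum>k\<in>UNIV. ip x (cov 1 (X 1) x) (X k x) * ?c k 2 2 x)
      + (\<Sum>k\<in>UNIV. ip x (cov 2 (X 1) x) (X k x) * ?c k 1 2 x)"
    unfolding deriv low by (simp add: sum_2 ip_linear algebra_simps)
  also have "\<dots> = ip x (X 1 x) (curv x *v X 2 x)
      + (ip x (cov 1 (X 1) x) (n x) * ip x (cov 2 (X 2) x) (n x)
      - ip x (cov 1 (X 2) x) (n x) * ip x (cov 1 (X 2) x) (n x))"
    unfolding proj cov_commutator[OF x smooth_X] cov_X_commute[OF x, of 2 1] by simp
  also have "\<dots> = area x * (ambient_term x + det (G x) * gauss_area x)"
    unfolding ambient_curvature_eq[OF x] det_second_form[OF x] by (simp add: algebra_simps)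
  finally show ?thesis
    unfolding gauss_curv_metric_def det_first_form[OF x] using assms(2) dG[OF x]
    by (simp add: field_simps)
qed

section \<open>Densities that are defined across the singular set\<close>

definition density :: "real^2 \<Rightarrow> real" where
  "density x = sqrt (det (G x)) * area x"

text \<open>The right side of \<open>gauss_equation\<close> times \<open>density\<close> after
  \<open>area\<close> has been cancelled; what is left makes sense at singular points as
  well.\<close>

definition curvature_density :: "real^2 \<Rightarrow> real" where
  "curvature_density x = (ambient_term x + det (G x) * gauss_area x) / sqrt (det (G x))"

lemma det_G_pos: "x \<in> V \<Longrightarrow> det (G x) > 0"
  by (rule gram_matrix.det_pos[OF gram_matrix_3.axioms[OF gram]])

lemma smooth_density: "smooth_on V density"
  unfolding density_def[abs_def]
  by (intro smooth_on_mult smooth_on_sqrt smooth_on_det open_V smooth_G smooth_area det_G_pos)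

lemma smooth_curvature_density: "smooth_on V curvature_density"
proof -
  have "sqrt (det (G x)) \<noteq> 0" if "x \<in> V" for x using det_G_pos[OF that] by simp
  then show ?thesis
    unfolding curvature_density_def[abs_def]
    by (intro smooth_on_divide smooth_on_add smooth_on_mult smooth_on_sqrt smooth_on_det open_V
        smooth_G smooth_ambient_term smooth_gauss_area det_G_pos)
qed

lemma density_eq_0_iff: "x \<in> V \<Longrightarrow> density x = 0 \<longleftrightarrow> area x = 0"
  using det_G_pos[of x] by (auto simp: density_def)

lemma curvature_times_density:
  assumes "x \<in> V" "area x \<noteq> 0"
  shows "gauss_curv_metric first_form x * density x = curvature_density x"
proof -
  obtain s where s: "sqrt (det (G x)) = s" "det (G x) = s * s" "s > 0"
    using det_G_pos[OF assms(1)] by fastforce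
  show ?thesis
    unfolding gauss_equation[OF assms] density_def curvature_density_def s(1)
    unfolding s(2) using s(3) assms(2) by (simp add: field_simps)
qed

text \<open>At a singular point \<open>Xa\<close> and \<open>Nb\<close> are orthogonal and nonzero, hence span the tangent plane.\<close>

lemma gauss_area_eq_0_iff:
  fixes a b :: "real^2"
  assumes x: "x \<in> V" and ab: "a $ 1 * b $ 2 - a $ 2 * b $ 1 \<noteq> 0"
    and "(\<Sum>i\<in>UNIV. b $ i *\<^sub>R X i x) = 0" "(\<Sum>i\<in>UNIV. a $ i *\<^sub>R X i x) \<noteq> 0"
    and "(\<Sum>i\<in>UNIV. b $ i *\<^sub>R N i x) \<noteq> 0"
  shows "gauss_area x = 0 \<longleftrightarrow>
    ip x (\<Sum>i\<in>UNIV. a $ i *\<^sub>R X i x) (\<Sum>i\<in>UNIV. a $ i *\<^sub>R N i x) = 0"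
proof -
  define Xa Na Nb where "Xa = (\<Sum>i\<in>UNIV. a $ i *\<^sub>R X i x)"
    and "Na = (\<Sum>i\<in>UNIV. a $ i *\<^sub>R N i x)" and "Nb = (\<Sum>i\<in>UNIV. b $ i *\<^sub>R N i x)"
  have sym: "ip x (X 2 x) (N 1 x) = ip x (X 1 x) (N 2 x)"
    using second_form_eq[OF x, of 1 2] second_form_eq[OF x, of 2 1]
      cov_X_commute[OF x, of 1 2] by simp
  \<comment> \<open>Symmetry of the second form exchanges \<open>a\<close> and \<open>b\<close>, and
    \<open>b\<close> spans a direction that the differential of the map annihilates.\<close>
  have "ip x Xa Nb = ip x (\<Sum>i\<in>UNIV. b $ i *\<^sub>R X i x) Na"
    by (simp add: Xa_def Na_def Nb_def sum_2 ip_linear sym algebra_simps)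
  then have XN: "ip x Xa Nb = 0" using assms(3) by (simp add: ip_linear)
  have pos: "ip x v v > 0" if "v \<noteq> 0" for v
    using gram_matrix.pos[OF gram_matrix_3.axioms[OF gram[OF x]] that] by (simp add: ip_def)
  have perp: "ip x (n x) Xa = 0" "ip x (n x) Na = 0" "ip x (n x) Nb = 0"
    using normal[OF x] N_tangent[OF x]
    by (simp_all add: Xa_def Na_def Nb_def sum_2 ip_linear) (simp_all add: ip_def)
  note det_eq = gram_matrix_3.gram_det_eq[OF gram[OF x] unit[OF x], folded ip_def]
  have "ip x Xa Xa * ip x Nb Nb = det (G x) * det (vector [Xa, Nb, n x]) * det (vector [Xa, Nb, n x])"
    using det_eq[OF perp(1,3,1,3)] XN by simp
  moreover have "ip x Xa Xa * ip x Nb Nb > 0"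
    using pos assms(4,5) unfolding Xa_def Nb_def by (intro mult_pos_pos) auto
  ultimately have nz: "det (vector [Xa, Nb, n x]) \<noteq> 0" by auto
  have "det (vector [Na, Nb, n x]) = (a $ 1 * b $ 2 - a $ 2 * b $ 1) * gauss_area x"
    unfolding gauss_area_def det_3 by (simp add: Na_def Nb_def sum_2 algebra_simps)
  \<comment> \<open>Here \<open>gram_det_eq\<close> is applied to the pairs \<open>Xa\<close>,
    \<open>Nb\<close> and \<open>Na\<close>, \<open>Nb\<close>; of its left side only the diagonal
    product survives, because \<open>Xa\<close> is orthogonal to \<open>Nb\<close>.\<close>
  with det_eq[OF perp(1,3,2,3)] XN
  have "ip x Xa Na * ip x Nb Nb =
      det (G x) * det (vector [Xa, Nb, n x]) * ((a $ 1 * b $ 2 - a $ 2 * b $ 1) * gauss_area x)"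
    by simp
  then show ?thesis
    using nz ab det_G_pos[OF x] pos[OF assms(5)] unfolding Xa_def[symmetric] Na_def[symmetric] Nb_def[symmetric]
    by (metis less_irrefl mult_eq_0_iff)
qed

lemma curvature_density_eq_0_iff:
  "x \<in> V \<Longrightarrow> curv x = 0 \<Longrightarrow> curvature_density x = 0 \<longleftrightarrow> gauss_area x = 0"
proof -
  assume x: "x \<in> V" and "curv x = 0"
  then have "G x ** curv x = 0" by (simp add: matrix_matrix_mult_def vec_eq_iff)
  then have "vector [(G x ** curv x) $ 2 $ 3, (G x ** curv x) $ 3 $ 1, (G x ** curv x) $ 1 $ 2] =
      (0 :: real^3)"
    by (simp add: vec_eq_iff forall_3)
  then have "ambient_term x = 0" by (simp add: ambient_term_def Let_def)
  then show ?thesis using det_G_pos[OF x] by (simp add: curvature_density_def)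
qed

end

section \<open>The Levi-Civita connection in coordinates\<close>

lemma frechet_derivative_eq_sum_partial:
  fixes f :: "real^'n \<Rightarrow> 'b::real_normed_vector"
  assumes "f differentiable (at x)"
  shows "frechet_derivative f (at x) u = (\<Sum>i\<in>UNIV. u $ i *\<^sub>R partial i f x)"
proof -
  have "frechet_derivative f (at x) u =
      frechet_derivative f (at x) (\<Sum>i\<in>UNIV. u $ i *\<^sub>R axis i 1)"
    by (rule arg_cong[OF axis_decomp])
  then show ?thesis
    unfolding partial_def using linear_frechet_derivative[OF assms]
    by (simp add: linear_sum linear_scale)
qed

text \<open>The Christoffel symbols as one bilinear map, in which compatibility and the change of
  coordinates can be expressed without indices.\<close>

definition chris_vec :: "(real^'n \<Rightarrow> real^'n^'n) \<Rightarrow> real^'n \<Rightarrow> real^'n \<Rightarrow> real^'n \<Rightarrow> real^'n::finite" where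
  "chris_vec G y u w = (\<chi> k. \<Sum>i\<in>UNIV. \<Sum>j\<in>UNIV. christoffel G y k i j * u $ i * w $ j)"

lemma bilinear_chris_vec: "bilinear (chris_vec G y)"
  unfolding bilinear_def chris_vec_def
  by (auto intro!: linearI simp: vec_eq_iff sum.distrib sum_distrib_left algebra_simps)

locale metric_field =
  fixes S :: "(real^'n) set" and G :: "real^'n \<Rightarrow> real^'n^'n"
  assumes open_S: "open S" and smooth_G: "smooth_on S G"
    and gram: "\<And>y. y \<in> S \<Longrightarrow> gram_matrix (G y)"
begin

lemma ip_commute: "y \<in> S \<Longrightarrow> v \<bullet> (G y *v w) = w \<bullet> (G y *v v)"
  by (rule gram_matrix.ip_commute[OF gram])

definition DG :: "real^'n \<Rightarrow> real^'n \<Rightarrow> real^'n^'n" where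
  "DG y u = frechet_derivative G (at y) u"

lemma partial_G_nth:
  assumes "y \<in> S"
  shows "partial i (\<lambda>y. G y $ j $ l) y = partial i G y $ j $ l"
proof -
  have "bounded_linear (\<lambda>M :: real^'n^'n. M $ j $ l)"
    using bounded_linear_compose[OF bounded_linear_vec_nth bounded_linear_vec_nth] .
  from partial_linear[OF this smooth_on_differentiable[OF smooth_G assms]] show ?thesis .
qed

lemma DG_form:
  assumes "y \<in> S"
  shows "q \<bullet> (DG y r *v s) =
    (\<Sum>i\<in>UNIV. \<Sum>j\<in>UNIV. \<Sum>l\<in>UNIV. r $ i * q $ j * s $ l * partial i (\<lambda>y. G y $ j $ l) y)"
proof -
  have "DG y r = (\<Sum>i\<in>UNIV. r $ i *\<^sub>R partial i G y)"
    unfolding DG_def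
    by (rule frechet_derivative_eq_sum_partial[OF smooth_on_differentiable[OF smooth_G assms]])
  then have "q \<bullet> (DG y r *v s) = (\<Sum>j\<in>UNIV. \<Sum>l\<in>UNIV. \<Sum>i\<in>UNIV.
      r $ i * q $ j * s $ l * partial i (\<lambda>y. G y $ j $ l) y)"
    unfolding partial_G_nth[OF assms]
    by (simp add: inner_vec_def matrix_vector_mult_def sum_distrib_left sum_distrib_right mult_ac)
  also have "\<dots> = (\<Sum>j\<in>UNIV. \<Sum>i\<in>UNIV. \<Sum>l\<in>UNIV.
      r $ i * q $ j * s $ l * partial i (\<lambda>y. G y $ j $ l) y)"
    by (intro sum.cong refl sum.swap)
  also have "\<dots> = (\<Sum>i\<in>UNIV. \<Sum>j\<in>UNIV. \<Sum>l\<in>UNIV.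
      r $ i * q $ j * s $ l * partial i (\<lambda>y. G y $ j $ l) y)"
    by (rule sum.swap)
  finally show ?thesis .
qed

lemma DG_commute:
  assumes "y \<in> S"
  shows "q \<bullet> (DG y r *v s) = s \<bullet> (DG y r *v q)"
proof -
  have "G z $ j $ l = G z $ l $ j" if "z \<in> S" for z j l
    using ip_commute[OF that, of "axis j 1" "axis l 1"]
    by (simp add: matrix_vector_mult_basis inner_axis' column_def)
  then have "partial i (\<lambda>y. G y $ j $ l) y = partial i (\<lambda>y. G y $ l $ j) y" for i j l
    by (intro partial_cong_open[OF open_S assms])
  then have "q \<bullet> (DG y r *v s) =
    (\<Sum>i\<in>UNIV. \<Sum>j\<in>UNIV. \<Sum>l\<in>UNIV. r $ i * s $ l * q $ j * partial i (\<lambda>y. G y $ l $ j) y)"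
    unfolding DG_form[OF assms] by (simp add: mult_ac)
  also have "\<dots> = s \<bullet> (DG y r *v q)"
    unfolding DG_form[OF assms] by (intro sum.cong refl sum.swap)
  finally show ?thesis .
qed

text \<open>This is \<open>christoffel_lower\<close> contracted with three vectors. The chain moves
  the sum over \<open>k\<close> innermost, where it can be evaluated, and then matches the three
  resulting sums with \<open>DG_form\<close>.\<close>

lemma koszul:
  assumes "y \<in> S"
  shows "v \<bullet> (G y *v chris_vec G y u w) =
    (w \<bullet> (DG y u *v v) + u \<bullet> (DG y w *v v) - u \<bullet> (DG y v *v w)) / 2"
proof -
  let ?d = "\<lambda>i j l. partial i (\<lambda>y. G y $ j $ l) y"
  have nz: "det (G y) \<noteq> 0" by (rule gram_matrix.det_nonzero[OF gram[OF assms]])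
  have "v \<bullet> (G y *v chris_vec G y u w) = (\<Sum>l\<in>UNIV. \<Sum>k\<in>UNIV. \<Sum>i\<in>UNIV. \<Sum>j\<in>UNIV.
      v $ l * u $ i * w $ j * (G y $ l $ k * christoffel G y k i j))"
    by (simp add: inner_vec_def matrix_vector_mult_def chris_vec_def sum_distrib_left mult_ac)
  also have "\<dots> = (\<Sum>l\<in>UNIV. \<Sum>i\<in>UNIV. \<Sum>k\<in>UNIV. \<Sum>j\<in>UNIV.
      v $ l * u $ i * w $ j * (G y $ l $ k * christoffel G y k i j))"
    by (intro sum.cong refl sum.swap)
  also have "\<dots> = (\<Sum>l\<in>UNIV. \<Sum>i\<in>UNIV. \<Sum>j\<in>UNIV. \<Sum>k\<in>UNIV.
      v $ l * u $ i * w $ j * (G y $ l $ k * christoffel G y k i j))"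
    by (intro sum.cong refl sum.swap)
  also have "\<dots> = (\<Sum>l\<in>UNIV. \<Sum>i\<in>UNIV. \<Sum>j\<in>UNIV.
      v $ l * u $ i * w $ j * ((?d i j l + ?d j i l - ?d l i j) / 2))"
    by (simp only: sum_distrib_left[symmetric] christoffel_lower[of G y, OF nz])
  also have "\<dots> = ((\<Sum>l\<in>UNIV. \<Sum>i\<in>UNIV. \<Sum>j\<in>UNIV. u $ i * w $ j * v $ l * ?d i j l)
    + (\<Sum>l\<in>UNIV. \<Sum>i\<in>UNIV. \<Sum>j\<in>UNIV. w $ j * u $ i * v $ l * ?d j i l)
    - (\<Sum>l\<in>UNIV. \<Sum>i\<in>UNIV. \<Sum>j\<in>UNIV. v $ l * u $ i * w $ j * ?d l i j)) / 2"
    by (simp add: sum.distrib[symmetric] sum_subtractf[symmetric] sum_divide_distrib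
        algebra_simps add_divide_distrib diff_divide_distrib)
  also have "(\<Sum>l\<in>UNIV. \<Sum>i\<in>UNIV. \<Sum>j\<in>UNIV. u $ i * w $ j * v $ l * ?d i j l) =
      (\<Sum>i\<in>UNIV. \<Sum>l\<in>UNIV. \<Sum>j\<in>UNIV. u $ i * w $ j * v $ l * ?d i j l)"
    by (rule sum.swap)
  also have "\<dots> = w \<bullet> (DG y u *v v)"
    unfolding DG_form[OF assms] by (intro sum.cong refl sum.swap)
  also have "(\<Sum>l\<in>UNIV. \<Sum>i\<in>UNIV. \<Sum>j\<in>UNIV. w $ j * u $ i * v $ l * ?d j i l) =
      (\<Sum>l\<in>UNIV. \<Sum>j\<in>UNIV. \<Sum>i\<in>UNIV. w $ j * u $ i * v $ l * ?d j i l)"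
    by (intro sum.cong refl sum.swap)
  also have "\<dots> = (\<Sum>j\<in>UNIV. \<Sum>l\<in>UNIV. \<Sum>i\<in>UNIV. w $ j * u $ i * v $ l * ?d j i l)"
    by (rule sum.swap)
  also have "\<dots> = u \<bullet> (DG y w *v v)"
    unfolding DG_form[OF assms] by (intro sum.cong refl sum.swap)
  also have "(\<Sum>l\<in>UNIV. \<Sum>i\<in>UNIV. \<Sum>j\<in>UNIV. v $ l * u $ i * w $ j * ?d l i j) =
      u \<bullet> (DG y v *v w)"
    unfolding DG_form[OF assms] ..
  finally show ?thesis .
qed

lemma eq_if_ip_eq:
  assumes "y \<in> S" "\<And>v. v \<bullet> (G y *v a) = v \<bullet> (G y *v b)"
  shows "a = b"
proof -
  have "(a - b) \<bullet> (G y *v (a - b)) = 0"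
    using assms(2)[of "a - b"] by (simp add: matrix_vector_mult_diff_distrib inner_diff_right)
  then show ?thesis using gram_matrix.pos[OF gram[OF assms(1)], of "a - b"] by force
qed

lemma chris_vec_commute:
  assumes "y \<in> S"
  shows "chris_vec G y u w = chris_vec G y w u"
  by (rule eq_if_ip_eq[OF assms]) (simp add: koszul[OF assms] DG_commute[OF assms, of u _ w])

lemma chris_vec_compatible:
  assumes "y \<in> S"
  shows "u \<bullet> (DG y z *v w) =
    chris_vec G y z u \<bullet> (G y *v w) + u \<bullet> (G y *v chris_vec G y z w)"
  using DG_commute[OF assms, of w z u] DG_commute[OF assms, of z w u] DG_commute[OF assms, of z u w]
  by (simp add: ip_commute[OF assms, of "chris_vec G y z u"] koszul[OF assms] field_simps)

text \<open>The lowered difference \<open>C\<close> of two such connections is symmetric in its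
  first two arguments and skew in its last two. Alternating the two exchanges six times returns to
  the start with the opposite sign.\<close>

lemma chris_vec_unique:
  assumes y: "y \<in> S" and sym: "\<And>u w. B u w = B w u"
    and compat: "\<And>z u w. u \<bullet> (DG y z *v w) = B z u \<bullet> (G y *v w) + u \<bullet> (G y *v B z w)"
  shows "B u w = chris_vec G y u w"
proof (rule eq_if_ip_eq[OF y])
  fix v
  define C where "C = (\<lambda>u w v. v \<bullet> (G y *v (B u w - chris_vec G y u w)))"
  have C_sym: "C u w v = C w u v" for u w v
    unfolding C_def using sym chris_vec_commute[OF y] by metis
  have C_skew: "C z u w = - C z w u" for z u w
    using compat[of u z w] chris_vec_compatible[OF y, of u z w]
      ip_commute[OF y, of "B z u" w] ip_commute[OF y, of "chris_vec G y z u" w]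
    by (simp add: C_def matrix_vector_mult_diff_distrib inner_diff_right)
  have "C u w v = 0"
    using C_skew[of u w v] C_sym[of u v w] C_skew[of v u w] C_sym[of v w u] C_skew[of w v u]
      C_sym[of w u v] by linarith
  then show "v \<bullet> (G y *v B u w) = v \<bullet> (G y *v chris_vec G y u w)"
    by (simp add: C_def matrix_vector_mult_diff_distrib inner_diff_right)
qed

text \<open>The product rule for covariant derivatives along an arbitrary map \<open>H\<close>. It
  serves both for transition maps and for a change of coordinates in the plane.\<close>

lemma ip_has_derivative:
  fixes H :: "'b::real_normed_vector \<Rightarrow> real^'n"
  assumes H: "(H has_derivative H') (at x)" and Hx: "H x \<in> S"
    and m: "(m has_derivative m') (at x)" and P: "(P has_derivative P') (at x)"
  shows "((\<lambda>x. m x \<bullet> (G (H x) *v P x)) has_derivative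
    (\<lambda>a. (m' a + chris_vec G (H x) (H' a) (m x)) \<bullet> (G (H x) *v P x) +
         m x \<bullet> (G (H x) *v (P' a + chris_vec G (H x) (H' a) (P x))))) (at x)"
proof -
  have "((\<lambda>x. G (H x)) has_derivative (\<lambda>a. DG (H x) (H' a))) (at x)"
    unfolding DG_def by (rule has_derivative_compose[OF H smooth_on_has_derivative[OF smooth_G Hx]])
  from bounded_bilinear.FDERIV[OF bounded_bilinear_inner m
      bounded_bilinear.FDERIV[OF bounded_bilinear_matrix_vector_mult this P]]
  show ?thesis
    by (rule back_subst[where P="\<lambda>D. (_ has_derivative D) _"])
       (simp add: fun_eq_iff inner_add_left inner_add_right matrix_vector_right_distrib
        chris_vec_compatible[OF Hx])
qed

end

text \<open>
  The Levi-Civita connection of \<open>G'\<close> transported by \<open>T\<close> is symmetric and compatible with \<open>G\<close>,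
  so it is the Levi-Civita connection of \<open>G\<close>.
\<close>

lemma chris_vec_transform:
  fixes T :: "real^'n \<Rightarrow> real^'n"
  assumes "metric_field S G" and "metric_field S' G'"
    and W: "open W" "W \<subseteq> S" "T ` W \<subseteq> S'" "smooth_on W T"
    and isometry: "\<And>y u w. y \<in> W \<Longrightarrow> u \<bullet> (G y *v w) =
      frechet_derivative T (at y) u \<bullet> (G' (T y) *v frechet_derivative T (at y) w)"
    and y: "y \<in> W" and surj: "surj (frechet_derivative T (at y))"
  shows "frechet_derivative T (at y) (chris_vec G y u w) =
    chris_vec G' (T y) (frechet_derivative T (at y) u) (frechet_derivative T (at y) w)
    + frechet_derivative (\<lambda>y. frechet_derivative T (at y) w) (at y) u"
proof -
  interpret D: metric_field S G by fact
  interpret R: metric_field S' G' by fact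
  let ?J = "\<lambda>u y. frechet_derivative T (at y) u"
  have yS: "y \<in> S" and TyS: "T y \<in> S'" using W y by auto
  let ?c = "\<lambda>u w. chris_vec G' (T y) (?J u y) (?J w y) + frechet_derivative (?J w) (at y) u"
  \<comment> \<open>The connection of \<open>G'\<close> pulled back by \<open>T\<close>, including
    the second derivative of \<open>T\<close>; \<open>inv\<close> selects a preimage under the
    surjective differential.\<close>
  define B where "B = (\<lambda>u w. inv (\<lambda>b. ?J b y) (?c u w))"
  have JB: "?J (B u w) y = ?c u w" for u w
    unfolding B_def by (rule surj_f_inv_f[OF surj])
  have "B u w = chris_vec G y u w"
  proof (rule D.chris_vec_unique[OF yS])
    fix u w
    show "B u w = B w u"
      unfolding B_def R.chris_vec_commute[OF TyS, of "?J u y"]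
        second_derivative_symmetric[OF W(1,4) y, of w] ..
  next
    fix z u w
    have Jd: "(?J u has_derivative frechet_derivative (?J u) (at y)) (at y)" for u
      by (rule smooth_on_has_derivative[OF smooth_on_frechet_derivative[OF W(4)] y])
    \<comment> \<open>The right side of the isometry is differentiated with the product rule for
      \<open>G'\<close>, the left side directly; equality of the two derivatives is compatibility of
      \<open>B\<close> with \<open>G\<close>.\<close>
    have "((\<lambda>x. ?J u x \<bullet> (G' (T x) *v ?J w x)) has_derivative
      (\<lambda>z. ?J (B z u) y \<bullet> (G' (T y) *v ?J w y) + ?J u y \<bullet> (G' (T y) *v ?J (B z w) y))) (at y)"
      unfolding JB
      using R.ip_has_derivative[OF smooth_on_has_derivative[OF W(4) y] TyS Jd Jd, of u w]
      by (simp add: add.commute)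
    then have "((\<lambda>x. u \<bullet> (G x *v w)) has_derivative
      (\<lambda>z. B z u \<bullet> (G y *v w) + u \<bullet> (G y *v B z w))) (at y)"
      unfolding isometry[OF y]
      by (rule has_derivative_transform_within_open[OF _ W(1) y]) (simp add: isometry)
    moreover have "((\<lambda>x. u \<bullet> (G x *v w)) has_derivative (\<lambda>z. u \<bullet> (D.DG y z *v w))) (at y)"
      unfolding D.DG_def
      by (intro bounded_linear.has_derivative[OF bounded_linear_inner_right]
          bounded_linear.has_derivative[OF bounded_bilinear.bounded_linear_left[OF
              bounded_bilinear_matrix_vector_mult]]
          smooth_on_has_derivative[OF D.smooth_G yS])
    ultimately have "(\<lambda>z. B z u \<bullet> (G y *v w) + u \<bullet> (G y *v B z w)) = (\<lambda>z. u \<bullet> (D.DG y z *v w))"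
      by (rule has_derivative_unique)
    from fun_cong[OF this, of z]
    show "u \<bullet> (D.DG y z *v w) = B z u \<bullet> (G y *v w) + u \<bullet> (G y *v B z w)" ..
  qed
  then show ?thesis using JB[of u w] by simp
qed

section \<open>Oriented Riemannian manifolds in charts\<close>

text \<open>Base point and vector both vary with \<open>y\<close>. Expanding the vector in the basis
  separates them, so the product rule applies to each summand.\<close>

lemma frechet_derivative_along_has_derivative:
  fixes T :: "'a::euclidean_space \<Rightarrow> 'b::euclidean_space"
  assumes W: "open W" "smooth_on W T" "H x \<in> W"
    and H: "(H has_derivative H') (at x)" and Z: "(Z has_derivative Z') (at x)"
  shows "((\<lambda>y. frechet_derivative T (at (H y)) (Z y)) has_derivative
    (\<lambda>a. frechet_derivative T (at (H x)) (Z' a) +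
      frechet_derivative (\<lambda>z. frechet_derivative T (at z) (Z x)) (at (H x)) (H' a))) (at x)"
proof -
  let ?J = "\<lambda>b z. frechet_derivative T (at z) b"
  have expand: "L v = (\<Sum>b\<in>Basis. (v \<bullet> b) *\<^sub>R L b)" if "linear L" for L :: "'a \<Rightarrow> 'b" and v
  proof -
    have "L v = L (\<Sum>b\<in>Basis. (v \<bullet> b) *\<^sub>R b)" by (simp add: euclidean_representation)
    then show ?thesis using that by (simp add: linear_sum linear_scale)
  qed
  have lin1: "linear (\<lambda>v. ?J v z)" if "z \<in> W" for z
    using linear_frechet_derivative[OF smooth_on_differentiable[OF W(2) that]] by simp
  have "isCont H x" using H has_derivative_continuous by blast
  then have "\<forall>\<^sub>F y in at x. H y \<in> W"
    unfolding isCont_def using W(1,3) topological_tendstoD by blast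
  then have near: "\<forall>\<^sub>F y in at x. (\<Sum>b\<in>Basis. (Z y \<bullet> b) *\<^sub>R ?J b (H y)) = ?J (Z y) (H y)"
    by eventually_elim (rule expand[OF lin1, symmetric])
  have D: "((\<lambda>y. ?J b (H y)) has_derivative (\<lambda>a. frechet_derivative (?J b) (at (H x)) (H' a))) (at x)" for b
    by (rule has_derivative_compose[OF H smooth_on_has_derivative[OF
            smooth_on_frechet_derivative[OF W(2)] W(3)]])
  have "((\<lambda>y. \<Sum>b\<in>Basis. (Z y \<bullet> b) *\<^sub>R ?J b (H y)) has_derivative
    (\<lambda>a. \<Sum>b\<in>Basis. (Z x \<bullet> b) *\<^sub>R frechet_derivative (?J b) (at (H x)) (H' a)
       + (Z' a \<bullet> b) *\<^sub>R ?J b (H x))) (at x)"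
    by (intro has_derivative_sum bounded_bilinear.FDERIV[OF bounded_bilinear_scaleR] D
        bounded_linear.has_derivative[OF bounded_linear_inner_left] Z)
  then have "((\<lambda>y. ?J (Z y) (H y)) has_derivative
    (\<lambda>a. \<Sum>b\<in>Basis. (Z x \<bullet> b) *\<^sub>R frechet_derivative (?J b) (at (H x)) (H' a)
       + (Z' a \<bullet> b) *\<^sub>R ?J b (H x))) (at x)"
    using near expand[OF lin1[OF W(3)], symmetric] by (rule has_derivative_transform_eventually) simp
  \<comment> \<open>The sum runs over the inner direction of a second derivative. Symmetry moves
    \<open>b\<close> to the outer slot, where linearity collapses the basis expansion.\<close>
  moreover have "(\<Sum>b\<in>Basis. (Z x \<bullet> b) *\<^sub>R frechet_derivative (?J b) (at (H x)) v) =
      frechet_derivative (?J (Z x)) (at (H x)) v" for v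
    unfolding second_derivative_symmetric[OF W(1,2,3), of _ v]
    by (rule expand[symmetric])
       (rule linear_frechet_derivative[OF smooth_on_differentiable[OF
            smooth_on_frechet_derivative[OF W(2)] W(3)]])
  ultimately show ?thesis
    unfolding sum.distrib expand[OF lin1[OF W(3)], symmetric] by (simp add: add.commute)
qed

lemma bilinear_form_matrix:
  fixes B :: "real^'n \<Rightarrow> real^'n \<Rightarrow> real"
  assumes "\<And>w. linear (\<lambda>u. B u w)" "\<And>u. linear (\<lambda>w. B u w)"
  shows "B u w = u \<bullet> ((\<chi> i j. B (axis i 1) (axis j 1)) *v w)"
proof -
  have *: "L v = (\<Sum>i\<in>UNIV. v $ i * L (axis i 1))" if "linear L" for L :: "real^'n \<Rightarrow> real" and v
  proof -
    have "L v = L (\<Sum>i\<in>UNIV. v $ i *\<^sub>R axis i 1)" by (rule arg_cong[OF axis_decomp])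
    then show ?thesis using that by (simp add: linear_sum linear_scale)
  qed
  have "B u w = (\<Sum>i\<in>UNIV. u $ i * (\<Sum>j\<in>UNIV. w $ j * B (axis i 1) (axis j 1)))"
    by (rule trans[OF *[OF assms(1), where v = u]])
       (intro sum.cong refl arg_cong[where f="(*) _"] *[OF assms(2), where v = w])
  then show ?thesis by (simp add: inner_vec_def matrix_vector_mult_def mult.commute)
qed

lemma matrix_eq_iff_forms:
  fixes A B :: "real^'n^'n"
  shows "A = B \<longleftrightarrow> (\<forall>u w. u \<bullet> (A *v w) = u \<bullet> (B *v w))"
  by (metis matrix_eq vector_eq_rdot inner_commute)

locale riem_manifold =
  fixes M :: "('m::{t2_space, second_countable_topology}, 'n::finite) riem"
  assumes oriented_riemannian_manifold: "oriented_riemannian_manifold M"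
begin

abbreviation J :: "('m, 'n) chart \<Rightarrow> ('m, 'n) chart \<Rightarrow> 'm \<Rightarrow> real^'n \<Rightarrow> real^'n" where
  "J c c' q \<equiv> frechet_derivative (transition c c') (at (snd c q))"

lemma charts_atD: "c \<in> charts_at M q \<Longrightarrow> c \<in> atlas M" "c \<in> charts_at M q \<Longrightarrow> q \<in> fst c"
  by (auto simp: charts_at_def)

lemma is_chart: "c \<in> atlas M \<Longrightarrow> is_chart c"
  using oriented_riemannian_manifold
  by (auto simp: oriented_riemannian_manifold_def oriented_smooth_atlas_def)

lemma open_dom: "c \<in> atlas M \<Longrightarrow> open (fst c)"
  using is_chart by (auto simp: is_chart_def)

lemma chart_homeomorphism:
  "c \<in> atlas M \<Longrightarrow> homeomorphism (fst c) (snd c ` fst c) (snd c) (chart_inv c)"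
  using is_chart by (auto simp: is_chart_def)

lemma open_chart_image:
  assumes "c \<in> atlas M" "open W" "W \<subseteq> fst c"
  shows "open (snd c ` W)"
proof -
  have "openin (top_of_set (snd c ` fst c)) (snd c ` W)"
    using homeomorphism_imp_open_map[OF chart_homeomorphism[OF assms(1)]]
      openin_open_eq[OF open_dom[OF assms(1)]] assms by blast
  then show ?thesis
    using is_chart[OF assms(1)] openin_open_eq unfolding is_chart_def by blast
qed

lemma chart_inv_apply: "c \<in> atlas M \<Longrightarrow> q \<in> fst c \<Longrightarrow> chart_inv c (snd c q) = q"
  using chart_homeomorphism homeomorphism_apply1 by metis

lemma transition_apply: "c \<in> atlas M \<Longrightarrow> q \<in> fst c \<Longrightarrow> transition c c' (snd c q) = snd c' q"
  by (simp add: transition_def chart_inv_apply)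

lemma open_overlap: "c \<in> atlas M \<Longrightarrow> c' \<in> atlas M \<Longrightarrow> open (snd c ` (fst c \<inter> fst c'))"
  by (intro open_chart_image open_Int open_dom) auto

lemma smooth_transition:
  "c \<in> atlas M \<Longrightarrow> c' \<in> atlas M \<Longrightarrow> smooth_on (snd c ` (fst c \<inter> fst c')) (transition c c')"
  using oriented_riemannian_manifold
  by (auto simp: oriented_riemannian_manifold_def oriented_smooth_atlas_def)

lemma det_J_pos:
  assumes "c \<in> charts_at M q" "c' \<in> charts_at M q"
  shows "det (matrix (J c c' q)) > 0"
  using oriented_riemannian_manifold charts_atD[OF assms(1)] charts_atD[OF assms(2)]
  unfolding oriented_riemannian_manifold_def oriented_smooth_atlas_def by blast

lemma transition_has_derivative:
  assumes "c \<in> charts_at M q" "c' \<in> charts_at M q"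
  shows "(transition c c' has_derivative J c c' q) (at (snd c q))"
  using smooth_on_has_derivative[OF smooth_transition] charts_atD[OF assms(1)] charts_atD[OF assms(2)]
  by blast

lemma linear_J: "c \<in> charts_at M q \<Longrightarrow> c' \<in> charts_at M q \<Longrightarrow> linear (J c c' q)"
  using transition_has_derivative has_derivative_linear by blast

lemma J_comp:
  assumes "c \<in> charts_at M q" "c' \<in> charts_at M q" "c'' \<in> charts_at M q"
  shows "J c' c'' q (J c c' q v) = J c c'' q v"
proof -
  note c = charts_atD[OF assms(1)] note c' = charts_atD[OF assms(2)] note c'' = charts_atD[OF assms(3)]
  let ?W = "snd c ` (fst c \<inter> fst c' \<inter> fst c'')"
  have "(transition c' c'' has_derivative J c' c'' q) (at (transition c c' (snd c q)))"
    using transition_has_derivative[OF assms(2,3)] by (simp add: transition_apply c)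
  from has_derivative_compose[OF transition_has_derivative[OF assms(1,2)] this]
  have "((\<lambda>y. transition c' c'' (transition c c' y)) has_derivative (\<lambda>v. J c' c'' q (J c c' q v)))
      (at (snd c q))" .
  moreover have "open ?W" by (intro open_chart_image open_Int open_dom c c' c'') auto
  moreover have "snd c q \<in> ?W" using c c' c'' by blast
  moreover have "transition c' c'' (transition c c' y) = transition c c'' y" if "y \<in> ?W" for y
    using that by (auto simp: transition_apply c c' c'')
  ultimately have "(transition c c'' has_derivative (\<lambda>v. J c' c'' q (J c c' q v))) (at (snd c q))"
    by (rule has_derivative_transform_within_open)
  from frechet_derivative_at[OF this] show ?thesis by metis
qed

lemma J_self:
  assumes "c \<in> charts_at M q"
  shows "J c c q v = v"
proof -
  note c = charts_atD[OF assms]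
  have "transition c c y = id y" if "y \<in> snd c ` fst c" for y
    using that by (auto simp: transition_apply c)
  moreover have "open (snd c ` fst c)" by (intro open_chart_image open_dom c) auto
  ultimately have "J c c q = frechet_derivative id (at (snd c q))"
    using c by (intro frechet_derivative_cong_open) auto
  then show ?thesis by simp
qed

lemma tangentD:
  "v \<in> tangent_space M q \<Longrightarrow> c \<in> charts_at M q \<Longrightarrow> c' \<in> charts_at M q \<Longrightarrow> v c' = J c c' q (v c)"
  unfolding tangent_space_def by blast

lemma tangent_space_add_scale:
  assumes "v \<in> tangent_space M q" "w \<in> tangent_space M q"
  shows "(\<lambda>c. a *\<^sub>R v c + b *\<^sub>R w c) \<in> tangent_space M q"
proof -
  have eq: "a *\<^sub>R v c' + b *\<^sub>R w c' = J c c' q (a *\<^sub>R v c + b *\<^sub>R w c)"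
    if "c \<in> charts_at M q" "c' \<in> charts_at M q" for c c'
    using tangentD[OF assms(1) that] tangentD[OF assms(2) that] linear_J[OF that]
    by (simp add: linear_add linear_scale)
  have zero: "v c = 0" "w c = 0" if "c \<notin> charts_at M q" for c
    using assms that unfolding tangent_space_def by blast+
  show ?thesis
    unfolding tangent_space_def
  proof (intro CollectI conjI ballI allI impI)
    show "a *\<^sub>R v c + b *\<^sub>R w c = 0" if "c \<notin> charts_at M q" for c
      using zero[OF that] by simp
  qed (rule eq)
qed

definition tvec_of :: "('m, 'n) chart \<Rightarrow> 'm \<Rightarrow> real^'n \<Rightarrow> ('m, 'n) tvec" where
  "tvec_of c q u = (\<lambda>c'. if c' \<in> charts_at M q then J c c' q u else 0)"

lemma coord_vec_eq: "coord_vec M c q i = tvec_of c q (axis i 1)"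
  by (simp add: coord_vec_def tvec_of_def)

lemma tvec_of_tangent: "c \<in> charts_at M q \<Longrightarrow> tvec_of c q u \<in> tangent_space M q"
  unfolding tangent_space_def tvec_of_def by (auto simp: J_comp)

lemma tvec_of_apply: "c \<in> charts_at M q \<Longrightarrow> tvec_of c q u c = u"
  by (simp add: tvec_of_def J_self)

lemma tvec_of_tangent_eq:
  assumes "v \<in> tangent_space M q" "c \<in> charts_at M q"
  shows "tvec_of c q (v c) = v"
proof
  fix c'
  show "tvec_of c q (v c) c' = v c'"
  proof (cases "c' \<in> charts_at M q")
    case True
    then show ?thesis using tangentD[OF assms True] by (simp only: tvec_of_def if_True)
  next
    case False
    moreover have "v c' = 0" using assms(1) False unfolding tangent_space_def by blast
    ultimately show ?thesis by (simp add: tvec_of_def)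
  qed
qed

lemma tvec_of_linear:
  assumes "c \<in> charts_at M q"
  shows "tvec_of c q (a *\<^sub>R u + b *\<^sub>R w) = (\<lambda>c'. a *\<^sub>R tvec_of c q u c' + b *\<^sub>R tvec_of c q w c')"
  using linear_J[OF assms] by (auto simp: tvec_of_def fun_eq_iff linear_add linear_scale)

lemma in_carrier: "c \<in> charts_at M q \<Longrightarrow> q \<in> carrier M"
  by (auto simp: charts_at_def carrier_def)

lemma metric_commute:
  "c \<in> charts_at M q \<Longrightarrow> v \<in> tangent_space M q \<Longrightarrow> w \<in> tangent_space M q \<Longrightarrow>
   metric M q v w = metric M q w v"
  using oriented_riemannian_manifold in_carrier
  unfolding oriented_riemannian_manifold_def riemannian_metric_def by blast

lemma metric_add_scale:
  "c \<in> charts_at M q \<Longrightarrow> v \<in> tangent_space M q \<Longrightarrow> w \<in> tangent_space M q \<Longrightarrow>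
   z \<in> tangent_space M q \<Longrightarrow>
   metric M q (\<lambda>c. a *\<^sub>R v c + b *\<^sub>R w c) z = a * metric M q v z + b * metric M q w z"
  using oriented_riemannian_manifold in_carrier
  unfolding oriented_riemannian_manifold_def riemannian_metric_def by blast

lemma metric_pos:
  "c \<in> charts_at M q \<Longrightarrow> v \<in> tangent_space M q \<Longrightarrow> v \<noteq> (\<lambda>_. 0) \<Longrightarrow> metric M q v v > 0"
  using oriented_riemannian_manifold in_carrier
  unfolding oriented_riemannian_manifold_def riemannian_metric_def by blast

text \<open>Tangent vectors correspond linearly to their coordinates in \<open>c\<close> through
  \<open>tvec_of\<close>, and the coordinate vector fields correspond to the unit vectors. Tangency
  of both arguments is essential, since the metric is unrestricted on other families.\<close>

lemma metric_chart:
  assumes v: "v \<in> tangent_space M q" and w: "w \<in> tangent_space M q" and c: "c \<in> charts_at M q"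
  shows "metric M q v w = v c \<bullet> (metric_matrix M c (snd c q) *v w c)"
proof -
  define B where "B = (\<lambda>u w. metric M q (tvec_of c q u) (tvec_of c q w))"
  note T = tvec_of_tangent[OF c]
  have B_comb: "B (a *\<^sub>R u + b *\<^sub>R u') w = a * B u w + b * B u' w" for a b u u' w
    unfolding B_def tvec_of_linear[OF c] by (rule metric_add_scale[OF c T T T])
  have B_sym: "B u w = B w u" for u w
    unfolding B_def by (rule metric_commute[OF c T T])
  have lin: "linear (\<lambda>u. B u w)" for w
    using B_comb[of 1 _ 1 _ w] B_comb[of _ _ 0 0 w] by (intro linearI) auto
  have "linear (\<lambda>w. B u w)" for u
    by (rule back_subst[where P = linear, OF lin[of u]]) (rule ext, rule B_sym)
  from bilinear_form_matrix[OF lin this, of "v c" "w c"]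
  have "metric M q v w = v c \<bullet> ((\<chi> i j. B (axis i 1) (axis j 1)) *v w c)"
    unfolding B_def by (simp add: tvec_of_tangent_eq v w c)
  then show ?thesis
    unfolding metric_matrix_def Let_def B_def coord_vec_eq
    using c by (simp add: chart_inv_apply charts_atD)
qed

lemma metric_field_chart:
  assumes "c \<in> atlas M"
  shows "metric_field (snd c ` fst c) (metric_matrix M c)"
proof
  show "open (snd c ` fst c)" using open_chart_image[OF assms open_dom[OF assms]] by simp
  show "smooth_on (snd c ` fst c) (metric_matrix M c)"
    using oriented_riemannian_manifold assms
    unfolding oriented_riemannian_manifold_def riemannian_metric_def by blast
next
  fix y assume "y \<in> snd c ` fst c"
  then obtain q where q: "q \<in> fst c" "y = snd c q" by blast
  then have c: "c \<in> charts_at M q" using assms by (simp add: charts_at_def)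
  have eq: "u \<bullet> (metric_matrix M c y *v w) = metric M q (tvec_of c q u) (tvec_of c q w)" for u w
    using metric_chart[OF tvec_of_tangent[OF c] tvec_of_tangent[OF c] c]
    by (simp add: q tvec_of_apply[OF c])
  show "transpose (metric_matrix M c y) = metric_matrix M c y"
    unfolding matrix_eq_iff_forms
  proof (intro allI)
    fix u w
    have "u \<bullet> (transpose (metric_matrix M c y) *v w) = w \<bullet> (metric_matrix M c y *v u)"
      by (metis dot_lmul_matrix inner_commute transpose_matrix_vector)
    also have "\<dots> = u \<bullet> (metric_matrix M c y *v w)"
      unfolding eq by (intro metric_commute[OF c] tvec_of_tangent c)
    finally show "u \<bullet> (transpose (metric_matrix M c y) *v w) = u \<bullet> (metric_matrix M c y *v w)" .
  qed
  show "v \<bullet> (metric_matrix M c y *v v) > 0" if "v \<noteq> 0" for v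
  proof -
    have "tvec_of c q v \<noteq> (\<lambda>_. 0)" using tvec_of_apply[OF c, of v] that by metis
    then show ?thesis unfolding eq using tvec_of_tangent[OF c] by (intro metric_pos[OF c])
  qed
qed

lemma transition_isometry:
  assumes "c \<in> charts_at M q" "c' \<in> charts_at M q"
  shows "u \<bullet> (metric_matrix M c (snd c q) *v w) =
    J c c' q u \<bullet> (metric_matrix M c' (snd c' q) *v J c c' q w)"
proof -
  note T = tvec_of_tangent[OF assms(1)]
  have "tvec_of c q u c' = J c c' q u" for u using assms(2) by (simp add: tvec_of_def)
  then show ?thesis
    using metric_chart[OF T T assms(1), of u w] metric_chart[OF T T assms(2), of u w]
    by (simp add: tvec_of_apply[OF assms(1)])
qed

text \<open>By isometry the matrix in \<open>c\<close> is congruent to the one in \<open>c'\<close>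
  through the Jacobian matrix, which contributes its determinant twice.\<close>

lemma det_metric_matrix:
  assumes "c \<in> charts_at M q" "c' \<in> charts_at M q"
  shows "det (metric_matrix M c (snd c q)) =
    (det (matrix (J c c' q)))\<^sup>2 * det (metric_matrix M c' (snd c' q))"
proof -
  let ?A = "matrix (J c c' q)" and ?G' = "metric_matrix M c' (snd c' q)"
  have J: "?A *v u = J c c' q u" for u
    by (rule fun_cong[OF matrix_vector_mul(3)[OF has_derivative_bounded_linear[OF
            transition_has_derivative[OF assms]]]])
  have "metric_matrix M c (snd c q) = transpose ?A ** (?G' ** ?A)"
    unfolding matrix_eq_iff_forms
  proof (intro allI)
    fix u w
    have "u \<bullet> ((transpose ?A ** (?G' ** ?A)) *v w) = ((?G' *v (?A *v w)) v* ?A) \<bullet> u"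
      by (simp only: matrix_vector_mul_assoc[symmetric] transpose_matrix_vector inner_commute)
    also have "\<dots> = (?A *v u) \<bullet> (?G' *v (?A *v w))"
      by (subst dot_lmul_matrix) (rule inner_commute)
    finally show "u \<bullet> (metric_matrix M c (snd c q) *v w) = u \<bullet> ((transpose ?A ** (?G' ** ?A)) *v w)"
      by (simp only: transition_isometry[OF assms] J)
  qed
  then show ?thesis by (simp add: det_mul det_transpose power2_eq_square)
qed

text \<open>Transition maps are isometries between the coordinate expressions of the metric, so
  \<open>chris_vec_transform\<close> applies on the overlap.\<close>

lemma cov_transform:
  assumes c: "c \<in> charts_at M q" and c': "c' \<in> charts_at M q"
  shows "J c c' q (chris_vec (metric_matrix M c) (snd c q) u w) =
    chris_vec (metric_matrix M c') (snd c' q) (J c c' q u) (J c c' q w)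
    + frechet_derivative (\<lambda>y. frechet_derivative (transition c c') (at y) w) (at (snd c q)) u"
proof -
  note c1 = charts_atD[OF c] note c2 = charts_atD[OF c']
  have "surj (J c c' q)"
    using J_comp[OF c' c c'] J_self[OF c'] by (metis surjI)
  moreover have "u \<bullet> (metric_matrix M c y *v w) =
      frechet_derivative (transition c c') (at y) u \<bullet>
      (metric_matrix M c' (transition c c' y) *v frechet_derivative (transition c c') (at y) w)"
    if yW: "y \<in> snd c ` (fst c \<inter> fst c')" for y u w
  proof -
    obtain r where "r \<in> fst c" "r \<in> fst c'" "y = snd c r" using yW by blast
    then show ?thesis
      using transition_isometry[of c r c' u w] c1 c2 by (simp add: charts_at_def transition_apply)
  qed
  moreover have "transition c c' ` (snd c ` (fst c \<inter> fst c')) \<subseteq> snd c' ` fst c'"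
    using c1 by (auto simp: transition_apply)
  ultimately show ?thesis
    using chris_vec_transform[OF metric_field_chart[OF c1(1)] metric_field_chart[OF c2(1)]
        open_overlap[OF c1(1) c2(1)] _ _ smooth_transition[OF c1(1) c2(1)], of "snd c q" u w] c1 c2
    by (auto simp: transition_apply)
qed

end

lemma det_vector_mult:
  fixes A :: "real^3^3"
  shows "det (vector [A *v u, A *v v, A *v w] :: real^3^3) = det A * det (vector [u, v, w] :: real^3^3)"
proof -
  have "(vector [A *v u, A *v v, A *v w] :: real^3^3) = vector [u, v, w] ** transpose A"
    by (simp add: vec_eq_iff forall_3 matrix_matrix_mult_def matrix_vector_mult_def transpose_def
        mult.commute)
  then show ?thesis by (simp add: det_mul det_transpose)
qed

text \<open>Frees the definition from its choice of a chart. The root of the squared Jacobian is the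
  Jacobian itself because the atlas is oriented, and it cancels against the change of the
  determinant.\<close>

lemma volume_form_chart:
  assumes M: "oriented_riemannian_manifold M" and c: "c \<in> charts_at M q"
    and "v \<in> tangent_space M q" "w \<in> tangent_space M q" "z \<in> tangent_space M q"
  shows "volume_form M q v w z =
    sqrt (det (metric_matrix M c (snd c q))) * det (vector [v c, w c, z c] :: real^3^3)"
proof -
  interpret riem_manifold M by standard (rule M)
  define c' where "c' = (SOME c. c \<in> charts_at M q)"
  have c': "c' \<in> charts_at M q" unfolding c'_def using c by (rule someI)
  let ?A = "matrix (J c c' q)"
  have J: "?A *v u = J c c' q u" for u
    by (rule fun_cong[OF matrix_vector_mul(3)[OF has_derivative_bounded_linear[OF
            transition_has_derivative[OF c c']]]])
  have "det (vector [v c', w c', z c'] :: real^3^3) = det ?A * det (vector [v c, w c, z c] :: real^3^3)"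
    unfolding det_vector_mult[symmetric] J using assms(3-5)[THEN tangentD[OF _ c c']] by simp
  moreover have "sqrt (det (metric_matrix M c (snd c q))) =
      det ?A * sqrt (det (metric_matrix M c' (snd c' q)))"
    unfolding det_metric_matrix[OF c c'] using det_J_pos[OF c c'] by (simp add: real_sqrt_mult)
  ultimately show ?thesis
    unfolding volume_form_def Let_def c'_def[symmetric] by simp
qed

section \<open>Maps into the manifold and covariant derivatives along them\<close>

context riem_manifold
begin

lemma tangent_eqI:
  "v \<in> tangent_space M q \<Longrightarrow> w \<in> tangent_space M q \<Longrightarrow> c \<in> charts_at M q \<Longrightarrow> v c = w c \<Longrightarrow> v = w"
  by (metis tvec_of_tangent_eq)

lemma zero_tangent: "v \<in> tangent_space M q \<Longrightarrow> (\<lambda>_. 0) \<in> tangent_space M q"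
  using tangent_space_add_scale[of v q v 0 0] by simp

lemma open_chart_preimage:
  "smooth_map_into M S h \<Longrightarrow> open S \<Longrightarrow> c \<in> atlas M \<Longrightarrow> open (S \<inter> h -` fst c)"
  unfolding smooth_map_into_def using continuous_open_preimage open_dom by blast

lemma smooth_chart_rep:
  "smooth_map_into M S h \<Longrightarrow> c \<in> atlas M \<Longrightarrow> smooth_on (S \<inter> h -` fst c) (snd c \<circ> h)"
  unfolding smooth_map_into_def by blast

lemma chart_rep_has_derivative:
  assumes "smooth_map_into M S h" "x \<in> S" "c \<in> charts_at M (h x)"
  shows "(snd c \<circ> h has_derivative frechet_derivative (snd c \<circ> h) (at x)) (at x)"
  using smooth_on_has_derivative[OF smooth_chart_rep[OF assms(1) charts_atD(1)[OF assms(3)]]]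
    assms(2) charts_atD(2)[OF assms(3)] by blast

lemma chart_rep_transform:
  assumes h: "smooth_map_into M S h" "open S" and x: "x \<in> S"
    and c: "c \<in> charts_at M (h x)" and c': "c' \<in> charts_at M (h x)"
  shows "frechet_derivative (snd c' \<circ> h) (at x) a = J c c' (h x) (frechet_derivative (snd c \<circ> h) (at x) a)"
proof -
  let ?W = "(S \<inter> h -` fst c) \<inter> (S \<inter> h -` fst c')"
  have "(transition c c' has_derivative J c c' (h x)) (at ((snd c \<circ> h) x))"
    using transition_has_derivative[OF c c'] by simp
  from has_derivative_compose[OF chart_rep_has_derivative[OF h(1) x c] this]
  have "((\<lambda>x. transition c c' ((snd c \<circ> h) x)) has_derivative
      (\<lambda>a. J c c' (h x) (frechet_derivative (snd c \<circ> h) (at x) a))) (at x)" .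
  moreover have "open ?W"
    by (intro open_Int open_chart_preimage[OF h] charts_atD(1)[OF c] charts_atD(1)[OF c'])
  moreover have "x \<in> ?W" using x charts_atD(2)[OF c] charts_atD(2)[OF c'] by simp
  moreover have "transition c c' ((snd c \<circ> h) y) = (snd c' \<circ> h) y" if "y \<in> ?W" for y
    using that transition_apply[OF charts_atD(1)[OF c]] by simp
  ultimately have "(snd c' \<circ> h has_derivative
      (\<lambda>a. J c c' (h x) (frechet_derivative (snd c \<circ> h) (at x) a))) (at x)"
    by (rule has_derivative_transform_within_open)
  from frechet_derivative_at[OF this] show ?thesis by metis
qed

lemma tangent_map_apply:
  "c \<in> charts_at M (h x) \<Longrightarrow> tangent_map M h x a c = frechet_derivative (snd c \<circ> h) (at x) a"
  by (simp add: tangent_map_def)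

lemma tangent_map_tangent:
  assumes "smooth_map_into M S h" "open S" "x \<in> S"
  shows "tangent_map M h x a \<in> tangent_space M (h x)"
  unfolding tangent_space_def
proof (intro CollectI conjI ballI allI impI)
  fix c c' assume c: "c \<in> charts_at M (h x)" "c' \<in> charts_at M (h x)"
  show "tangent_map M h x a c' = J c c' (h x) (tangent_map M h x a c)"
    unfolding tangent_map_apply[of _ h, OF c(1)] tangent_map_apply[of _ h, OF c(2)]
    by (rule chart_rep_transform[OF assms c])
qed (simp add: tangent_map_def)

lemma cov_deriv_apply:
  "c \<in> charts_at M (h x) \<Longrightarrow> cov_deriv M h Y x a c =
   frechet_derivative (\<lambda>y. Y y c) (at x) a +
   chris_vec (metric_matrix M c) (snd c (h x)) (tangent_map M h x a c) (Y x c)"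
  by (simp add: cov_deriv_def chris_vec_def)

text \<open>Differentiating the relation between the coordinates of \<open>Y\<close> in two charts
  produces a second derivative of the transition map, which is exactly the inhomogeneous term of
  \<open>cov_transform\<close>.\<close>

lemma cov_deriv_tangent:
  assumes h: "smooth_map_into M S h" "open S" and x: "x \<in> S"
    and Y: "\<And>y. y \<in> S \<Longrightarrow> Y y \<in> tangent_space M (h y)"
    and Y_diff: "\<And>c. c \<in> charts_at M (h x) \<Longrightarrow> (\<lambda>y. Y y c) differentiable (at x)"
  shows "cov_deriv M h Y x a \<in> tangent_space M (h x)"
  unfolding tangent_space_def
proof (intro CollectI conjI ballI allI impI)
  fix c c' assume c: "c \<in> charts_at M (h x)" and c': "c' \<in> charts_at M (h x)"
  note c1 = charts_atD[OF c] note c2 = charts_atD[OF c']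
  let ?T = "transition c c'" and ?H = "snd c \<circ> h"
  let ?W = "(S \<inter> h -` fst c) \<inter> (S \<inter> h -` fst c')"
  have W: "open ?W" "x \<in> ?W"
    using x c1(2) c2(2) by (auto intro!: open_Int open_chart_preimage[OF h] c1 c2)
  have mem: "?H x \<in> snd c ` (fst c \<inter> fst c')" using c1 c2 by auto
  have "((\<lambda>y. frechet_derivative ?T (at (?H y)) (Y y c)) has_derivative
    (\<lambda>a. J c c' (h x) (frechet_derivative (\<lambda>y. Y y c) (at x) a) +
      frechet_derivative (\<lambda>z. frechet_derivative ?T (at z) (Y x c)) (at (?H x))
        (frechet_derivative ?H (at x) a))) (at x)"
    using frechet_derivative_along_has_derivative[OF open_overlap[OF c1(1) c2(1)]
        smooth_transition[OF c1(1) c2(1)] mem chart_rep_has_derivative[OF h(1) x c]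
        Y_diff[OF c, unfolded frechet_derivative_works]] by simp
  moreover have "frechet_derivative ?T (at (?H y)) (Y y c) = Y y c'" if "y \<in> ?W" for y
    using that tangentD[OF Y, of y c c'] c1(1) c2(1) by (simp add: charts_at_def)
  ultimately have "((\<lambda>y. Y y c') has_derivative
    (\<lambda>a. J c c' (h x) (frechet_derivative (\<lambda>y. Y y c) (at x) a) +
      frechet_derivative (\<lambda>z. frechet_derivative ?T (at z) (Y x c)) (at (?H x))
        (frechet_derivative ?H (at x) a))) (at x)"
    by (rule has_derivative_transform_within_open[OF _ W])
  from fun_cong[OF frechet_derivative_at[OF this], of a]
  have D: "frechet_derivative (\<lambda>y. Y y c') (at x) a =
    J c c' (h x) (frechet_derivative (\<lambda>y. Y y c) (at x) a) +
      frechet_derivative (\<lambda>z. frechet_derivative ?T (at z) (Y x c)) (at (snd c (h x)))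
        (tangent_map M h x a c)"
    by (simp add: tangent_map_apply c)
  show "cov_deriv M h Y x a c' = J c c' (h x) (cov_deriv M h Y x a c)"
    unfolding cov_deriv_apply[of _ h, OF c] cov_deriv_apply[of _ h, OF c'] D
      linear_add[OF linear_J[OF c c']] cov_transform[OF c c']
      tangentD[OF tangent_map_tangent[OF h x] c c'] tangentD[OF Y[OF x] c c']
    by (simp only: add.assoc add.commute add.left_commute)
qed (simp add: cov_deriv_def)

lemma tangent_map_smooth:
  assumes "smooth_map_into M S h" "open S" "c \<in> atlas M"
  shows "smooth_on (S \<inter> h -` fst c) (\<lambda>y. tangent_map M h y a c)"
proof -
  have "smooth_on (S \<inter> h -` fst c) (\<lambda>y. frechet_derivative (snd c \<circ> h) (at y) a)"
    by (intro smooth_on_frechet_derivative smooth_chart_rep assms)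
  then show ?thesis
    by (subst smooth_on_cong[OF open_chart_preimage[OF assms]])
       (auto simp: tangent_map_def charts_at_def assms(3))
qed

lemma smooth_map_into_compose:
  assumes "smooth_map_into M U f" "open U" "open S" "\<psi> ` S \<subseteq> U" "smooth_on S \<psi>"
  shows "smooth_map_into M S (f \<circ> \<psi>)"
  unfolding smooth_map_into_def
proof (intro conjI ballI)
  show cont: "continuous_on S (f \<circ> \<psi>)"
    using assms(1,4) smooth_on_continuous[OF assms(5)] continuous_on_subset
    unfolding smooth_map_into_def by (blast intro: continuous_on_compose)
  show "(f \<circ> \<psi>) ` S \<subseteq> carrier M"
    using assms(1,4) unfolding smooth_map_into_def by fastforce
  fix c assume c: "c \<in> atlas M"
  have "open (S \<inter> (f \<circ> \<psi>) -` fst c)"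
    by (rule continuous_open_preimage[OF cont assms(3) open_dom[OF c]])
  from smooth_on_compose[OF this open_chart_preimage[OF assms(1,2) c] _
      smooth_on_subset[OF assms(5)] smooth_chart_rep[OF assms(1) c]] assms(4)
  show "smooth_on (S \<inter> (f \<circ> \<psi>) -` fst c) (snd c \<circ> (f \<circ> \<psi>))"
    by (auto simp: o_def)
qed

lemma tangent_map_compose:
  assumes f: "smooth_map_into M U f" and "\<psi> y \<in> U" and \<psi>: "\<psi> differentiable (at y)"
  shows "tangent_map M (f \<circ> \<psi>) y a = tangent_map M f (\<psi> y) (frechet_derivative \<psi> (at y) a)"
proof
  fix c
  show "tangent_map M (f \<circ> \<psi>) y a c = tangent_map M f (\<psi> y) (frechet_derivative \<psi> (at y) a) c"
  proof (cases "c \<in> charts_at M (f (\<psi> y))")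
    case True
    have "(\<psi> has_derivative frechet_derivative \<psi> (at y)) (at y)"
      using \<psi> by (simp add: frechet_derivative_works)
    from has_derivative_compose[OF this chart_rep_has_derivative[OF f assms(2) True]]
    have "(snd c \<circ> (f \<circ> \<psi>) has_derivative
      (\<lambda>a. frechet_derivative (snd c \<circ> f) (at (\<psi> y)) (frechet_derivative \<psi> (at y) a))) (at y)"
      by (simp add: o_def)
    from frechet_derivative_at[OF this, symmetric] show ?thesis
      using True by (simp add: tangent_map_def)
  qed (simp add: tangent_map_def)
qed

end

section \<open>Fronts in a chart\<close>

lemma frechet_derivative_Pair:
  "f differentiable (at x) \<Longrightarrow> g differentiable (at x) \<Longrightarrow>
   frechet_derivative (\<lambda>y. (f y, g y)) (at x) = (\<lambda>a. (frechet_derivative f (at x) a, frechet_derivative g (at x) a))"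
  unfolding frechet_derivative_works
  by (rule frechet_derivative_at[symmetric]) (rule has_derivative_Pair)

text \<open>One ambient chart is fixed, and all computations take place on the part \<open>V\<close>
  of \<open>U\<close> that \<open>f\<close> maps into its domain.\<close>

locale front_chart = riem_manifold M
  for M :: "('m::{t2_space, second_countable_topology}, 3) riem" +
  fixes U :: "(real^2) set" and f :: "real^2 \<Rightarrow> 'm" and \<nu> :: "real^2 \<Rightarrow> ('m, 3) tvec"
    and c :: "('m, 3) chart"
  assumes open_U: "open U" and front: "front M U f \<nu>" and chart: "c \<in> atlas M"
begin

definition V :: "(real^2) set" where "V = U \<inter> f -` fst c"

definition F :: "real^2 \<Rightarrow> real^3" where "F = snd c \<circ> f"

definition n :: "real^2 \<Rightarrow> real^3" where "n x = \<nu> x c"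

definition G :: "real^2 \<Rightarrow> real^3^3" where "G x = metric_matrix M c (F x)"

text \<open>The pull-back of the connection form. It is linear in \<open>partial i F x\<close>,
  which is why the pulled-back curvature degenerates together with the differential of
  \<open>F\<close>.\<close>

definition A :: "2 \<Rightarrow> real^2 \<Rightarrow> real^3^3" where
  "A i x = (\<Sum>a\<in>UNIV. partial i F x $ a *\<^sub>R (\<chi> k j. christoffel (metric_matrix M c) (F x) k a j))"

lemma smooth_f: "smooth_map_into M U f"
  using front by (simp add: front_def)

lemma normal_field: "unit_normal_field M U f \<nu>"
  using front by (simp add: front_def)

lemma open_V: "open V"
  unfolding V_def by (rule open_chart_preimage[OF smooth_f open_U chart])

lemma V_chart: "x \<in> V \<Longrightarrow> c \<in> charts_at M (f x)"
  using chart by (simp add: V_def charts_at_def)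

lemma V_U: "x \<in> V \<Longrightarrow> x \<in> U" by (simp add: V_def)

lemma F_image: "x \<in> V \<Longrightarrow> F x \<in> snd c ` fst c"
  by (simp add: V_def F_def)

lemma smooth_F: "smooth_on V F"
  unfolding V_def F_def by (rule smooth_chart_rep[OF smooth_f chart])

lemma smooth_n: "smooth_on V n"
  using normal_field chart unfolding n_def[abs_def] V_def unit_normal_field_def smooth_field_along_def
  by blast

lemma \<nu>_tangent: "x \<in> U \<Longrightarrow> \<nu> x \<in> tangent_space M (f x)"
  using normal_field unfolding unit_normal_field_def smooth_field_along_def by blast

sublocale metric: metric_field "snd c ` fst c" "metric_matrix M c"
  by (rule metric_field_chart[OF chart])

lemma smooth_along_F:
  fixes g :: "real^3 \<Rightarrow> 'b::real_normed_vector"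
  shows "smooth_on (snd c ` fst c) g \<Longrightarrow> smooth_on V (\<lambda>x. g (F x))"
  using F_image by (intro smooth_on_compose[OF open_V metric.open_S _ smooth_F]) auto

lemma F_has_derivative: "x \<in> V \<Longrightarrow> (F has_derivative frechet_derivative F (at x)) (at x)"
  by (rule smooth_on_has_derivative[OF smooth_F])

lemma frechet_derivative_F: "x \<in> V \<Longrightarrow> frechet_derivative F (at x) a = (\<Sum>i\<in>UNIV. a $ i *\<^sub>R partial i F x)"
  by (rule frechet_derivative_eq_sum_partial[OF smooth_on_differentiable[OF smooth_F]])

lemma tangent_map_chart: "x \<in> V \<Longrightarrow> tangent_map M f x a c = frechet_derivative F (at x) a"
  unfolding F_def by (rule tangent_map_apply[OF V_chart])

lemma A_mult: "A i x *v w = chris_vec (metric_matrix M c) (F x) (partial i F x) w"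
proof -
  have "(A i x *v w) $ k = (\<Sum>j\<in>UNIV. \<Sum>a\<in>UNIV.
      christoffel (metric_matrix M c) (F x) k a j * partial i F x $ a * w $ j)" for k
    by (simp add: A_def matrix_vector_mult_def sum_distrib_right sum_distrib_left mult_ac)
  then show ?thesis
    unfolding vec_eq_iff chris_vec_def by (subst sum.swap) simp
qed

lemma smooth_christoffel_matrix:
  "smooth_on (snd c ` fst c) (\<lambda>y. (\<chi> k j. christoffel (metric_matrix M c) y k a j) :: real^3^3)"
proof (intro smooth_on_vec metric.open_S)
  fix k j
  have "smooth_on (snd c ` fst c) (\<lambda>y. christoffel (metric_matrix M c) y k a j)"
    by (intro smooth_on_christoffel metric.open_S metric.smooth_G gram_matrix.det_nonzero metric.gram)
  then show "smooth_on (snd c ` fst c)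
      (\<lambda>y. ((\<chi> k j. christoffel (metric_matrix M c) y k a j) :: real^3^3) $ k $ j)"
    by simp
qed

lemma metric_f:
  "x \<in> V \<Longrightarrow> v \<in> tangent_space M (f x) \<Longrightarrow> w \<in> tangent_space M (f x) \<Longrightarrow>
   metric M (f x) v w = v c \<bullet> (G x *v w c)"
  unfolding G_def F_def o_def by (rule metric_chart[OF _ _ V_chart])

text \<open>Metric compatibility and torsion-freeness of the pull-back are inherited from
  \<open>chris_vec_compatible\<close> and \<open>chris_vec_commute\<close> at the image point,
  together with the symmetry of the second derivatives of \<open>F\<close>.\<close>

sublocale frontal_data V G A "\<lambda>i. partial i F" n
proof (rule frontal_data.intro)
  show "open V" by (rule open_V)
  show "smooth_on V G" unfolding G_def[abs_def] by (rule smooth_along_F[OF metric.smooth_G])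
  show "smooth_on V (A i)" for i
    unfolding A_def[abs_def]
    by (intro smooth_on_sum open_V smooth_on_bilinear[OF _ bounded_bilinear_scaleR] smooth_on_nth
        smooth_on_partial smooth_F smooth_along_F smooth_christoffel_matrix)
  show "smooth_on V (partial i F)" for i by (rule smooth_on_partial[OF smooth_F])
  show "smooth_on V n" by (rule smooth_n)
next
  fix x assume x: "x \<in> V"
  show "gram_matrix_3 (G x)"
    unfolding gram_matrix_3_def G_def by (rule metric.gram[OF F_image[OF x]])
  show "v \<bullet> (partial i G x *v w) = (A i x *v v) \<bullet> (G x *v w) + v \<bullet> (G x *v (A i x *v w))" for i v w
  proof -
    have "(G has_derivative (\<lambda>a. metric.DG (F x) (frechet_derivative F (at x) a))) (at x)"
      unfolding metric.DG_def G_def[abs_def]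
      by (rule has_derivative_compose[OF F_has_derivative[OF x]
            smooth_on_has_derivative[OF metric.smooth_G F_image[OF x]]])
    then have "partial i G x = metric.DG (F x) (partial i F x)"
      unfolding partial_def[of i F] by (rule partial_eq)
    then show ?thesis
      by (simp only: A_mult G_def metric.chris_vec_compatible[OF F_image[OF x]])
  qed
  show "partial i (partial j F) x + A i x *v partial j F x =
      partial j (partial i F) x + A j x *v partial i F x" for i j
    unfolding A_mult partial_symmetric[OF open_V smooth_F x, of i j]
      metric.chris_vec_commute[OF F_image[OF x], of "partial i F x"] ..
  show "n x \<bullet> (G x *v n x) = 1"
    using normal_field metric_f[OF x \<nu>_tangent \<nu>_tangent] V_U[OF x]
    unfolding unit_normal_field_def n_def by simp
  show "n x \<bullet> (G x *v partial i F x) = 0" for i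
    using normal_field metric_f[OF x \<nu>_tangent tangent_map_tangent[OF smooth_f open_U]] V_U[OF x]
    unfolding unit_normal_field_def n_def partial_def
    by (simp add: tangent_map_chart[OF x])
qed

lemma first_fundamental_form_eq: "x \<in> V \<Longrightarrow> first_fundamental_form M f x = first_form x"
  using metric_f[OF _ tangent_map_tangent[OF smooth_f open_U] tangent_map_tangent[OF smooth_f open_U]]
  by (simp add: first_fundamental_form_def first_form_def ip_def V_U tangent_map_chart partial_def
      vec_eq_iff)

lemma gauss_curvature_eq: "x \<in> V \<Longrightarrow> gauss_curvature M f x = gauss_curv_metric first_form x"
  unfolding gauss_curvature_def
  by (rule gauss_curv_metric_cong_open[OF open_V _ first_fundamental_form_eq])

lemma area_density_eq:
  assumes x: "x \<in> V"
  shows "area_density M f \<nu> x = density x"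
proof -
  have "metric_matrix M c (snd c (f x)) = G x" by (simp add: G_def F_def)
  then show ?thesis
    using volume_form_chart[OF oriented_riemannian_manifold V_chart[OF x]
        tangent_map_tangent[OF smooth_f open_U V_U[OF x]]
        tangent_map_tangent[OF smooth_f open_U V_U[OF x]] \<nu>_tangent[OF V_U[OF x]]]
    by (simp add: area_density_def density_def area_def partial_def n_def tangent_map_chart[OF x])
qed

lemma tangent_map_eq_iff:
  assumes "x \<in> V"
  shows "tangent_map M f x a = tangent_map M f x b \<longleftrightarrow>
    frechet_derivative F (at x) a = frechet_derivative F (at x) b"
  using tangent_eqI[OF tangent_map_tangent[OF smooth_f open_U V_U[OF assms]]
      tangent_map_tangent[OF smooth_f open_U V_U[OF assms]] V_chart[OF assms], of a b]
    tangent_map_chart[OF assms]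
  by (metis (no_types))

lemma singular_iff:
  assumes x: "x \<in> V"
  shows "x \<in> singular_set M U f \<longleftrightarrow> area x = 0"
proof -
  have "x \<in> singular_set M U f \<longleftrightarrow> \<not> inj (frechet_derivative F (at x))"
    using V_U[OF x] by (simp add: singular_set_def inj_def tangent_map_eq_iff[OF x])
  also have "\<dots> \<longleftrightarrow> (\<exists>a. a \<noteq> 0 \<and> (\<Sum>i\<in>UNIV. a $ i *\<^sub>R partial i F x) = 0)"
    using linear_injective_0[OF linear_frechet_derivative[OF smooth_on_differentiable[OF smooth_F x]]]
    by (auto simp: frechet_derivative_F[OF x])
  also have "\<dots> \<longleftrightarrow> area x = 0"
    unfolding area_def sum_2
    by (rule gram_matrix_3.det_eq_0_iff_dependent[symmetric, OF gram[OF x] unit[OF x] normal[OF x] normal[OF x]])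
  finally show ?thesis .
qed

lemma K_times_area_density:
  assumes "x \<in> V" "x \<notin> singular_set M U f"
  shows "gauss_curvature M f x * area_density M f \<nu> x = curvature_density x"
  using assms curvature_times_density[OF assms(1)]
  by (simp add: gauss_curvature_eq area_density_eq singular_iff)

text \<open>A pulled-back 2-form vanishes where the differential has rank at most one. Concretely,
  the two derivative terms agree because both directions are multiples of \<open>e\<close>, and
  \<open>A 1 x\<close>, \<open>A 2 x\<close> commute as multiples of one matrix.\<close>

lemma curv_eq_0:
  assumes x: "x \<in> V" and dep: "partial 1 F x = s *\<^sub>R e" "partial 2 F x = t *\<^sub>R e"
  shows "curv x = 0"
proof -
  define \<Gamma> where "\<Gamma> = (\<lambda>a y. (\<chi> k j. christoffel (metric_matrix M c) y k a j) :: real^3^3)"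
  let ?X = "\<lambda>i. partial i F"
  have A_eq: "A i = (\<lambda>x. \<Sum>a\<in>UNIV. ?X i x $ a *\<^sub>R \<Gamma> a (F x))" for i
    by (simp add: A_def[abs_def] \<Gamma>_def)
  have \<Gamma>: "smooth_on (snd c ` fst c) (\<Gamma> a)" for a
    unfolding \<Gamma>_def by (rule smooth_christoffel_matrix)
  have diff\<Gamma>: "(\<lambda>x. \<Gamma> a (F x)) differentiable (at x)" for a
    by (rule smooth_on_differentiable[OF smooth_along_F[OF \<Gamma>] x])
  have diffX: "(\<lambda>x. ?X i x $ a) differentiable (at x)" for i a
    by (rule smooth_on_differentiable[OF smooth_on_nth[OF open_V smooth_on_partial[OF smooth_F]] x])
  have part\<Gamma>: "partial i (\<lambda>x. \<Gamma> a (F x)) x = frechet_derivative (\<Gamma> a) (at (F x)) (?X i x)" for i a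
    unfolding partial_def[of i F]
    by (rule partial_eq[OF has_derivative_compose[OF F_has_derivative[OF x]
            smooth_on_has_derivative[OF \<Gamma> F_image[OF x]]]])
  have lin: "frechet_derivative (\<Gamma> a) (at (F x)) (r *\<^sub>R e) = r *\<^sub>R frechet_derivative (\<Gamma> a) (at (F x)) e" for r a
    using linear_scale[OF linear_frechet_derivative[OF smooth_on_differentiable[OF \<Gamma> F_image[OF x]]]] .
  have partX: "partial j (\<lambda>x. ?X i x $ a) x = partial j (?X i) x $ a" for i j a
    by (rule partial_linear[OF bounded_linear_vec_nth smooth_on_differentiable[OF smooth_on_partial[OF smooth_F] x]])
  have "partial j (A i) x = (\<Sum>a\<in>UNIV. ?X i x $ a *\<^sub>R frechet_derivative (\<Gamma> a) (at (F x)) (?X j x)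
      + partial j (?X i) x $ a *\<^sub>R \<Gamma> a (F x))" for i j
    unfolding A_eq
    by (subst partial_sum)
       (auto simp: partial_bilinear[OF bounded_bilinear_scaleR diffX diff\<Gamma>] part\<Gamma> partX
         intro!: bounded_bilinear_differentiable[OF bounded_bilinear_scaleR] diffX diff\<Gamma>)
  then have "partial 1 (A 2) x = partial 2 (A 1) x"
    by (simp add: dep lin partial_symmetric[OF open_V smooth_F x, of 1 2] mult.commute mult.left_commute)
  moreover have "A 1 x ** A 2 x = A 2 x ** A 1 x"
  proof -
    let ?B = "\<Sum>a\<in>UNIV. e $ a *\<^sub>R \<Gamma> a (F x)"
    have "A 1 x = s *\<^sub>R ?B" "A 2 x = t *\<^sub>R ?B"
      by (simp_all add: A_eq dep scaleR_sum_right)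
    then show ?thesis
      by (simp add: matrix_scalar_ac scalar_matrix_assoc[symmetric] mult.commute)
  qed
  ultimately show ?thesis by (simp add: curv_def)
qed

text \<open>In a direction that \<open>F\<close> annihilates the Christoffel part of the covariant
  derivative drops out, so a vanishing sum would put \<open>b\<close> into the kernels of both
  \<open>F\<close> and \<open>n\<close>, against the front condition.\<close>

lemma immersion:
  assumes x: "x \<in> V" and b: "b \<noteq> 0" "(\<Sum>i\<in>UNIV. b $ i *\<^sub>R partial i F x) = 0"
  shows "(\<Sum>i\<in>UNIV. b $ i *\<^sub>R N i x) \<noteq> 0"
proof
  assume 0: "(\<Sum>i\<in>UNIV. b $ i *\<^sub>R N i x) = 0"
  have "(\<Sum>i\<in>UNIV. b $ i *\<^sub>R (A i x *v n x)) =
      chris_vec (metric_matrix M c) (F x) (\<Sum>i\<in>UNIV. b $ i *\<^sub>R partial i F x) (n x)"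
    using bilinear_chris_vec[of "metric_matrix M c" "F x"]
    by (simp add: A_mult sum_2 bilinear_ladd bilinear_lmul)
  also have "\<dots> = 0"
    unfolding b(2) by (rule bilinear_lzero[OF bilinear_chris_vec])
  finally have "(\<Sum>i\<in>UNIV. b $ i *\<^sub>R partial i n x) = 0"
    using 0 by (simp add: N_def cov_def sum_2 algebra_simps)
  then have dn: "frechet_derivative n (at x) b = 0"
    using frechet_derivative_eq_sum_partial[OF smooth_on_differentiable[OF smooth_n x]] by simp
  have "inj (frechet_derivative (\<lambda>y. (F y, n y)) (at x))"
    using front V_U[OF x] V_chart[OF x] unfolding front_def F_def n_def o_def by blast
  then have "inj (\<lambda>a. (frechet_derivative F (at x) a, frechet_derivative n (at x) a))"
    by (simp add: frechet_derivative_Pair[OF smooth_on_differentiable[OF smooth_F x]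
          smooth_on_differentiable[OF smooth_n x]])
  moreover have "frechet_derivative F (at x) b = 0" using b(2) by (simp add: frechet_derivative_F[OF x])
  moreover have "frechet_derivative F (at x) 0 = 0" "frechet_derivative n (at x) 0 = 0"
    by (rule linear_0[OF linear_frechet_derivative[OF smooth_on_differentiable[OF smooth_F x]]],
        rule linear_0[OF linear_frechet_derivative[OF smooth_on_differentiable[OF smooth_n x]]])
  ultimately show False using dn b(1) by (auto dest: injD[of _ b 0])
qed

text \<open>\<open>area\<close> is bilinear in the two partial derivatives of \<open>F\<close>; if
  both vanish at \<open>x\<close>, it vanishes there to second order, and so does the area
  density.\<close>

lemma nondegenerate_rank:
  assumes x: "x \<in> V" and nd: "nondegenerate_at M f \<nu> x"
  shows "\<exists>i. partial i F x \<noteq> 0"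
proof (rule ccontr)
  assume "\<not> ?thesis"
  then have X0: "partial i F x = 0" for i by blast
  let ?X = "\<lambda>i. partial i F"
  have hd: "(?X i has_derivative frechet_derivative (?X i) (at x)) (at x)" for i
    by (rule smooth_on_has_derivative[OF smooth_on_partial[OF smooth_F] x])
  have bb: "bounded_bilinear cross3"
    using bilinear_cross bilinear_conv_bounded_bilinear by blast
  have "area = (\<lambda>y. n y \<bullet> cross3 (?X 1 y) (?X 2 y))"
    unfolding area_def[abs_def] dot_cross_det det_3 vector_3 by (simp add: algebra_simps)
  then have D: "(area has_derivative (\<lambda>_. 0)) (at x)"
    using bounded_bilinear.FDERIV[OF bounded_bilinear_inner smooth_on_has_derivative[OF smooth_n x]
        bounded_bilinear.FDERIV[OF bb hd hd], of 1 2]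
    by (simp add: X0)
  have "((\<lambda>y. sqrt (det (G y))) has_derivative frechet_derivative (\<lambda>y. sqrt (det (G y))) (at x)) (at x)"
    by (intro smooth_on_has_derivative[OF _ x] smooth_on_sqrt smooth_on_det open_V smooth_G det_G_pos)
  moreover have "area x = 0" by (simp add: area_def X0 det_3)
  ultimately have "(density has_derivative (\<lambda>_. 0)) (at x)"
    unfolding density_def[abs_def] using has_derivative_mult[OF _ D] by fastforce
  then have "(area_density M f \<nu> has_derivative (\<lambda>_. 0)) (at x)"
    by (rule has_derivative_transform_within_open[OF _ open_V x]) (simp add: area_density_eq)
  then show False using nd frechet_derivative_at unfolding nondegenerate_at_def by metis
qed

end

section \<open>The limiting normal curvature\<close>

context front_chart
begin

definition Xv :: "real^2 \<Rightarrow> real^2 \<Rightarrow> real^3" where "Xv x a = (\<Sum>i\<in>UNIV. a $ i *\<^sub>R partial i F x)"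

definition Nv :: "real^2 \<Rightarrow> real^2 \<Rightarrow> real^3" where "Nv x a = (\<Sum>i\<in>UNIV. a $ i *\<^sub>R N i x)"

text \<open>By \<open>second_form_eq\<close> the numerator is the second fundamental form on
  \<open>a\<close>. Written with \<open>Nv\<close>, the quotient involves only a direction at
  \<open>x\<close> and no coordinate system.\<close>

definition normal_quotient :: "real^2 \<Rightarrow> real^2 \<Rightarrow> real" where
  "normal_quotient x a = - ip x (Xv x a) (Nv x a) / ip x (Xv x a) (Xv x a)"

lemma frechet_derivative_F_Xv: "x \<in> V \<Longrightarrow> frechet_derivative F (at x) a = Xv x a"
  unfolding Xv_def by (rule frechet_derivative_F)

lemma Xv_linear: "Xv x (s *\<^sub>R a + t *\<^sub>R b) = s *\<^sub>R Xv x a + t *\<^sub>R Xv x b"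
  by (simp add: Xv_def sum_2 algebra_simps)

lemma Nv_linear: "Nv x (s *\<^sub>R a + t *\<^sub>R b) = s *\<^sub>R Nv x a + t *\<^sub>R Nv x b"
  by (simp add: Nv_def sum_2 algebra_simps)

lemma Nv_eq:
  assumes "x \<in> V"
  shows "Nv x a = frechet_derivative n (at x) a + chris_vec (metric_matrix M c) (F x) (Xv x a) (n x)"
proof -
  have "chris_vec (metric_matrix M c) (F x) (Xv x a) (n x) = (\<Sum>i\<in>UNIV. a $ i *\<^sub>R (A i x *v n x))"
    using bilinear_chris_vec[of "metric_matrix M c" "F x"]
    by (simp add: A_mult Xv_def sum_2 bilinear_ladd bilinear_lmul)
  then show ?thesis
    by (simp add: frechet_derivative_eq_sum_partial[OF smooth_on_differentiable[OF smooth_n assms]]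
        Nv_def N_def cov_def sum_2 algebra_simps)
qed

lemma ip_Xv_Nv_commute:
  assumes "x \<in> V"
  shows "ip x (Xv x a) (Nv x b) = ip x (Xv x b) (Nv x a)"
proof -
  have "ip x (partial 2 F x) (N 1 x) = ip x (partial 1 F x) (N 2 x)"
    using second_form_eq[OF assms, of 1 2] second_form_eq[OF assms, of 2 1]
      cov_X_commute[OF assms, of 1 2] by simp
  then show ?thesis by (simp add: Xv_def Nv_def sum_2 ip_linear algebra_simps)
qed

text \<open>Modulo \<open>b\<close>, \<open>a'\<close> is a nonzero multiple of \<open>a\<close>.
  Both forms ignore the part along \<open>b\<close>, by \<open>Xv x b = 0\<close> and symmetry, and
  scale by the same square.\<close>

lemma normal_quotient_indep:
  fixes a b :: "real^2"
  assumes x: "x \<in> V" and b: "b \<noteq> 0" "Xv x b = 0" and a: "Xv x a \<noteq> 0" and a': "Xv x a' \<noteq> 0"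
  shows "normal_quotient x a' = normal_quotient x a"
proof -
  define d where "d = a $ 1 * b $ 2 - a $ 2 * b $ 1"
  have "d \<noteq> 0"
  proof
    assume "d = 0"
    moreover have "(b $ 1) *\<^sub>R a = (a $ 1) *\<^sub>R b" if "d = 0"
      using that by (simp add: d_def vec_eq_iff forall_2)
    moreover have "(b $ 2) *\<^sub>R a = (a $ 2) *\<^sub>R b" if "d = 0"
      using that by (simp add: d_def vec_eq_iff forall_2 mult.commute)
    ultimately have "Xv x (b $ 1 *\<^sub>R a + 0 *\<^sub>R a) = 0" "Xv x (b $ 2 *\<^sub>R a + 0 *\<^sub>R a) = 0"
      using b(2) Xv_linear[of x "a $ 1" b 0 b] Xv_linear[of x "a $ 2" b 0 b] by simp_all
    then have "b $ 1 = 0" "b $ 2 = 0" using a unfolding Xv_linear by simp_all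
    then show False using b(1) by (simp add: vec_eq_iff forall_2)
  qed
  \<comment> \<open>Coordinates of \<open>a'\<close> in the basis \<open>a\<close>, \<open>b\<close>
    by Cramer's rule.\<close>
  define s t where "s = (a' $ 1 * b $ 2 - a' $ 2 * b $ 1) / d"
    and "t = (a $ 1 * a' $ 2 - a $ 2 * a' $ 1) / d"
  have "a' = s *\<^sub>R a + t *\<^sub>R b"
  proof -
    have "d *\<^sub>R a' = d *\<^sub>R (s *\<^sub>R a + t *\<^sub>R b)"
      using \<open>d \<noteq> 0\<close> by (simp add: s_def t_def scaleR_add_right vec_eq_iff forall_2)
        (simp add: d_def algebra_simps)
    then show ?thesis using \<open>d \<noteq> 0\<close> by simp
  qed
  then have X: "Xv x a' = s *\<^sub>R Xv x a" and Nn: "Nv x a' = s *\<^sub>R Nv x a + t *\<^sub>R Nv x b"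
    by (simp_all add: Xv_linear Nv_linear b(2))
  have "s \<noteq> 0" using a' X by auto
  have "ip x (Xv x a) (Nv x b) = 0"
    unfolding ip_Xv_Nv_commute[OF x, of a b] b(2) by (simp add: ip_linear)
  then show ?thesis
    using \<open>s \<noteq> 0\<close> by (simp add: normal_quotient_def X Nn ip_linear)
qed

text \<open>Differentiating the orthogonality of \<open>\<nu>\<close> and the first coordinate
  derivative trades the second derivative of the map for a first derivative of \<open>\<nu>\<close>.
  The second derivatives of the coordinate change thereby disappear, and only its first column at
  the origin matters.\<close>

lemma normal_curvature_quotient_eq:
  assumes p: "p \<in> V" and \<psi>: "positive_coordinates U p W \<psi>"
  shows "normal_curvature_quotient M (f \<circ> \<psi>) (\<nu> p) =
    normal_quotient p (frechet_derivative \<psi> (at 0) e_u)"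
proof -
  let ?h = "f \<circ> \<psi>" and ?a = "frechet_derivative \<psi> (at 0) e_u"
  let ?Y = "\<lambda>y. tangent_map M ?h y e_u"
  have W: "open W" "0 \<in> W" "\<psi> ` W \<subseteq> U" "smooth_on W \<psi>" and \<psi>0: "\<psi> 0 = p"
    using \<psi> by (auto simp: positive_coordinates_def)
  have h: "smooth_map_into M W ?h" by (rule smooth_map_into_compose[OF smooth_f open_U W(1,3,4)])
  have tm: "tangent_map M ?h y a = tangent_map M f (\<psi> y) (frechet_derivative \<psi> (at y) a)"
    if "y \<in> W" for y a
    using that W(3) by (intro tangent_map_compose[OF smooth_f]) (auto intro: smooth_on_differentiable[OF W(4)])
  define W' where "W' = W \<inter> ?h -` fst c"
  have W': "open W'" "0 \<in> W'" "W' \<subseteq> W"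
    using W p open_chart_preimage[OF h W(1) chart] by (auto simp: W'_def V_def \<psi>0)
  have W'V: "\<psi> y \<in> V" if "y \<in> W'" for y
    using that W(3) by (auto simp: W'_def V_def)
  have c0: "c \<in> charts_at M (?h 0)" using V_chart[OF p] by (simp add: \<psi>0)
  let ?P = "\<lambda>y. ?Y y c"
  have smooth_Y: "smooth_on (W \<inter> ?h -` fst c') (\<lambda>y. ?Y y c')" if "c' \<in> atlas M" for c'
    by (rule tangent_map_smooth[OF h W(1) that])
  have P_hd: "(?P has_derivative frechet_derivative ?P (at 0)) (at 0)"
    using smooth_on_has_derivative[OF smooth_Y[OF chart]] W'(2) by (simp add: W'_def)
  have P0: "?P 0 = Xv p ?a"
    using tm[OF W(2)] tangent_map_chart[OF p] frechet_derivative_F_Xv[OF p] by (simp add: \<psi>0)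
  have \<psi>_hd: "(\<psi> has_derivative frechet_derivative \<psi> (at 0)) (at 0)"
    by (rule smooth_on_has_derivative[OF W(4,2)])
  have H_hd: "((\<lambda>y. F (\<psi> y)) has_derivative (\<lambda>a. Xv p (frechet_derivative \<psi> (at 0) a))) (at 0)"
    using has_derivative_compose[OF \<psi>_hd, of F "frechet_derivative F (at p)"] F_has_derivative[OF p]
    by (simp add: \<psi>0 frechet_derivative_F_Xv[OF p])
  have n_hd: "((\<lambda>y. n (\<psi> y)) has_derivative (\<lambda>a. frechet_derivative n (at p) (frechet_derivative \<psi> (at 0) a))) (at 0)"
    using has_derivative_compose[OF \<psi>_hd, of n "frechet_derivative n (at p)"]
      smooth_on_has_derivative[OF smooth_n p] by (simp add: \<psi>0)
  define Z where "Z = cov_deriv M ?h ?Y 0 e_u"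
  have Zc: "Z c = frechet_derivative ?P (at 0) e_u + chris_vec (metric_matrix M c) (F p) (Xv p ?a) (Xv p ?a)"
    unfolding Z_def cov_deriv_apply[of _ ?h, OF c0] P0 by (simp add: \<psi>0 F_def)
  have "((\<lambda>y. n (\<psi> y) \<bullet> (metric_matrix M c (F (\<psi> y)) *v ?P y)) has_derivative (\<lambda>_. 0)) (at 0)"
  proof (rule has_derivative_transform_within_open[OF has_derivative_const[of 0] W'(1,2)])
    fix y assume y: "y \<in> W'"
    have "?P y = Xv (\<psi> y) (frechet_derivative \<psi> (at y) e_u)"
      using tm[of y] W'(3) y tangent_map_chart[OF W'V[OF y]] frechet_derivative_F_Xv[OF W'V[OF y]] by auto
    then show "0 = n (\<psi> y) \<bullet> (metric_matrix M c (F (\<psi> y)) *v ?P y)"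
      using normal[OF W'V[OF y]]
      by (simp add: Xv_def G_def[symmetric] sum_2 matrix_vector_right_distrib matrix_vector_mult_scaleR
          inner_add_right)
  qed
  from has_derivative_unique[OF this metric.ip_has_derivative[OF H_hd _ n_hd P_hd]]
  have "(frechet_derivative n (at p) ?a + chris_vec (metric_matrix M c) (F p) (Xv p ?a) (n p)) \<bullet>
      (G p *v Xv p ?a) + n p \<bullet> (G p *v Z c) = 0"
    using F_image[OF p] unfolding Zc by (simp add: \<psi>0 G_def P0 fun_eq_iff del: frechet_derivative_const)
  then have num: "Z c \<bullet> (G p *v n p) = - ip p (Xv p ?a) (Nv p ?a)"
    unfolding Nv_eq[OF p, symmetric] using ip_commute[OF p, of "Nv p ?a" "Xv p ?a"] ip_commute[OF p, of "n p" "Z c"]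
    by (simp add: ip_def)
  \<comment> \<open>The inner product in the definition takes the whole family \<open>Z\<close>, so
    tangency is required before it can be evaluated in \<open>c\<close>.\<close>
  have "Z \<in> tangent_space M (?h 0)"
    unfolding Z_def
  proof (rule cov_deriv_tangent[OF h W(1,2)])
    show "?Y y \<in> tangent_space M (?h y)" if "y \<in> W" for y
      by (rule tangent_map_tangent[OF h W(1) that])
    show "(\<lambda>y. ?Y y c') differentiable (at 0)" if c': "c' \<in> charts_at M (?h 0)" for c'
      using charts_atD[OF c'] W(2)
      by (intro smooth_on_differentiable[OF smooth_Y]) auto
  qed
  then have "metric M (f p) Z (\<nu> p) = - ip p (Xv p ?a) (Nv p ?a)"
    using metric_f[OF p _ \<nu>_tangent[OF V_U[OF p]]] num by (simp add: \<psi>0 n_def)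
  moreover have "metric M (f p) (?Y 0) (?Y 0) = ip p (Xv p ?a) (Xv p ?a)"
    using metric_f[OF p] tangent_map_tangent[OF h W(1,2)] by (simp add: \<psi>0 P0 ip_def)
  ultimately show ?thesis
    by (simp add: normal_curvature_quotient_def Z_def[symmetric] \<psi>0 normal_quotient_def)
qed

text \<open>Non-degeneracy excludes rank zero, so some unit vector is not annihilated and is
  independent of the kernel. Replacing \<open>b\<close> by its negative adjusts the
  orientation.\<close>

lemma singular_kernel:
  assumes p: "p \<in> V" "p \<in> singular_set M U f" "nondegenerate_at M f \<nu> p"
  obtains a b :: "real^2" where "b \<noteq> 0" "Xv p b = 0" "Xv p a \<noteq> 0" "a $ 1 * b $ 2 - a $ 2 * b $ 1 > 0"
proof -
  have lin: "linear (frechet_derivative F (at p))"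
    by (rule linear_frechet_derivative[OF smooth_on_differentiable[OF smooth_F p(1)]])
  have "\<not> inj (frechet_derivative F (at p))"
    using p(2) by (auto simp: singular_set_def inj_def tangent_map_eq_iff[OF p(1)])
  then obtain b where b: "b \<noteq> 0" "Xv p b = 0"
    unfolding linear_injective_0[OF lin] frechet_derivative_F_Xv[OF p(1)] by blast
  obtain i where i: "partial i F p \<noteq> 0" using nondegenerate_rank[OF p(1,3)] by (rule exE)
  define a where "a = (axis i 1 :: real^2)"
  have a: "Xv p a \<noteq> 0"
    unfolding frechet_derivative_F_Xv[OF p(1), symmetric] a_def using i unfolding partial_def .
  have "a $ 1 * b $ 2 - a $ 2 * b $ 1 \<noteq> 0"
  proof
    assume 0: "a $ 1 * b $ 2 - a $ 2 * b $ 1 = 0"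
    have "b = (b $ i) *\<^sub>R a"
      using 0 exhaust_2[of i] by (auto simp: a_def vec_eq_iff forall_2 axis_def)
    then have "Xv p b = (b $ i) *\<^sub>R Xv p a" using Xv_linear[of p "b $ i" a 0 a] by simp
    then show False using b a \<open>b = (b $ i) *\<^sub>R a\<close> by auto
  qed
  then consider "a $ 1 * b $ 2 - a $ 2 * b $ 1 > 0" | "a $ 1 * (- b) $ 2 - a $ 2 * (- b) $ 1 > 0"
    by fastforce
  then show ?thesis
  proof cases
    case 1
    show ?thesis by (rule that[OF b a 1])
  next
    case 2
    have "Xv p (- b) = 0" using Xv_linear[of p "-1" b 0 b] b(2) by simp
    then show ?thesis using that[of "- b" a] b(1) a 2 by simp
  qed
qed

text \<open>Affine coordinates suffice: the columns of their derivative are \<open>a\<close> and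
  \<open>b\<close>, and the preimage of all of \<open>U\<close> serves as domain.\<close>

lemma admissible_coordinates_exist:
  fixes a b :: "real^2"
  assumes p: "p \<in> V" and b: "Xv p b = 0" and ab: "a $ 1 * b $ 2 - a $ 2 * b $ 1 > 0"
  shows "\<exists>W \<psi>. admissible_coordinates M U f p W \<psi>"
proof -
  define d where "d = a $ 1 * b $ 2 - a $ 2 * b $ 1"
  have "d \<noteq> 0" using ab by (simp add: d_def)
  define L where "L = (\<lambda>y :: real^2. y $ 1 *\<^sub>R a + y $ 2 *\<^sub>R b)"
  \<comment> \<open>The inverse of \<open>L\<close> by Cramer's rule.\<close>
  define R where "R = (\<lambda>y :: real^2. axis 1 ((y $ 1 * b $ 2 - y $ 2 * b $ 1) / d)
    + axis 2 ((a $ 1 * y $ 2 - a $ 2 * y $ 1) / d) :: real^2)"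
  have LR: "L (R y) = y" for y
  proof -
    have "d *\<^sub>R L (R y) = d *\<^sub>R y"
      using \<open>d \<noteq> 0\<close> by (simp add: L_def R_def vec_eq_iff forall_2 axis_def scaleR_add_right)
        (simp add: d_def algebra_simps)
    then show ?thesis using \<open>d \<noteq> 0\<close> by simp
  qed
  have RL: "R (L y) = y" for y
  proof -
    have "L y $ 1 * b $ 2 - L y $ 2 * b $ 1 = y $ 1 * d" "a $ 1 * L y $ 2 - a $ 2 * L y $ 1 = y $ 2 * d"
      by (simp_all add: L_def d_def algebra_simps)
    then show ?thesis using \<open>d \<noteq> 0\<close> by (simp add: R_def vec_eq_iff forall_2 axis_def)
  qed
  have L: "bounded_linear L"
    by (intro linear_conv_bounded_linear[THEN iffD1] linearI) (simp_all add: L_def algebra_simps)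
  have R: "bounded_linear R"
    by (intro linear_conv_bounded_linear[THEN iffD1] linearI)
       (simp_all add: R_def vec_eq_iff forall_2 axis_def algebra_simps add_divide_distrib diff_divide_distrib)
  define \<psi> where "\<psi> = (\<lambda>y. p + L y)"
  define W where "W = \<psi> -` U"
  have smooth_\<psi>: "smooth_on S \<psi>" if "open S" for S
    unfolding \<psi>_def by (intro smooth_on_add that smooth_on_const smooth_on_bounded_linear L)
  have inv: "\<psi> (R (x - p)) = x" "R (\<psi> y - p) = y" for x y
    by (simp_all add: \<psi>_def LR RL)
  have L0: "L 0 = 0" by (simp add: L_def)
  have W: "open W" "0 \<in> W"
    using open_vimage[OF open_U, of \<psi>] smooth_on_continuous[OF smooth_\<psi>[OF open_UNIV]] V_U[OF p]
    by (auto simp: W_def \<psi>_def L0)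
  have img: "\<psi> ` W = U" unfolding W_def using inv(1) by (metis surj_def surj_image_vimage_eq)
  have inj: "inj_on \<psi> W" using inv(2) by (metis inj_onI)
  have D: "(\<psi> has_derivative L) (at y)" for y
    unfolding \<psi>_def using bounded_linear_imp_has_derivative[OF L]
    by (auto intro!: derivative_eq_intros)
  have "matrix L = (\<chi> i j. if j = 1 then a $ i else b $ i)"
    by (simp add: matrix_def L_def vec_eq_iff forall_2 axis_def)
  then have "det (matrix L) > 0" using ab by (simp add: det_2 mult.commute)
  moreover have "smooth_on U (inv_into W \<psi>)"
  proof -
    have "smooth_on U (\<lambda>x. R (x - p))"
      by (rule smooth_on_linear_compose[OF open_U R smooth_on_diff[OF open_U
              smooth_on_bounded_linear[OF bounded_linear_ident] smooth_on_const]])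
    moreover have "inv_into W \<psi> x = R (x - p)" if "x \<in> U" for x
      using that inv(1)[of x] img by (intro inv_into_f_eq[OF inj]) (auto simp: W_def)
    ultimately show ?thesis by (simp cong: smooth_on_cong[OF open_U])
  qed
  ultimately have pos: "positive_coordinates U p W \<psi>"
    unfolding positive_coordinates_def frechet_derivative_at[OF D, symmetric] img
    using W open_U inj smooth_\<psi>[OF W(1)] by (simp add: \<psi>_def L0)
  have "\<psi> 0 = p" by (simp add: \<psi>_def L0)
  moreover have "frechet_derivative \<psi> (at 0) e_v = b"
    unfolding frechet_derivative_at[OF D, symmetric] by (simp add: L_def axis_def)
  ultimately have "tangent_map M (f \<circ> \<psi>) 0 e_v = tangent_map M f p b"
    using tangent_map_compose[OF smooth_f, of \<psi> 0 e_v] D[of 0] V_U[OF p]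
    by (simp add: differentiableI)
  also have "\<dots> = (\<lambda>_. 0)"
  proof (rule tangent_eqI[OF _ _ V_chart[OF p]])
    show t: "tangent_map M f p b \<in> tangent_space M (f p)"
      by (rule tangent_map_tangent[OF smooth_f open_U V_U[OF p]])
    show "(\<lambda>_. 0) \<in> tangent_space M (f p)" by (rule zero_tangent[OF t])
    show "tangent_map M f p b c = 0"
      by (simp add: tangent_map_chart[OF p] frechet_derivative_F_Xv[OF p] b)
  qed
  finally show ?thesis using pos unfolding admissible_coordinates_def by blast
qed

text \<open>Discharges the \<open>THE\<close> of the definition: admissible coordinates exist, and
  each of them yields the quotient for a direction outside the kernel, hence the value for
  \<open>a\<close>.\<close>

lemma limiting_normal_curvature_eq:
  fixes a b :: "real^2"
  assumes p: "p \<in> V" and b: "b \<noteq> 0" "Xv p b = 0" and a: "Xv p a \<noteq> 0"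
    and ab: "a $ 1 * b $ 2 - a $ 2 * b $ 1 > 0"
  shows "limiting_normal_curvature M U f \<nu> p = normal_quotient p a"
proof -
  have eq: "normal_curvature_quotient M (f \<circ> \<psi>) (\<nu> p) = normal_quotient p a"
    if adm: "admissible_coordinates M U f p W \<psi>" for W \<psi>
  proof -
    have pos: "positive_coordinates U p W \<psi>" and ev: "tangent_map M (f \<circ> \<psi>) 0 e_v = (\<lambda>_. 0)"
      using adm by (auto simp: admissible_coordinates_def)
    then have \<psi>: "\<psi> 0 = p" "\<psi> differentiable (at 0)" "det (matrix (frechet_derivative \<psi> (at 0))) > 0"
      using smooth_on_differentiable by (auto simp: positive_coordinates_def)
    let ?D = "frechet_derivative \<psi> (at 0)"
    have "tangent_map M f p (?D e_v) = (\<lambda>_. 0)"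
      using tangent_map_compose[OF smooth_f, of \<psi> 0 e_v] ev \<psi> V_U[OF p] by simp
    from fun_cong[OF this, of c] have v: "Xv p (?D e_v) = 0"
      by (simp add: tangent_map_chart[OF p] frechet_derivative_F_Xv[OF p])
    have det: "?D e_u $ 1 * ?D e_v $ 2 - ?D e_v $ 1 * ?D e_u $ 2 \<noteq> 0"
      using \<psi>(3) by (simp add: det_2 matrix_def)
    \<comment> \<open>The columns of the coordinate derivative span the plane and the second lies in
      the kernel; if the first did too, \<open>Xv p a\<close> would vanish.\<close>
    have "Xv p (?D e_u) \<noteq> 0"
    proof
      assume u: "Xv p (?D e_u) = 0"
      let ?u = "?D e_u" and ?v = "?D e_v"
      let ?d = "?u $ 1 * ?v $ 2 - ?v $ 1 * ?u $ 2"
      have "?d *\<^sub>R a = (a $ 1 * ?v $ 2 - ?v $ 1 * a $ 2) *\<^sub>R ?u + (?u $ 1 * a $ 2 - a $ 1 * ?u $ 2) *\<^sub>R ?v"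
        by (simp add: vec_eq_iff forall_2 algebra_simps)
      then have "Xv p (?d *\<^sub>R a + 0 *\<^sub>R a) = 0"
        using Xv_linear[of p _ ?u _ ?v] u v by simp
      then show False using a det unfolding Xv_linear by simp
    qed
    then show ?thesis
      unfolding normal_curvature_quotient_eq[OF p pos]
      by (intro normal_quotient_indep[OF p b a])
  qed
  obtain W \<psi> where adm: "admissible_coordinates M U f p W \<psi>"
    using admissible_coordinates_exist[OF p b(2) ab] by blast
  show ?thesis
    unfolding limiting_normal_curvature_def
  proof (rule the_equality)
    show "\<exists>V \<psi>. admissible_coordinates M U f p V \<psi> \<and>
        normal_quotient p a = normal_curvature_quotient M (f \<circ> \<psi>) (\<nu> p)"
      by (intro exI conjI) (rule adm, rule eq[OF adm, symmetric])
  qed (auto dest: eq)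
qed

lemma singular_curv_eq_0:
  assumes p: "p \<in> V" and b: "b \<noteq> 0" "Xv p b = 0"
  shows "curv p = 0"
proof (cases "b $ 1 = 0")
  case True
  then have "b $ 2 \<noteq> 0" using b(1) by (auto simp: vec_eq_iff forall_2)
  then have "partial 2 F p = 0" using b(2) True by (simp add: Xv_def sum_2)
  then show ?thesis using curv_eq_0[OF p, of 1 "partial 1 F p" 0] by simp
next
  case False
  have "b $ 1 *\<^sub>R partial 1 F p = - (b $ 2 *\<^sub>R partial 2 F p)"
    using b(2) by (simp add: Xv_def sum_2 eq_neg_iff_add_eq_0)
  then have "inverse (b $ 1) *\<^sub>R (b $ 1 *\<^sub>R partial 1 F p) = (- inverse (b $ 1) * b $ 2) *\<^sub>R partial 2 F p"
    by simp
  then have "partial 1 F p = (- inverse (b $ 1) * b $ 2) *\<^sub>R partial 2 F p"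
    using False by simp
  then show ?thesis by (rule curv_eq_0[OF p, of _ "partial 2 F p" 1]) simp
qed

theorem limiting_normal_curvature_eq_0_iff:
  assumes p: "p \<in> V" "p \<in> singular_set M U f" "nondegenerate_at M f \<nu> p"
  shows "limiting_normal_curvature M U f \<nu> p = 0 \<longleftrightarrow> curvature_density p = 0"
    and "limiting_normal_curvature M U f \<nu> p = 0 \<longleftrightarrow> gauss_area p = 0"
proof -
  obtain a b where b: "b \<noteq> 0" "Xv p b = 0" and a: "Xv p a \<noteq> 0"
    and ab: "a $ 1 * b $ 2 - a $ 2 * b $ 1 > 0" by (rule singular_kernel[OF p])
  have "ip p (Xv p a) (Xv p a) > 0"
    using gram_matrix.pos[OF gram_matrix_3.axioms[OF gram[OF p(1)]] a] by (simp add: ip_def)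
  then have "limiting_normal_curvature M U f \<nu> p = 0 \<longleftrightarrow> ip p (Xv p a) (Nv p a) = 0"
    unfolding limiting_normal_curvature_eq[OF p(1) b a ab] normal_quotient_def by simp
  also have "\<dots> \<longleftrightarrow> gauss_area p = 0"
    using gauss_area_eq_0_iff[OF p(1), of a b] ab b a immersion[OF p(1) b(1)]
    by (simp add: Xv_def Nv_def)
  finally show 1: "limiting_normal_curvature M U f \<nu> p = 0 \<longleftrightarrow> gauss_area p = 0" .
  show "limiting_normal_curvature M U f \<nu> p = 0 \<longleftrightarrow> curvature_density p = 0"
    unfolding 1 curvature_density_eq_0_iff[OF p(1) singular_curv_eq_0[OF p(1) b]] ..
qed

end

section \<open>The two sides of a regular zero set\<close>

lemma two_sides_commute: "two_sides W C S T \<Longrightarrow> two_sides W C T S"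
  unfolding two_sides_def by blast

text \<open>\<open>g\<close> is completed to a local diffeomorphism whose first component is
  \<open>g\<close>. The two sides are the preimages of the half balls, which are connected because
  half balls are convex.\<close>

lemma zero_set_two_sides:
  fixes g :: "real^2 \<Rightarrow> real"
  assumes V: "open V" and g: "smooth_on V g" and p: "p \<in> V" "g p = 0"
    and dg: "frechet_derivative g (at p) \<noteq> (\<lambda>_. 0)"
    and C: "\<And>x. x \<in> V \<Longrightarrow> x \<in> C \<longleftrightarrow> g x = 0"
  shows "\<exists>W. p \<in> W \<and> W \<subseteq> V \<and> two_sides W C {x \<in> W. g x > 0} {x \<in> W. g x < 0}"
proof -
  define d1 d2 where "d1 = partial 1 g p" and "d2 = partial 2 g p"
  have Dg: "frechet_derivative g (at p) a = a $ 1 * d1 + a $ 2 * d2" for a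
    by (simp add: frechet_derivative_eq_sum_partial[OF smooth_on_differentiable[OF g p(1)]] sum_2
        d1_def d2_def)
  have d: "d1\<^sup>2 + d2\<^sup>2 \<noteq> 0"
  proof
    assume "d1\<^sup>2 + d2\<^sup>2 = 0"
    then have "frechet_derivative g (at p) = (\<lambda>_. 0)" by (simp add: Dg[abs_def] sum_power2_eq_zero_iff fun_eq_iff)
    then show False using dg by simp
  qed
  \<comment> \<open>The second component is linear with gradient the quarter turn of
    \<open>(d1, d2)\<close>, so the Jacobian determinant at \<open>p\<close> is
    \<open>d1\<^sup>2 + d2\<^sup>2\<close>.\<close>
  define \<Phi> where "\<Phi> = (\<lambda>x. axis 1 (g x) + axis 2 (d1 * x $ 2 - d2 * x $ 1) :: real^2)"
  have \<Phi>: "smooth_on V \<Phi>"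
    unfolding \<Phi>_def
    by (intro smooth_on_add smooth_on_linear_compose[OF V bounded_linear_axis] V g smooth_on_diff
        smooth_on_mult smooth_on_const smooth_on_bounded_linear bounded_linear_vec_nth)
  have \<Phi>1: "\<Phi> x $ 1 = g x" for x by (simp add: \<Phi>_def axis_def)
  define \<Phi>' where "\<Phi>' = (\<lambda>x. Blinfun (frechet_derivative \<Phi> (at x)))"
  have app: "blinfun_apply (\<Phi>' x) = frechet_derivative \<Phi> (at x)" if "x \<in> V" for x
    unfolding \<Phi>'_def
    by (rule bounded_linear_Blinfun_apply[OF has_derivative_bounded_linear[OF smooth_on_has_derivative[OF \<Phi> that]]])
  \<comment> \<open>The inverse function theorem asks for continuity in operator norm, which in
    finite dimension can be tested on vectors.\<close>
  have "continuous_on V \<Phi>'"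
  proof (rule continuous_on_blinfun_componentwise)
    fix i :: "real^2"
    show "continuous_on V (\<lambda>x. blinfun_apply (\<Phi>' x) i)"
      using smooth_on_continuous[OF smooth_on_frechet_derivative[OF \<Phi>], of i]
      by (rule continuous_on_eq) (simp add: app)
  qed
  have D\<Phi>: "frechet_derivative \<Phi> (at p) a =
      axis 1 (a $ 1 * d1 + a $ 2 * d2) + axis 2 (d1 * a $ 2 - d2 * a $ 1)" for a
  proof -
    have "((\<lambda>x. axis 2 (d1 * x $ 2 - d2 * x $ 1) :: real^2) has_derivative
        (\<lambda>a. axis 2 (d1 * a $ 2 - d2 * a $ 1))) (at p)"
      by (intro bounded_linear.has_derivative[OF bounded_linear_axis] has_derivative_diff
          has_derivative_mult_right bounded_linear_imp_has_derivative bounded_linear_vec_nth)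
    from has_derivative_add[OF bounded_linear.has_derivative[OF bounded_linear_axis
          smooth_on_has_derivative[OF g p(1)]] this]
    have "(\<Phi> has_derivative (\<lambda>a. axis 1 (frechet_derivative g (at p) a)
        + axis 2 (d1 * a $ 2 - d2 * a $ 1))) (at p)" unfolding \<Phi>_def .
    from fun_cong[OF frechet_derivative_at[OF this], of a] show ?thesis unfolding Dg by simp
  qed
  have lin: "linear (blinfun_apply (\<Phi>' p))" by (rule bounded_linear.linear[OF blinfun.bounded_linear_right])
  have "inj (blinfun_apply (\<Phi>' p))"
    unfolding linear_injective_0[OF lin] unfolding app[OF p(1)] D\<Phi>
  proof (intro allI impI)
    fix a :: "real^2" assume "axis 1 (a $ 1 * d1 + a $ 2 * d2) + axis 2 (d1 * a $ 2 - d2 * a $ 1) = (0 :: real^2)"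
    then have "a $ 1 * d1 + a $ 2 * d2 = 0" "d1 * a $ 2 - d2 * a $ 1 = 0"
      by (auto simp: vec_eq_iff forall_2 axis_def)
    moreover have "(d1\<^sup>2 + d2\<^sup>2) * a $ 1 = d1 * (a $ 1 * d1 + a $ 2 * d2) - d2 * (d1 * a $ 2 - d2 * a $ 1)"
      "(d1\<^sup>2 + d2\<^sup>2) * a $ 2 = d2 * (a $ 1 * d1 + a $ 2 * d2) + d1 * (d1 * a $ 2 - d2 * a $ 1)"
      by (simp_all add: algebra_simps power2_eq_square)
    ultimately show "a = 0" using d by (auto simp: vec_eq_iff forall_2)
  qed
  then obtain R where R: "linear R" "R \<circ> blinfun_apply (\<Phi>' p) = id"
    using linear_injective_left_inverse[OF lin] by blast
  have "Blinfun R o\<^sub>L \<Phi>' p = id_blinfun"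
    using R by (intro blinfun_eqI)
      (simp add: bounded_linear_Blinfun_apply linear_conv_bounded_linear[THEN iffD1] fun_eq_iff)
  then obtain U' V' \<Psi> \<Psi>' where inv: "open U'" "U' \<subseteq> V" "p \<in> U'" "open V'" "\<Phi> p \<in> V'" "homeomorphism U' V' \<Phi> \<Psi>"
    using inverse_function_theorem[OF V _ \<open>continuous_on V \<Phi>'\<close> p(1)]
      smooth_on_has_derivative[OF \<Phi>] app by metis
  obtain r where r: "r > 0" "ball (\<Phi> p) r \<subseteq> V'" using inv(4,5) openE by blast
  \<comment> \<open>The centre \<open>\<Phi> p\<close> lies on the line where the first coordinate
    is zero, so the ball meets both half planes.\<close>
  define B where "B = ball (\<Phi> p) r"
  define W where "W = \<Psi> ` B"
  have BV: "B \<subseteq> V'" using r by (simp add: B_def)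
  have \<Psi>_cont: "continuous_on V' \<Psi>" and \<Phi>\<Psi>: "\<And>y. y \<in> V' \<Longrightarrow> \<Phi> (\<Psi> y) = y"
    and \<Psi>\<Phi>: "\<And>x. x \<in> U' \<Longrightarrow> \<Psi> (\<Phi> x) = x" and \<Psi>V: "\<Psi> ` V' = U'"
    using inv(6) by (auto simp: homeomorphism_def)
  have open_img: "open (\<Psi> ` A)" if "open A" "A \<subseteq> V'" for A
  proof -
    have "openin (top_of_set U') (\<Psi> ` A)"
      using homeomorphism_imp_open_map[OF homeomorphism_symD[OF inv(6)], of A] that inv(4)
      by (simp add: openin_open_eq)
    then show ?thesis using inv(1) openin_open_eq by blast
  qed
  have g\<Psi>: "g (\<Psi> y) = y $ 1" if "y \<in> V'" for y
    using \<Phi>1[of "\<Psi> y"] \<Phi>\<Psi>[OF that] by simp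
  have \<Phi>p1: "\<Phi> p $ 1 = 0" by (simp add: \<Phi>1 p)
  have side: "open (\<Psi> ` (B \<inter> H)) \<and> connected (\<Psi> ` (B \<inter> H))" if "open H" "convex H" for H
  proof -
    have sub: "B \<inter> H \<subseteq> V'" using BV by blast
    have "connected (B \<inter> H)" using that by (intro convex_connected convex_Int) (simp_all add: B_def)
    moreover have "open (B \<inter> H)" using that by (simp add: B_def open_Int)
    ultimately show ?thesis
      using open_img[OF _ sub] connected_continuous_image[OF continuous_on_subset[OF \<Psi>_cont sub]]
      by blast
  qed
  \<comment> \<open>A short move along \<open>z\<close> stays in the ball and enters
    \<open>H\<close>. With \<open>z\<close> the first unit vector or its negative, every point of
    the zero line is a limit of either half.\<close>
  have near: "\<exists>y'\<in>B \<inter> H. dist y' y < e"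
    if "y \<in> B" "e > 0" "\<And>t. t > 0 \<Longrightarrow> y + t *\<^sub>R z \<in> H" "norm z = 1" for y e H and z :: "real^2"
  proof -
    obtain s where s: "s > 0" "ball y s \<subseteq> B" using \<open>y \<in> B\<close> openE[of B y] by (auto simp: B_def)
    define t where "t = min s e / 2"
    have t: "t > 0" "t < s" "t < e" using s(1) that(2) by (auto simp: t_def)
    have "dist (y + t *\<^sub>R z) y = t" using t(1) that(4) by (simp add: dist_norm)
    then show ?thesis using t s(2) that(3)[OF t(1)]
      by (intro bexI[of _ "y + t *\<^sub>R z"]) (auto simp: dist_commute)
  qed
  have clos: "\<Psi> y \<in> closure (\<Psi> ` (B \<inter> H))"
    if y: "y \<in> B" and z: "\<And>t. t > 0 \<Longrightarrow> y + t *\<^sub>R z \<in> H" "norm z = 1" for y H and z :: "real^2"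
    unfolding closure_approachable
  proof (intro allI impI)
    fix e :: real assume "e > 0"
    have "isCont \<Psi> y" using \<Psi>_cont inv(4) BV y by (meson continuous_on_eq_continuous_at subsetD)
    then obtain s where s: "s > 0" "\<And>y'. dist y' y < s \<Longrightarrow> dist (\<Psi> y') (\<Psi> y) < e"
      using \<open>e > 0\<close> unfolding continuous_at_eps_delta by blast
    obtain y' where "y' \<in> B \<inter> H" "dist y' y < s" using near[OF y s(1) z] by blast
    then show "\<exists>x\<in>\<Psi> ` (B \<inter> H). dist x (\<Psi> y) < e" using s(2) by blast
  qed
  let ?P = "{y :: real^2. y $ 1 > 0}" and ?Q = "{y :: real^2. y $ 1 < 0}"
  have S: "{x \<in> W. g x > 0} = \<Psi> ` (B \<inter> ?P)" and T: "{x \<in> W. g x < 0} = \<Psi> ` (B \<inter> ?Q)"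
    using g\<Psi> BV by (auto simp: W_def)
  have op: "open ?P" "convex ?P" "open ?Q" "convex ?Q"
    using convex_halfspace_gt[of 0 "axis 1 1 :: real^2"] convex_halfspace_lt[of "axis 1 1 :: real^2" 0]
    by (simp_all add: open_halfspace_component_gt_cart open_halfspace_component_lt_cart inner_axis')
  have Wside: "open W \<and> connected W" using side[of UNIV] by (simp add: W_def)
  have "p \<in> W" 
    unfolding W_def by (rule image_eqI[of _ _ "\<Phi> p"]) (simp_all add: \<Psi>\<Phi>[OF inv(3)] B_def r(1))
  have "W \<subseteq> V" using \<Psi>V BV inv(2) by (auto simp: W_def)
  have pB: "\<Phi> p \<in> B" using r by (simp add: B_def)
  have e1: "norm (axis 1 1 :: real^2) = 1" "norm (- axis 1 1 :: real^2) = 1" by simp_all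
  have zero_clos: "\<Psi> y \<in> closure (\<Psi> ` (B \<inter> ?P)) \<and> \<Psi> y \<in> closure (\<Psi> ` (B \<inter> ?Q))"
    if "y \<in> B" "y $ 1 = 0" for y
    using that by (intro conjI clos[OF _ _ e1(1)] clos[OF _ _ e1(2)]) auto
  have "W \<inter> C \<subseteq> closure {x \<in> W. g x > 0} \<inter> closure {x \<in> W. g x < 0}"
  proof
    fix x assume x: "x \<in> W \<inter> C"
    then obtain y where y: "y \<in> B" "x = \<Psi> y" by (auto simp: W_def)
    have "g x = 0" using x C \<open>W \<subseteq> V\<close> by blast
    then have "y $ 1 = 0" using g\<Psi>[of y] y BV by auto
    then show "x \<in> closure {x \<in> W. g x > 0} \<inter> closure {x \<in> W. g x < 0}"
      unfolding S T using zero_clos[OF y(1)] y(2) by blast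
  qed
  moreover have "{x \<in> W. g x > 0} \<noteq> {}" "{x \<in> W. g x < 0} \<noteq> {}"
    unfolding S T using zero_clos[OF pB \<Phi>p1] by (metis closure_empty empty_iff)+
  moreover have "{x \<in> W. g x > 0} \<union> {x \<in> W. g x < 0} = W - C"
    using C \<open>W \<subseteq> V\<close> by fastforce
  moreover have "{x \<in> W. g x > 0} \<inter> {x \<in> W. g x < 0} = {}" by force
  ultimately have "two_sides W C {x \<in> W. g x > 0} {x \<in> W. g x < 0}"
    unfolding two_sides_def using Wside side[OF op(1,2)] side[OF op(3,4)] S T by simp
  then show ?thesis using \<open>p \<in> W\<close> \<open>W \<subseteq> V\<close> by blast
qed

section \<open>Extension and sign change of the curvature\<close>

context front_chart
begin

lemma singular_neighbourhood:
  assumes p: "p \<in> singular_set M U f" "nondegenerate_at M f \<nu> p" and W: "open W" "p \<in> W" "W \<subseteq> V"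
  shows "\<exists>W'. p \<in> W' \<and> W' \<subseteq> W \<and>
    two_sides W' (singular_set M U f) {x \<in> W'. density x > 0} {x \<in> W'. density x < 0}"
proof (rule zero_set_two_sides[OF W(1) smooth_on_subset[OF smooth_density W(3)] W(2)])
  have iff: "x \<in> singular_set M U f \<longleftrightarrow> density x = 0" if "x \<in> W" for x
    using that W(3) singular_iff density_eq_0_iff by blast
  then show "x \<in> W \<Longrightarrow> x \<in> singular_set M U f \<longleftrightarrow> density x = 0" for x .
  show "density p = 0" using iff[OF W(2)] p(1) by blast
  have "frechet_derivative (area_density M f \<nu>) (at p) = frechet_derivative density (at p)"
    using W by (intro frechet_derivative_cong_open[OF W(1,2)] area_density_eq) auto
  then show "frechet_derivative density (at p) \<noteq> (\<lambda>_. 0)"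
    using p(2) by (simp add: nondegenerate_at_def)
qed

text \<open>The singular set near \<open>p\<close> lies in the closure of either of its two sides,
  and both sides consist of regular points.\<close>

lemma regular_points_tendsto:
  assumes p: "p \<in> singular_set M U f" "nondegenerate_at M f \<nu> p" and W: "open W" "p \<in> W" "W \<subseteq> V"
  shows "\<exists>x. (\<forall>k. x k \<in> W - singular_set M U f) \<and> x \<longlonglongrightarrow> p"
proof -
  obtain W' where W': "p \<in> W'" "W' \<subseteq> W"
    "two_sides W' (singular_set M U f) {x \<in> W'. density x > 0} {x \<in> W'. density x < 0}"
    using singular_neighbourhood[OF p W] by blast
  have "p \<in> closure {x \<in> W'. density x > 0}"
    using W'(1,3) p(1) unfolding two_sides_def by blast
  moreover have "{x \<in> W'. density x > 0} \<subseteq> W - singular_set M U f"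
    using W'(2,3) unfolding two_sides_def by blast
  ultimately have "p \<in> closure (W - singular_set M U f)" using closure_mono by blast
  then show ?thesis unfolding closure_sequential by blast
qed

text \<open>Values at singular points are limits of values at regular ones. This gives both the
  independence of the chart and the uniqueness of the extended 2-form.\<close>

lemma eq_curvature_density_if_eq_on_regular:
  assumes p: "p \<in> V" and nd: "p \<in> singular_set M U f \<Longrightarrow> nondegenerate_at M f \<nu> p"
    and W: "open W" "p \<in> W" "W \<subseteq> V" and e: "isCont e p"
    and eq: "\<And>x. x \<in> W - singular_set M U f \<Longrightarrow> e x = gauss_curvature M f x * area_density M f \<nu> x"
  shows "e p = curvature_density p"
proof (cases "p \<in> singular_set M U f")
  case False
  then show ?thesis using eq[of p] W(2) K_times_area_density[OF p] by simp
next
  case True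
  obtain x where x: "\<And>k. x k \<in> W - singular_set M U f" "x \<longlonglongrightarrow> p"
    using regular_points_tendsto[OF True nd[OF True] W] by blast
  have "isCont curvature_density p" by (rule smooth_on_isCont[OF smooth_curvature_density p])
  then have "(\<lambda>k. curvature_density (x k)) \<longlonglongrightarrow> curvature_density p"
    using x(2) isCont_tendsto_compose by blast
  moreover have "(\<lambda>k. e (x k)) \<longlonglongrightarrow> e p" using e x(2) isCont_tendsto_compose by blast
  moreover have "e (x k) = curvature_density (x k)" for k
    using eq[OF x(1)] K_times_area_density[of "x k"] x(1)[of k] W(3) by auto
  ultimately show ?thesis using LIMSEQ_unique by simp
qed

text \<open>A bound on \<open>K\<close> would bound \<open>curvature_density\<close> by a multiple
  of \<open>density\<close> at regular points; in the limit at \<open>p\<close> the latter is zero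
  and the former is not.\<close>

lemma curvature_unbounded:
  assumes p: "p \<in> singular_set M U f" "nondegenerate_at M f \<nu> p" "p \<in> V"
    and nz: "curvature_density p \<noteq> 0"
  shows "unbounded_near (gauss_curvature M f) (U - singular_set M U f) p"
  unfolding unbounded_near_def
proof (intro allI impI notI)
  fix W assume W: "open W \<and> p \<in> W" and "bounded (gauss_curvature M f ` (W \<inter> (U - singular_set M U f)))"
  then obtain b where b: "\<And>x. x \<in> W \<inter> (U - singular_set M U f) \<Longrightarrow> \<bar>gauss_curvature M f x\<bar> \<le> b"
    unfolding bounded_iff by auto
  have "open (W \<inter> V)" "p \<in> W \<inter> V" "W \<inter> V \<subseteq> V" using W open_V p(3) by auto
  from regular_points_tendsto[OF p(1,2) this]
  obtain x where x: "\<And>k. x k \<in> W \<inter> V - singular_set M U f" "x \<longlonglongrightarrow> p" by blast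
  have le: "\<bar>curvature_density (x k)\<bar> \<le> b * \<bar>density (x k)\<bar>" for k
  proof -
    have xk: "x k \<in> V" "x k \<notin> singular_set M U f" "x k \<in> W \<inter> (U - singular_set M U f)"
      using x(1)[of k] V_U by auto
    then show ?thesis
      using K_times_area_density[OF xk(1,2)] b[OF xk(3)]
      by (metis abs_ge_zero abs_mult area_density_eq mult_right_mono)
  qed
  have "(\<lambda>k. \<bar>curvature_density (x k)\<bar>) \<longlonglongrightarrow> \<bar>curvature_density p\<bar>"
    using smooth_on_isCont[OF smooth_curvature_density p(3)] x(2)
    by (intro tendsto_rabs) (rule isCont_tendsto_compose)
  moreover have "(\<lambda>k. b * \<bar>density (x k)\<bar>) \<longlonglongrightarrow> b * \<bar>density p\<bar>"
    using smooth_on_isCont[OF smooth_density p(3)] x(2)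
    by (intro tendsto_mult tendsto_const tendsto_rabs) (rule isCont_tendsto_compose)
  ultimately have "\<bar>curvature_density p\<bar> \<le> b * \<bar>density p\<bar>"
    using le by (intro LIMSEQ_le) auto
  moreover have "density p = 0" using p(1,3) singular_iff density_eq_0_iff by blast
  ultimately show False using nz by simp
qed

lemma curvature_changes_sign:
  assumes p: "p \<in> singular_set M U f" "nondegenerate_at M f \<nu> p" "p \<in> V"
    and nz: "curvature_density p \<noteq> 0"
  shows "changes_sign_across (gauss_curvature M f) U (singular_set M U f) p"
proof -
  \<comment> \<open>A neighbourhood on which \<open>curvature_density\<close> has the sign it has at
    \<open>p\<close>; there the sign of \<open>K\<close> is governed by that of
    \<open>density\<close>.\<close>
  define W where "W = V \<inter> (\<lambda>x. curvature_density x * curvature_density p) -` {0<..}"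
  have "continuous_on V (\<lambda>x. curvature_density x * curvature_density p)"
    by (intro continuous_intros smooth_on_continuous smooth_curvature_density)
  then have "open W" unfolding W_def using open_V by (intro continuous_open_preimage) auto
  moreover have "p \<in> W" using p(3) nz by (simp add: W_def zero_less_mult_iff) linarith
  moreover have "W \<subseteq> V" by (simp add: W_def)
  ultimately obtain W' where W': "p \<in> W'" "W' \<subseteq> W" and
    sides: "two_sides W' (singular_set M U f) {x \<in> W'. density x > 0} {x \<in> W'. density x < 0}"
    using singular_neighbourhood[OF p(1,2)] by blast
  have K: "gauss_curvature M f x * density x = curvature_density x"
    "curvature_density x * curvature_density p > 0" if "x \<in> W'" "density x \<noteq> 0" for x
    using K_times_area_density[of x] that W'(2) singular_iff[of x] density_eq_0_iff[of x]
    by (auto simp: W_def area_density_eq)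
  have "W' \<subseteq> U" using W'(2) V_U by (auto simp: W_def)
  show ?thesis
  proof (cases "curvature_density p > 0")
    case True
    have "gauss_curvature M f x > 0" if "x \<in> W'" "density x > 0" for x
      using K[of x] that True by (metis less_irrefl zero_less_mult_pos2)
    moreover have "gauss_curvature M f x < 0" if "x \<in> W'" "density x < 0" for x
      using K[of x] that True by (smt (verit) mult_nonneg_nonpos zero_less_mult_pos2)
    ultimately show ?thesis
      unfolding changes_sign_across_def using W'(1) \<open>W' \<subseteq> U\<close> sides by blast
  next
    case False
    then have neg: "curvature_density p < 0" using nz by simp
    have "curvature_density x < 0" if "x \<in> W'" "density x \<noteq> 0" for x
      using K(2)[OF that] neg by (simp add: zero_less_mult_iff)
    then have "gauss_curvature M f x < 0" if "x \<in> W'" "density x > 0" for x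
      using K(1)[of x] that by (smt (verit) mult_nonneg_nonneg)
    moreover have "gauss_curvature M f x > 0" if "x \<in> W'" "density x < 0" for x
      using K(1)[of x] that \<open>\<And>x. x \<in> W' \<Longrightarrow> density x \<noteq> 0 \<Longrightarrow> curvature_density x < 0\<close>[of x]
      by (smt (verit) mult_nonpos_nonpos)
    ultimately show ?thesis
      unfolding changes_sign_across_def using W'(1) \<open>W' \<subseteq> U\<close> two_sides_commute[OF sides] by blast
  qed
qed

text \<open>Makes the density a constant that takes the chart as a parameter, so that the chart may
  vary with the point in \<open>extension\<close>.\<close>

definition K_dA :: "real^2 \<Rightarrow> real" where "K_dA = curvature_density"

lemma gauss_area_eq_0_iff_dependent:
  assumes "x \<in> V"
  shows "gauss_area x = 0 \<longleftrightarrow> (\<exists>a. a \<noteq> 0 \<and> Nv x a = 0)"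
  unfolding gauss_area_def Nv_def sum_2
  by (rule gram_matrix_3.det_eq_0_iff_dependent[OF gram[OF assms] unit[OF assms]
        N_tangent[OF assms] N_tangent[OF assms]])

end

section \<open>Gluing over all charts of the ambient manifold\<close>

locale nondegenerate_front = riem_manifold M
  for M :: "('m::{t2_space, second_countable_topology}, 3) riem" +
  fixes U :: "(real^2) set" and f :: "real^2 \<Rightarrow> 'm" and \<nu> :: "real^2 \<Rightarrow> ('m, 3) tvec"
  assumes open_U: "open U" and front: "front M U f \<nu>"
    and nondegenerate: "\<And>p. p \<in> singular_set M U f \<Longrightarrow> nondegenerate_at M f \<nu> p"
begin

lemma front_chart: "c \<in> atlas M \<Longrightarrow> front_chart M U f \<nu> c"
  by (intro front_chart.intro riem_manifold_axioms front_chart_axioms.intro open_U front)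

lemma chart_exists: "x \<in> U \<Longrightarrow> \<exists>c. c \<in> charts_at M (f x)"
proof -
  assume "x \<in> U"
  then have "f x \<in> carrier M" using front by (auto simp: front_def smooth_map_into_def)
  then show ?thesis by (simp only: carrier_def charts_at_def) blast
qed

definition extension :: "real^2 \<Rightarrow> real" where
  "extension x = front_chart.K_dA M f \<nu> (SOME c. c \<in> charts_at M (f x)) x"

text \<open>Where two charts overlap, both densities equal \<open>K\<close> times the area density
  at regular points, hence agree at \<open>x\<close> by continuity. Near a given point one chart may
  therefore be used throughout, which yields smoothness.\<close>

lemma extension_eq:
  assumes x: "x \<in> U" and c: "c \<in> charts_at M (f x)"
  shows "extension x = front_chart.K_dA M f \<nu> c x"
proof -
  define c' where "c' = (SOME c. c \<in> charts_at M (f x))"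
  have c': "c' \<in> charts_at M (f x)" unfolding c'_def using c by (rule someI)
  interpret C: front_chart M U f \<nu> c using front_chart charts_atD[OF c] by blast
  interpret C': front_chart M U f \<nu> c' using front_chart charts_atD[OF c'] by blast
  have xV: "x \<in> C.V" "x \<in> C'.V" using x c c' by (auto simp: C.V_def C'.V_def charts_at_def)
  have "C'.K_dA x = C.curvature_density x"
  proof (rule C.eq_curvature_density_if_eq_on_regular[OF xV(1) nondegenerate])
    show "open (C.V \<inter> C'.V)" using C.open_V C'.open_V by blast
    show "x \<in> C.V \<inter> C'.V" "C.V \<inter> C'.V \<subseteq> C.V" using xV by auto
    show "isCont C'.K_dA x"
      unfolding C'.K_dA_def by (rule smooth_on_isCont[OF C'.smooth_curvature_density xV(2)])
    show "C'.K_dA y = gauss_curvature M f y * area_density M f \<nu> y"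
      if "y \<in> C.V \<inter> C'.V - singular_set M U f" for y
      using C'.K_times_area_density[of y] that by (simp add: C'.K_dA_def)
  qed
  then show ?thesis by (simp add: extension_def c'_def[symmetric] C.K_dA_def)
qed

lemma extension_regular:
  assumes "x \<in> U - singular_set M U f"
  shows "extension x = gauss_curvature M f x * area_density M f \<nu> x"
proof -
  obtain c where c: "c \<in> charts_at M (f x)" using assms chart_exists by blast
  interpret C: front_chart M U f \<nu> c using front_chart charts_atD[OF c] by blast
  have "x \<in> C.V" using assms c by (auto simp: C.V_def charts_at_def)
  then show ?thesis
    using C.K_times_area_density[of x] assms extension_eq[OF _ c] by (simp add: C.K_dA_def)
qed

lemma smooth_extension: "smooth_on U extension"
proof (rule smooth_on_local)
  fix x assume x: "x \<in> U"
  then obtain c where c: "c \<in> charts_at M (f x)" using chart_exists by blast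
  interpret C: front_chart M U f \<nu> c using front_chart charts_atD[OF c] by blast
  have "smooth_on C.V extension \<longleftrightarrow> smooth_on C.V C.K_dA"
    using extension_eq C.V_U C.V_chart by (intro smooth_on_cong[OF C.open_V]) blast
  then have "smooth_on C.V extension" by (simp add: C.K_dA_def C.smooth_curvature_density)
  moreover have "x \<in> C.V" using x c by (auto simp: C.V_def charts_at_def)
  ultimately show "\<exists>T. open T \<and> x \<in> T \<and> smooth_on T extension" using C.open_V by blast
qed

lemma smooth_extension_K_dA:
  "smooth_extension_K_dA M U f \<nu> (\<lambda>x a b. extension x * du_wedge_dv x a b)"
  unfolding smooth_extension_K_dA_def smooth_two_form_def
proof (intro conjI ballI allI)
  fix x a b
  show "bilinear (\<lambda>a b. extension x * du_wedge_dv x a b)"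
    unfolding bilinear_def du_wedge_dv_def by (auto intro!: linearI simp: algebra_simps)
  show "extension x * du_wedge_dv x a a = 0" by (simp add: du_wedge_dv_def)
  show "smooth_on U (\<lambda>x. extension x * du_wedge_dv x a b)"
    unfolding du_wedge_dv_def by (intro smooth_on_mult smooth_on_const smooth_extension open_U)
  show "extension x * du_wedge_dv x a b =
      gauss_curvature M f x * signed_area_element M f \<nu> x a b" if "x \<in> U - singular_set M U f"
    by (simp add: extension_regular[OF that] signed_area_element_def)
qed

text \<open>An alternating bilinear form on the plane is determined by its value on
  \<open>e_u\<close>, \<open>e_v\<close>, and continuity prescribes this value at \<open>p\<close>.
  Condition (2) thus has the same meaning for every smooth extension.\<close>

lemma extension_unique:
  assumes \<omega>: "smooth_extension_K_dA M U f \<nu> \<omega>" and p: "p \<in> U"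
  shows "(\<forall>a b. \<omega> p a b = 0) \<longleftrightarrow> extension p = 0"
proof -
  have bil: "bilinear (\<omega> p)" and alt: "\<And>a. \<omega> p a a = 0"
    and sm: "smooth_on U (\<lambda>x. \<omega> x e_u e_v)"
    and reg: "\<And>x. x \<in> U - singular_set M U f \<Longrightarrow>
      \<omega> x e_u e_v = gauss_curvature M f x * signed_area_element M f \<nu> x e_u e_v"
    using \<omega> p by (auto simp: smooth_extension_K_dA_def smooth_two_form_def)
  obtain c where c: "c \<in> charts_at M (f p)" using p chart_exists by blast
  interpret C: front_chart M U f \<nu> c using front_chart charts_atD[OF c] by blast
  have pV: "p \<in> C.V" using p c by (auto simp: C.V_def charts_at_def)
  have "\<omega> p e_u e_v = C.curvature_density p"
  proof (rule C.eq_curvature_density_if_eq_on_regular[OF pV nondegenerate C.open_V pV subset_refl])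
    show "isCont (\<lambda>x. \<omega> x e_u e_v) p" by (rule smooth_on_isCont[OF sm p])
    show "\<omega> x e_u e_v = gauss_curvature M f x * area_density M f \<nu> x"
      if "x \<in> C.V - singular_set M U f" for x
      using reg[of x] that C.V_U by (auto simp: signed_area_element_def du_wedge_dv_def axis_def)
  qed
  then have eq: "\<omega> p e_u e_v = extension p" by (simp add: extension_eq[OF p c] C.K_dA_def)
  have "\<omega> p (e_u + e_v) (e_u + e_v) = \<omega> p e_u e_v + \<omega> p e_v e_u"
    using bil by (simp add: bilinear_ladd bilinear_radd alt[of e_u] alt[of e_v])
  then have skew: "\<omega> p e_v e_u = - \<omega> p e_u e_v" using alt[of "e_u + e_v"] by linarith
  have "\<omega> p a b = du_wedge_dv p a b * \<omega> p e_u e_v" for a b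
  proof -
    have "\<omega> p a b = \<omega> p (a $ 1 *\<^sub>R e_u + a $ 2 *\<^sub>R e_v) (b $ 1 *\<^sub>R e_u + b $ 2 *\<^sub>R e_v)"
      using axis_decomp[of a] axis_decomp[of b] by (simp add: sum_2)
    also have "\<dots> = du_wedge_dv p a b * \<omega> p e_u e_v"
      using bil by (simp add: bilinear_ladd bilinear_radd bilinear_lmul bilinear_rmul alt skew
          du_wedge_dv_def algebra_simps)
    finally show ?thesis .
  qed
  then show ?thesis using eq by (metis mult_zero_right)
qed

theorem singular_point:
  assumes p: "p \<in> singular_set M U f"
  shows "limiting_normal_curvature M U f \<nu> p = 0 \<longleftrightarrow> extension p = 0"
    and "limiting_normal_curvature M U f \<nu> p \<noteq> 0 \<Longrightarrow>
      unbounded_near (gauss_curvature M f) (U - singular_set M U f) p"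
    and "limiting_normal_curvature M U f \<nu> p \<noteq> 0 \<Longrightarrow>
      changes_sign_across (gauss_curvature M f) U (singular_set M U f) p"
proof -
  have pU: "p \<in> U" using p by (simp add: singular_set_def)
  obtain c where c: "c \<in> charts_at M (f p)" using pU chart_exists by blast
  interpret C: front_chart M U f \<nu> c using front_chart charts_atD[OF c] by blast
  have pV: "p \<in> C.V" using pU c by (auto simp: C.V_def charts_at_def)
  note nd = nondegenerate[OF p]
  show iff: "limiting_normal_curvature M U f \<nu> p = 0 \<longleftrightarrow> extension p = 0"
    unfolding C.limiting_normal_curvature_eq_0_iff(1)[OF pV p nd]
    by (simp add: extension_eq[OF pU c] C.K_dA_def)
  assume "limiting_normal_curvature M U f \<nu> p \<noteq> 0"
  then have nz: "C.curvature_density p \<noteq> 0"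
    using C.limiting_normal_curvature_eq_0_iff(1)[OF pV p nd] by simp
  show "unbounded_near (gauss_curvature M f) (U - singular_set M U f) p"
    by (rule C.curvature_unbounded[OF p nd pV nz])
  show "changes_sign_across (gauss_curvature M f) U (singular_set M U f) p"
    by (rule C.curvature_changes_sign[OF p nd pV nz])
qed

end

section \<open>Fronts in Euclidean space\<close>

lemma chart_inv_euclidean: "chart_inv euclidean_chart = id"
  by (simp add: chart_inv_def euclidean_chart_def fun_eq_iff inv_into_f_eq)

lemma transition_euclidean: "transition euclidean_chart euclidean_chart = id"
  by (simp add: transition_def chart_inv_euclidean) (simp add: euclidean_chart_def)

lemma charts_at_euclidean: "charts_at euclidean_space_riem q = {euclidean_chart}"
  by (auto simp: charts_at_def euclidean_space_riem_def) (simp add: euclidean_chart_def)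

lemma metric_matrix_euclidean:
  "metric_matrix (euclidean_space_riem :: (real^'n, 'n::finite) riem) euclidean_chart = (\<lambda>_. mat 1)"
proof
  fix y :: "real^'n"
  let ?M = "euclidean_space_riem :: (real^'n, 'n) riem"
  have coord: "coord_vec ?M euclidean_chart q i euclidean_chart = axis i 1" for q i
    by (simp add: coord_vec_def charts_at_euclidean transition_euclidean)
  have metric: "metric ?M q v w = v euclidean_chart \<bullet> w euclidean_chart" for q v w
    by (simp add: euclidean_space_riem_def)
  have "metric_matrix ?M euclidean_chart y = (\<chi> i j. axis i 1 \<bullet> (axis j 1 :: real^'n))"
    by (simp only: metric_matrix_def Let_def metric coord)
  then show "metric_matrix ?M euclidean_chart y = mat 1"
    by (simp add: vec_eq_iff mat_def inner_axis_axis)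
qed

lemma oriented_riemannian_manifold_euclidean:
  "oriented_riemannian_manifold (euclidean_space_riem :: (real^'n, 'n::finite) riem)"
  unfolding oriented_riemannian_manifold_def
proof
  let ?M = "euclidean_space_riem :: (real^'n, 'n) riem" and ?c = "euclidean_chart :: (real^'n, 'n) chart"
  have atlas: "atlas ?M = {?c}" by (simp add: euclidean_space_riem_def)
  have c: "fst ?c = UNIV" "snd ?c = id" by (simp_all add: euclidean_chart_def)
  have "is_chart ?c"
    by (simp add: is_chart_def c chart_inv_euclidean homeomorphism_def)
  moreover have "smooth_on UNIV (id :: real^'n \<Rightarrow> real^'n)"
    unfolding id_def by (rule smooth_on_bounded_linear[OF bounded_linear_ident])
  moreover have "matrix (id :: real^'n \<Rightarrow> real^'n) = mat 1" by (rule matrix_id_mat_1)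
  ultimately show "oriented_smooth_atlas ?M"
    by (simp add: oriented_smooth_atlas_def atlas c transition_euclidean)
  \<comment> \<open>Positivity of the metric needs the component in the only chart to be nonzero;
    this holds for nonzero tangent vectors because all other components vanish.\<close>
  have T: "v c' = 0" if "v \<in> tangent_space ?M q" "c' \<noteq> ?c" for v q c'
    using that unfolding tangent_space_def charts_at_euclidean by blast
  have "v ?c \<noteq> 0" if "v \<in> tangent_space ?M q" "v \<noteq> (\<lambda>_. 0)" for v q
    using T[OF that(1)] that(2) by (metis ext)
  moreover have "metric ?M q v w = v ?c \<bullet> w ?c" for q v w
    by (simp add: euclidean_space_riem_def)
  ultimately show "riemannian_metric ?M"
    unfolding riemannian_metric_def
    by (auto simp: atlas metric_matrix_euclidean smooth_on_const inner_add_left intro: inner_commute)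
qed

lemma christoffel_const: "christoffel (\<lambda>_. B) x k i j = 0"
  by (simp add: christoffel_def)

text \<open>The Christoffel symbols vanish in the Euclidean chart, so \<open>Nv\<close> is the plain
  derivative of the Gauss map, and \<open>gauss_area\<close> vanishes exactly when this derivative
  has a kernel.\<close>

theorem euclidean_gauss_map:
  fixes M :: "(real^3, 3) riem"
  assumes M: "M = euclidean_space_riem" and "nondegenerate_front M U f \<nu>"
    and p: "p \<in> singular_set M U f"
  shows "limiting_normal_curvature M U f \<nu> p = 0 \<longleftrightarrow>
    \<not> inj (frechet_derivative (gauss_map \<nu>) (at p))"
proof -
  interpret nondegenerate_front M U f \<nu> by fact
  let ?c = "euclidean_chart :: (real^3, 3) chart"
  have c: "?c \<in> charts_at M (f p)" by (simp add: M charts_at_euclidean)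
  interpret C: front_chart M U f \<nu> ?c using front_chart charts_atD[OF c] by blast
  have pV: "p \<in> C.V" using p c by (auto simp: C.V_def charts_at_def singular_set_def)
  have n: "gauss_map \<nu> = C.n" by (simp add: gauss_map_def[abs_def] C.n_def[abs_def])
  have "chris_vec (\<lambda>_. mat 1 :: real^3^3) y u w = 0" for y u w
    by (simp add: chris_vec_def christoffel_const vec_eq_iff)
  then have Nv: "C.Nv p a = frechet_derivative C.n (at p) a" for a
    using C.Nv_eq[OF pV, of a] by (simp add: M metric_matrix_euclidean)
  have lin: "linear (frechet_derivative C.n (at p))"
    by (rule linear_frechet_derivative[OF smooth_on_differentiable[OF C.smooth_n pV]])
  show ?thesis
    unfolding C.limiting_normal_curvature_eq_0_iff(2)[OF pV p nondegenerate[OF p]]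
      C.gauss_area_eq_0_iff_dependent[OF pV] Nv n linear_injective_0[OF lin] by blast
qed

theorem theorem1:
  shows
    "(\<forall>(M :: ('m::{t2_space, second_countable_topology}, 3) riem) (U :: (real^2) set) f \<nu>.
        oriented_riemannian_manifold M \<and> open U \<and> connected U \<and> U \<noteq> {} \<and> front M U f \<nu> \<and>
        (\<forall>p\<in>singular_set M U f. nondegenerate_at M f \<nu> p) \<longrightarrow>
        (\<exists>\<omega>. smooth_extension_K_dA M U f \<nu> \<omega>) \<and>
        (\<forall>p\<in>singular_set M U f.
           (\<forall>\<omega>. smooth_extension_K_dA M U f \<nu> \<omega> \<longrightarrow>
              (limiting_normal_curvature M U f \<nu> p = 0 \<longleftrightarrow> (\<forall>a b. \<omega> p a b = 0))) \<and>
           (limiting_normal_curvature M U f \<nu> p \<noteq> 0 \<longrightarrow>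
              unbounded_near (gauss_curvature M f) (U - singular_set M U f) p \<and>
              changes_sign_across (gauss_curvature M f) U (singular_set M U f) p)))
     \<and>
     (\<forall>(M :: (real^3, 3) riem) (U :: (real^2) set) f \<nu>.
        M = euclidean_space_riem \<and> open U \<and> connected U \<and> U \<noteq> {} \<and> front M U f \<nu> \<and>
        (\<forall>p\<in>singular_set M U f. nondegenerate_at M f \<nu> p) \<longrightarrow>
        (\<forall>p\<in>singular_set M U f.
           (limiting_normal_curvature M U f \<nu> p = 0 \<longleftrightarrow>
              \<not> inj (frechet_derivative (gauss_map \<nu>) (at p))) \<and>
           (\<forall>\<omega>. smooth_extension_K_dA M U f \<nu> \<omega> \<longrightarrow>
              ((\<forall>a b. \<omega> p a b = 0) \<longleftrightarrow>
               \<not> inj (frechet_derivative (gauss_map \<nu>) (at p))))))"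
proof (rule conjI; (intro allI impI)?)
  fix M :: "('m, 3) riem" and U :: "(real^2) set" and f \<nu>
  assume "oriented_riemannian_manifold M \<and> open U \<and> connected U \<and> U \<noteq> {} \<and> front M U f \<nu> \<and>
    (\<forall>p\<in>singular_set M U f. nondegenerate_at M f \<nu> p)"
  then interpret nondegenerate_front M U f \<nu>
    by unfold_locales auto
  have "p \<in> U" if "p \<in> singular_set M U f" for p using that by (simp add: singular_set_def)
  then show "(\<exists>\<omega>. smooth_extension_K_dA M U f \<nu> \<omega>) \<and>
        (\<forall>p\<in>singular_set M U f.
           (\<forall>\<omega>. smooth_extension_K_dA M U f \<nu> \<omega> \<longrightarrow>
              (limiting_normal_curvature M U f \<nu> p = 0 \<longleftrightarrow> (\<forall>a b. \<omega> p a b = 0))) \<and>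
           (limiting_normal_curvature M U f \<nu> p \<noteq> 0 \<longrightarrow>
              unbounded_near (gauss_curvature M f) (U - singular_set M U f) p \<and>
              changes_sign_across (gauss_curvature M f) U (singular_set M U f) p))"
    by (intro conjI ballI allI impI exI[of _ "\<lambda>x a b. extension x * du_wedge_dv x a b"]
        smooth_extension_K_dA singular_point(2,3))
      (simp_all add: singular_point(1) extension_unique)
next
  fix M :: "(real^3, 3) riem" and U :: "(real^2) set" and f \<nu>
  assume asm: "M = euclidean_space_riem \<and> open U \<and> connected U \<and> U \<noteq> {} \<and> front M U f \<nu> \<and>
    (\<forall>p\<in>singular_set M U f. nondegenerate_at M f \<nu> p)"
  then interpret nondegenerate_front M U f \<nu>
    using oriented_riemannian_manifold_euclidean[where 'n = 3] by unfold_locales auto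
  have gm: "limiting_normal_curvature M U f \<nu> p = 0 \<longleftrightarrow> \<not> inj (frechet_derivative (gauss_map \<nu>) (at p))"
    if "p \<in> singular_set M U f" for p
    using asm that by (intro euclidean_gauss_map nondegenerate_front_axioms) auto
  have "p \<in> U" if "p \<in> singular_set M U f" for p using that by (simp add: singular_set_def)
  then show "\<forall>p\<in>singular_set M U f.
           (limiting_normal_curvature M U f \<nu> p = 0 \<longleftrightarrow>
              \<not> inj (frechet_derivative (gauss_map \<nu>) (at p))) \<and>
           (\<forall>\<omega>. smooth_extension_K_dA M U f \<nu> \<omega> \<longrightarrow>
              ((\<forall>a b. \<omega> p a b = 0) \<longleftrightarrow>
               \<not> inj (frechet_derivative (gauss_map \<nu>) (at p))))"
    by (intro conjI ballI allI impI gm) (simp_all add: gm[symmetric] singular_point(1) extension_unique)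
qed

end
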